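(* Let $\Omega\subset\mathbb{R}^3$ be an open set. Let $(E_n)$ and $(H_n)$ be two sequences of vector fields bounded in $L^2(\Omega)$ such that $(\operatorname{curl}E_n)$ and $(\operatorname{div}H_n)$ are also bounded in $L^2(\Omega)$. Then there exist $E,H\in L^2(\Omega)$ with $\operatorname{curl}E\in L^2(\Omega)$ and $\operatorname{div}H\in L^2(\Omega)$, and subsequences, again denoted by $(E_n)$ and $(H_n)$, such that $E_n\rightharpoonup E$, $\operatorname{curl}E_n\rightharpoonup\operatorname{curl}E$, $H_n\rightharpoonup H$, $\operatorname{div}H_n\rightharpoonup\operatorname{div}H$ weakly in $L^2(\Omega)$, and for all $\varphi\in C_c^\infty(\Omega)$ $$\int_\Omega\varphi\,(E_n\cdot H_n)\to\int_\Omega\varphi\,(E\cdot H).$$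
   Context: $\operatorname{curl}$ and $\operatorname{div}$ are taken in the weak (distributional) sense; $C_c^\infty(\Omega)$ denotes smooth scalar functions with compact support in $\Omega$. *)

theory Defs
  imports "HOL-Analysis.Analysis"
begin

text \<open>Functions on \<open>\<Omega>\<close> are total functions whose values outside \<open>\<Omega>\<close> never matter; elements of
  \<open>L\<^sup>2(\<Omega>)\<close> are represented by functions rather than by classes modulo null sets.\<close>

definition L2 :: "(real^3) set \<Rightarrow> (real^3 \<Rightarrow> 'b::euclidean_space) set" where
  "L2 \<Omega> = {f \<in> borel_measurable (lebesgue_on \<Omega>). integrable (lebesgue_on \<Omega>) (\<lambda>x. (norm (f x))\<^sup>2)}"

definition L2_norm_on :: "(real^3) set \<Rightarrow> (real^3 \<Rightarrow> 'b::euclidean_space) \<Rightarrow> real" where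
  "L2_norm_on \<Omega> f = sqrt (\<integral>x. (norm (f x))\<^sup>2 \<partial>lebesgue_on \<Omega>)"

definition L2_bounded :: "(real^3) set \<Rightarrow> (nat \<Rightarrow> real^3 \<Rightarrow> 'b::euclidean_space) \<Rightarrow> bool" where
  "L2_bounded \<Omega> f \<longleftrightarrow> (\<forall>n. f n \<in> L2 \<Omega>) \<and> (\<exists>M. \<forall>n. L2_norm_on \<Omega> (f n) \<le> M)"

definition L2_weakly_converges ::
  "(real^3) set \<Rightarrow> (nat \<Rightarrow> real^3 \<Rightarrow> 'b::euclidean_space) \<Rightarrow> (real^3 \<Rightarrow> 'b) \<Rightarrow> bool" where
  "L2_weakly_converges \<Omega> f g \<longleftrightarrow> (\<forall>n. f n \<in> L2 \<Omega>) \<and> g \<in> L2 \<Omega> \<and>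
     (\<forall>h\<in>L2 \<Omega>. (\<lambda>n. \<integral>x. f n x \<bullet> h x \<partial>lebesgue_on \<Omega>) \<longlonglongrightarrow> (\<integral>x. g x \<bullet> h x \<partial>lebesgue_on \<Omega>))"

primrec C_k :: "nat \<Rightarrow> ('a::euclidean_space \<Rightarrow> real) \<Rightarrow> bool" where
  "C_k 0 f \<longleftrightarrow> continuous_on UNIV f"
| "C_k (Suc k) f \<longleftrightarrow> (\<forall>x. f differentiable at x) \<and>
     (\<forall>b\<in>Basis. C_k k (\<lambda>x. frechet_derivative f (at x) b))"

text \<open>A smooth function with compact support in the open set \<open>\<Omega>\<close> is identified with its
  extension by zero, which is smooth on the whole space.\<close>

definition test_functions :: "(real^3) set \<Rightarrow> (real^3 \<Rightarrow> real) set" where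
  "test_functions \<Omega> = {\<phi>. (\<forall>k. C_k k \<phi>) \<and> compact (closure {x. \<phi> x \<noteq> 0}) \<and>
     closure {x. \<phi> x \<noteq> 0} \<subseteq> \<Omega>}"

definition grad :: "(real^3 \<Rightarrow> real) \<Rightarrow> real^3 \<Rightarrow> real^3" where
  "grad \<phi> x = (\<chi> i. frechet_derivative \<phi> (at x) (axis i 1))"

definition locally_integrable_on :: "(real^3 \<Rightarrow> 'b::euclidean_space) \<Rightarrow> (real^3) set \<Rightarrow> bool"
    (infix \<open>locally'_integrable'_on\<close> 50) where
  "f locally_integrable_on \<Omega> \<longleftrightarrow> (\<forall>K\<subseteq>\<Omega>. compact K \<longrightarrow> set_integrable lebesgue K f)"

text \<open>The distribution \<open>curl E\<close> has first component \<open>\<partial>\<^sub>2 E\<^sub>3 - \<partial>\<^sub>3 E\<^sub>2\<close>, which sends a scalar test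
  function \<open>\<phi>\<close> to the integral of \<open>E\<^sub>2 \<partial>\<^sub>3 \<phi> - E\<^sub>3 \<partial>\<^sub>2 \<phi>\<close>, and cyclically for the others; together
  these are the components of the integral of \<open>E \<times> grad \<phi>\<close>.\<close>

definition has_weak_curl :: "(real^3) set \<Rightarrow> (real^3 \<Rightarrow> real^3) \<Rightarrow> (real^3 \<Rightarrow> real^3) \<Rightarrow> bool" where
  "has_weak_curl \<Omega> E C \<longleftrightarrow> E locally_integrable_on \<Omega> \<and> C locally_integrable_on \<Omega> \<and>
     (\<forall>\<phi>\<in>test_functions \<Omega>.
        (\<integral>x. \<phi> x *\<^sub>R C x \<partial>lebesgue_on \<Omega>) = (\<integral>x. cross3 (E x) (grad \<phi> x) \<partial>lebesgue_on \<Omega>))"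

definition has_weak_div :: "(real^3) set \<Rightarrow> (real^3 \<Rightarrow> real^3) \<Rightarrow> (real^3 \<Rightarrow> real) \<Rightarrow> bool" where
  "has_weak_div \<Omega> H D \<longleftrightarrow> H locally_integrable_on \<Omega> \<and> D locally_integrable_on \<Omega> \<and>
     (\<forall>\<phi>\<in>test_functions \<Omega>.
        (\<integral>x. \<phi> x * D x \<partial>lebesgue_on \<Omega>) = - (\<integral>x. H x \<bullet> grad \<phi> x \<partial>lebesgue_on \<Omega>))"

end

theory Submission
  imports Defs "HOL-Library.Diagonal_Subsequence"
begin

text \<open>Weak limits exist by weak sequential compactness of \<open>L\<^sup>2\<close>-balls, and they inherit the weak curl and
  divergence. For the product, subtract the limit so that \<open>E\<^sub>n\<close> tends weakly to 0, and localise
  to compactly supported fields \<open>u = \<phi> E\<^sub>n\<close> and \<open>v = \<psi> H\<^sub>n\<close>. Let \<open>\<rho>\<^sub>\<delta>\<close> be minus the Laplacian of the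
  Plummer potential \<open>P\<^sub>\<delta>(z) = 1 / sqrt (\<bar>z\<bar>\<^sup>2 + \<delta>\<^sup>2)\<close>; it is an approximate identity, up to
  normalisation. By \<open>- \<Delta> = curl curl - grad div\<close>, the difference
  \<open>\<integral> (\<rho>\<^sub>\<delta> * u) \<bullet> v - \<integral> (\<rho>\<^sub>\<epsilon> * u) \<bullet> v\<close> only involves \<open>curl u\<close>, \<open>div v\<close> and the kernel
  \<open>\<nabla> (P\<^sub>\<delta> - P\<^sub>\<epsilon>)\<close>, whose \<open>L\<^sup>1\<close>-norm on bounded sets is small uniformly in \<open>\<delta> \<le> \<epsilon>\<close>. Letting
  \<open>\<delta>\<close> tend to 0 compares \<open>\<integral> u \<bullet> v\<close> with \<open>\<integral> (\<rho>\<^sub>\<epsilon> * u) \<bullet> v\<close>, which vanishes in the limit for fixed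
  \<open>\<epsilon>\<close> because convolution with \<open>\<rho>\<^sub>\<epsilon>\<close> turns weak into strong convergence.\<close>

section \<open>Square-integrable functions\<close>

text \<open>The obstacle is that the curl of \<open>E n\<close> and the divergence of
  \<open>H n\<close> are known only against smooth compactly supported functions, while the Newton
  kernel that inverts the Laplacian is singular. The Plummer potential is smooth on the whole space,
  so a test function times one of its derivatives is again a test function, and the distributional
  hypotheses apply to it for each fixed point of evaluation. All its derivatives are polynomials in
  the coordinates and in the potential itself, so smoothness, scaling and the Laplacian identity are
  algebra. Uniformity in \<delta> comes from monotonicity: the gradient grows in length as \<delta>
  decreases and stays below \<open>1 / |z|^2\<close>, which is locally integrable in dimension
  three. Only the limit of \<open>E n\<close> has to be subtracted: the product with a merely
  bounded \<open>H n\<close> then tends to zero, and what remains is linear in \<open>H n\<close>.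
  Integrals over pairs of points call for Borel functions, whereas the data are Lebesgue measurable
  on \<Omega>; hence the passage to Borel representatives.\<close>

definition sq_integrable :: "'a measure \<Rightarrow> ('a \<Rightarrow> 'b::euclidean_space) \<Rightarrow> bool" where
  "sq_integrable M f \<longleftrightarrow> f \<in> borel_measurable M \<and> integrable M (\<lambda>x. (norm (f x))\<^sup>2)"

definition L2_ip :: "'a measure \<Rightarrow> ('a \<Rightarrow> 'b::euclidean_space) \<Rightarrow> ('a \<Rightarrow> 'b) \<Rightarrow> real" where
  "L2_ip M f g = (\<integral>x. f x \<bullet> g x \<partial>M)"

definition normsq :: "'a measure \<Rightarrow> ('a \<Rightarrow> 'b::euclidean_space) \<Rightarrow> real" where
  "normsq M f = (\<integral>x. (norm (f x))\<^sup>2 \<partial>M)"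

lemma sq_integrable_measurable: "sq_integrable M f \<Longrightarrow> f \<in> borel_measurable M"
  by (simp add: sq_integrable_def)

lemma normsq_nonneg [simp]: "0 \<le> normsq M f"
  by (simp add: normsq_def)

text \<open>Young's inequality without its factor 1/2. The two norms may live on different spaces;
  \<open>b = 1\<close> bounds a norm by 1 plus its square, which turns square integrability into
  integrability on bounded sets.\<close>

lemma norm_mult_le_sum_squares: "norm a * norm b \<le> (norm a)\<^sup>2 + (norm b)\<^sup>2"
proof -
  have "2 * (norm a * norm b) \<le> (norm a)\<^sup>2 + (norm b)\<^sup>2"
    using sum_squares_bound[of "norm a" "norm b"] by simp
  moreover have "0 \<le> norm a * norm b" by simp
  ultimately show ?thesis by linarith
qed

lemma sq_integrable_norm_mult:
  assumes "sq_integrable M f" "sq_integrable M g"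
  shows "integrable M (\<lambda>x. norm (f x) * norm (g x))"
proof (rule Bochner_Integration.integrable_bound)
  show "integrable M (\<lambda>x. (norm (f x))\<^sup>2 + (norm (g x))\<^sup>2)"
    using assms by (simp add: sq_integrable_def)
  show "(\<lambda>x. norm (f x) * norm (g x)) \<in> borel_measurable M"
    using assms[THEN sq_integrable_measurable] by measurable
qed (auto simp: norm_mult_le_sum_squares)

lemma sq_integrable_bilinear:
  fixes f :: "'a \<Rightarrow> 'b::euclidean_space" and g :: "'a \<Rightarrow> 'c::euclidean_space"
    and B :: "'b \<Rightarrow> 'c \<Rightarrow> 'd::euclidean_space"
  assumes "sq_integrable M f" "sq_integrable M g"
    and "(\<lambda>x. B (f x) (g x)) \<in> borel_measurable M"
    and "\<And>a b. norm (B a b) \<le> norm a * norm b"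
  shows "integrable M (\<lambda>x. B (f x) (g x))"
  by (rule Bochner_Integration.integrable_bound[OF sq_integrable_norm_mult[OF assms(1,2)] assms(3)])
    (auto intro: order_trans[OF assms(4)])

lemma sq_integrable_inner:
  assumes "sq_integrable M f" "sq_integrable M g"
  shows "integrable M (\<lambda>x. f x \<bullet> g x)"
  using assms
  by (intro sq_integrable_bilinear Cauchy_Schwarz_ineq2[folded real_norm_def])
    (auto simp: sq_integrable_def)

lemma sq_integrable_bound:
  assumes "sq_integrable M f" "g \<in> borel_measurable M"
    and "\<And>x. x \<in> space M \<Longrightarrow> norm (g x) \<le> C * norm (f x)"
  shows "sq_integrable M g"
  unfolding sq_integrable_def
proof
  show "integrable M (\<lambda>x. (norm (g x))\<^sup>2)"
  proof (rule Bochner_Integration.integrable_bound)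
    show "integrable M (\<lambda>x. C\<^sup>2 * (norm (f x))\<^sup>2)"
      using assms by (simp add: sq_integrable_def)
    show "(\<lambda>x. (norm (g x))\<^sup>2) \<in> borel_measurable M"
      using assms(2) by measurable
    show "AE x in M. norm ((norm (g x))\<^sup>2) \<le> norm (C\<^sup>2 * (norm (f x))\<^sup>2)"
      using assms(3) by (auto simp flip: power_mult_distrib intro!: AE_I2 power_mono)
  qed
qed fact

lemma sq_integrable_scaleR: "sq_integrable M f \<Longrightarrow> sq_integrable M (\<lambda>x. c *\<^sub>R f x)"
  by (rule sq_integrable_bound[where C="\<bar>c\<bar>"]) (auto simp: sq_integrable_def)

lemma sq_integrable_add:
  fixes f g :: "'a \<Rightarrow> 'b::euclidean_space"
  assumes "sq_integrable M f" "sq_integrable M g"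
  shows "sq_integrable M (\<lambda>x. f x + g x)"
proof -
  have "integrable M (\<lambda>x. (norm (f x))\<^sup>2 + 2 * (f x \<bullet> g x) + (norm (g x))\<^sup>2)"
    using assms sq_integrable_inner[OF assms] by (auto simp: sq_integrable_def)
  moreover have "(norm (f x + g x))\<^sup>2 = (norm (f x))\<^sup>2 + 2 * (f x \<bullet> g x) + (norm (g x))\<^sup>2" for x
    by (simp add: power2_norm_eq_inner inner_add inner_commute)
  moreover have "(\<lambda>x. f x + g x) \<in> borel_measurable M"
    using assms[THEN sq_integrable_measurable] by measurable
  ultimately show ?thesis
    by (simp add: sq_integrable_def)
qed

lemma sq_integrable_diff:
  "sq_integrable M f \<Longrightarrow> sq_integrable M g \<Longrightarrow> sq_integrable M (\<lambda>x. f x - g x)"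
  using sq_integrable_add[of M f "\<lambda>x. (-1) *\<^sub>R g x"] sq_integrable_scaleR[of M g "-1"] by simp

lemma L2_ip_commute: "L2_ip M f g = L2_ip M g f"
  by (simp add: L2_ip_def inner_commute)

lemma L2_ip_add_left:
  "sq_integrable M f \<Longrightarrow> sq_integrable M g \<Longrightarrow> sq_integrable M h \<Longrightarrow>
    L2_ip M (\<lambda>x. f x + g x) h = L2_ip M f h + L2_ip M g h"
  by (simp add: L2_ip_def inner_add_left sq_integrable_inner)

lemma L2_ip_diff_left:
  "sq_integrable M f \<Longrightarrow> sq_integrable M g \<Longrightarrow> sq_integrable M h \<Longrightarrow>
    L2_ip M (\<lambda>x. f x - g x) h = L2_ip M f h - L2_ip M g h"
  by (simp add: L2_ip_def inner_diff_left sq_integrable_inner)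

lemma L2_ip_scaleR_left: "L2_ip M (\<lambda>x. c *\<^sub>R f x) h = c * L2_ip M f h"
  by (simp add: L2_ip_def)

text \<open>The Hilbert space arguments below all run through this quadratic polynomial in
  \<open>t\<close>: Cauchy-Schwarz, the parallelogram law, and near-orthogonality to a
  subspace.\<close>

lemma normsq_add_scaleR:
  fixes f g :: "'a \<Rightarrow> 'b::euclidean_space"
  assumes "sq_integrable M f" "sq_integrable M g"
  shows "normsq M (\<lambda>x. f x + t *\<^sub>R g x) = normsq M f + 2 * t * L2_ip M f g + t\<^sup>2 * normsq M g"
proof -
  have "(norm (f x + t *\<^sub>R g x))\<^sup>2 = (norm (f x))\<^sup>2 + 2 * t * (f x \<bullet> g x) + t\<^sup>2 * (norm (g x))\<^sup>2" for x
    unfolding power2_norm_eq_inner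
    by (simp add: inner_add_left inner_add_right inner_commute power2_eq_square algebra_simps)
  then show ?thesis
    using assms sq_integrable_inner[OF assms] by (simp add: normsq_def L2_ip_def sq_integrable_def)
qed

text \<open>Evaluation at the minimiser \<open>- b / c\<close> gives the claim. The constant term
  \<open>a\<close> is free, so besides Cauchy-Schwarz this shows that the slope \<open>b\<close> at
  a point within \<open>a\<close> of an infimum is small.\<close>

lemma quadratic_nonneg_discriminant:
  fixes a b c :: real
  assumes nonneg: "\<And>t. 0 \<le> a + 2 * t * b + t\<^sup>2 * c" and "0 \<le> c"
  shows "b\<^sup>2 \<le> a * c"
proof (cases "c = 0")
  case True
  have "b = 0"
  proof (rule ccontr)
    assume "b \<noteq> 0"
    then show False
      \<comment> \<open>For \<open>c = 0\<close> this choice of \<open>t\<close> makes the linear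
        function \<open>a + 2 * t * b\<close> equal to -1.\<close>
      using nonneg[of "- (a + 1) / (2 * b)"] True by (simp add: field_simps)
  qed
  then show ?thesis using True by simp
next
  case False
  then have "c > 0" using assms by simp
  have "0 \<le> a + 2 * (- b / c) * b + (- b / c)\<^sup>2 * c" by (rule nonneg)
  also have "\<dots> = a - b\<^sup>2 / c"
    using \<open>c > 0\<close> by (simp add: power2_eq_square field_simps)
  finally show ?thesis using \<open>c > 0\<close> by (simp add: field_simps)
qed

lemma L2_ip_Cauchy_Schwarz:
  assumes "sq_integrable M f" "sq_integrable M g"
  shows "(L2_ip M f g)\<^sup>2 \<le> normsq M f * normsq M g"
  by (rule quadratic_nonneg_discriminant)
    (simp_all add: normsq_add_scaleR[OF assms, symmetric])

lemma L2_ip_abs_le: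
  assumes "sq_integrable M f" "sq_integrable M g" "normsq M f \<le> a\<^sup>2" "normsq M g \<le> b\<^sup>2" "0 \<le> a" "0 \<le> b"
  shows "\<bar>L2_ip M f g\<bar> \<le> a * b"
proof -
  have "(L2_ip M f g)\<^sup>2 \<le> normsq M f * normsq M g" using assms by (intro L2_ip_Cauchy_Schwarz)
  also have "\<dots> \<le> a\<^sup>2 * b\<^sup>2" using assms by (intro mult_mono) auto
  finally have "\<bar>L2_ip M f g\<bar>\<^sup>2 \<le> (a * b)\<^sup>2" by (simp add: power_mult_distrib)
  then show ?thesis using assms by (meson mult_nonneg_nonneg power2_le_imp_le)
qed

text \<open>The parallelogram law with the norm of the difference discarded.\<close>

lemma normsq_add_le:
  fixes f g :: "'a \<Rightarrow> 'b::euclidean_space"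
  assumes "sq_integrable M f" "sq_integrable M g"
  shows "normsq M (\<lambda>x. f x + g x) \<le> 2 * normsq M f + 2 * normsq M g"
proof -
  have "normsq M (\<lambda>x. f x + g x) + normsq M (\<lambda>x. f x + (-1) *\<^sub>R g x) = 2 * normsq M f + 2 * normsq M g"
    using normsq_add_scaleR[OF assms, of 1] normsq_add_scaleR[OF assms, of "-1"] by simp
  then show ?thesis using normsq_nonneg[of M "\<lambda>x. f x + (-1) *\<^sub>R g x"] by linarith
qed

lemma normsq_minus: "normsq M (\<lambda>x. - f x) = normsq M f"
  by (simp add: normsq_def)

lemma normsq_diff_le:
  fixes f g :: "'a \<Rightarrow> 'b::euclidean_space"
  assumes "sq_integrable M f" "sq_integrable M g"
  shows "normsq M (\<lambda>x. f x - g x) \<le> 2 * normsq M f + 2 * normsq M g"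
  using normsq_add_le[OF assms(1), of "\<lambda>x. (-1) *\<^sub>R g x"] sq_integrable_scaleR[OF assms(2), of "-1"]
  by (simp add: normsq_minus)

section \<open>Completeness, representation of functionals, weak compactness\<close>

text \<open>The increments are dominated by a geometric series of ratio \<open>sqrt (1/2)\<close>,
  so the telescoping series converges absolutely.\<close>

lemma convergent_if_weighted_squares_bounded:
  fixes z :: "nat \<Rightarrow> 'b::euclidean_space"
  assumes "\<And>j. 2 ^ j * (norm (z (Suc j) - z j))\<^sup>2 \<le> T"
  shows "convergent z"
proof -
  have T: "0 \<le> T" using assms[of 0] by (simp add: order_trans[OF zero_le_power2])
  have b: "norm (z (Suc j) - z j) \<le> sqrt T * (sqrt (1/2)) ^ j" for j
  proof -
    have "(norm (z (Suc j) - z j))\<^sup>2 \<le> T * (1/2) ^ j"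
      using assms[of j] by (simp add: field_simps)
    then have "norm (z (Suc j) - z j) \<le> sqrt (T * (1/2) ^ j)" by (rule real_le_rsqrt)
    also have "\<dots> = sqrt T * (sqrt (1/2)) ^ j" by (simp only: real_sqrt_mult real_sqrt_power)
    finally show ?thesis .
  qed
  have "summable (\<lambda>j. sqrt T * (sqrt (1/2)) ^ j)"
    by (intro summable_mult summable_geometric) (auto simp: real_less_lsqrt)
  then have "summable (\<lambda>j. z (Suc j) - z j)"
    by (rule summable_comparison_test[rotated]) (use b in auto)
  then have "(\<lambda>n. \<Sum>j<n. z (Suc j) - z j) \<longlonglongrightarrow> (\<Sum>j. z (Suc j) - z j)"
    by (rule summable_LIMSEQ)
  then have "(\<lambda>n. z n - z 0 + z 0) \<longlonglongrightarrow> (\<Sum>j. z (Suc j) - z j) + z 0"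
    by (intro tendsto_add tendsto_const) (simp add: sum_lessThan_telescope)
  then show "convergent z"
    by (auto simp: convergent_def)
qed


text \<open>Riesz-Fischer for rapidly Cauchy sequences. Because the assumed rate is
  \<open>(1/4) ^ j\<close>, the squared increments weighted by \<open>2 ^ j\<close> still have
  summable integrals; their sum is finite almost everywhere, which forces pointwise convergence.
  Fatou's lemma carries the Cauchy bound over to the limit.\<close>

lemma sq_integrable_complete:
  fixes g :: "nat \<Rightarrow> 'a \<Rightarrow> 'b::euclidean_space"
  assumes g: "\<And>j. sq_integrable M (g j)"
    and close: "\<And>j. normsq M (\<lambda>x. g (Suc j) x - g j x) \<le> (1/4) ^ j"
  obtains h where "sq_integrable M h" "\<And>j. normsq M (\<lambda>x. g j x - h x) \<le> 4 * (1/4) ^ j"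
proof -
  have [measurable]: "\<And>j. g j \<in> borel_measurable M"
    using g sq_integrable_measurable by blast
  \<comment> \<open>The constant 4 is the fixed point of the recursion:
    \<open>2 * (4 / 4) + 2 = 4\<close>.\<close>
  have far: "normsq M (\<lambda>x. g (j + n) x - g j x) \<le> 4 * (1/4) ^ j" for j n
  proof (induction n arbitrary: j)
    case 0 then show ?case by (simp add: normsq_def)
  next
    case (Suc n)
    have "normsq M (\<lambda>x. g (j + Suc n) x - g j x)
        = normsq M (\<lambda>x. (g (Suc j + n) x - g (Suc j) x) + (g (Suc j) x - g j x))"
      by simp
    also have "\<dots> \<le> 2 * normsq M (\<lambda>x. g (Suc j + n) x - g (Suc j) x) + 2 * normsq M (\<lambda>x. g (Suc j) x - g j x)"
      by (intro normsq_add_le sq_integrable_diff g)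
    also have "\<dots> \<le> 2 * (4 * (1/4) ^ Suc j) + 2 * (1/4) ^ j"
      using Suc[of "Suc j"] close[of j] by linarith
    finally show ?case by simp
  qed
  define D where "D j = (\<lambda>x. 2 ^ j * (norm (g (Suc j) x - g j x))\<^sup>2)" for j
  have D: "(\<integral>\<^sup>+x. ennreal (D j x) \<partial>M) \<le> ennreal ((1/2) ^ j)" for j
  proof -
    have "integrable M (D j)"
      using sq_integrable_diff[OF g g, of "Suc j" j] by (simp add: D_def sq_integrable_def)
    then have "(\<integral>\<^sup>+x. ennreal (D j x) \<partial>M) = ennreal (\<integral>x. D j x \<partial>M)"
      by (rule nn_integral_eq_integral) (simp add: D_def)
    also have "(\<integral>x. D j x \<partial>M) = 2 ^ j * normsq M (\<lambda>x. g (Suc j) x - g j x)"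
      by (simp add: D_def normsq_def)
    also have "\<dots> \<le> 2 ^ j * (1/4) ^ j"
      using close by (intro mult_left_mono) auto
    also have "\<dots> = (1/2) ^ j"
      by (simp flip: power_mult_distrib)
    finally show ?thesis by (simp add: ennreal_leI)
  qed
  have "(\<integral>\<^sup>+x. (\<Sum>j. ennreal (D j x)) \<partial>M) = (\<Sum>j. \<integral>\<^sup>+x. ennreal (D j x) \<partial>M)"
    by (intro nn_integral_suminf) (simp add: D_def)
  also have "\<dots> \<le> (\<Sum>j. ennreal ((1/2) ^ j))"
    by (intro suminf_le D) auto
  also have "\<dots> = ennreal (\<Sum>j. (1/2) ^ j)"
    by (intro suminf_ennreal2) (auto intro: summable_geometric)
  finally have "(\<integral>\<^sup>+x. (\<Sum>j. ennreal (D j x)) \<partial>M) \<noteq> \<infinity>"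
    by (auto simp: top_unique)
  then have "AE x in M. (\<Sum>j. ennreal (D j x)) \<noteq> \<infinity>"
    by (intro nn_integral_PInf_AE) (auto simp: D_def)
  then have conv: "AE x in M. (\<lambda>j. g j x) \<longlonglongrightarrow> lim (\<lambda>j. g j x)"
  proof eventually_elim
    case (elim x)
    obtain T where T: "(\<Sum>j. ennreal (D j x)) = ennreal T" "0 \<le> T"
      using elim by (cases "\<Sum>j. ennreal (D j x)") auto
    have "D j x \<le> T" for j
    proof -
      have "ennreal (D j x) \<le> ennreal T"
        using sum_le_suminf[of "\<lambda>j. ennreal (D j x)" "{j}"] T by simp
      then show ?thesis using T by simp
    qed
    then show ?case
      by (intro convergent_LIMSEQ_iff[THEN iffD1] convergent_if_weighted_squares_bounded[where T=T]) (simp add: D_def)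
  qed
  \<comment> \<open>\<open>lim\<close> is total, so this is measurable everywhere; its arbitrary
    values where the sequence diverges concern a null set.\<close>
  define h where "h x = lim (\<lambda>j. g j x)" for x
  have [measurable]: "h \<in> borel_measurable M"
    unfolding h_def by measurable
  have fatou: "(\<integral>\<^sup>+x. ennreal ((norm (g j x - h x))\<^sup>2) \<partial>M) \<le> ennreal (4 * (1/4) ^ j)" for j
  proof -
    have "(\<integral>\<^sup>+x. ennreal ((norm (g j x - h x))\<^sup>2) \<partial>M)
        = (\<integral>\<^sup>+x. liminf (\<lambda>n. ennreal ((norm (g j x - g (j + n) x))\<^sup>2)) \<partial>M)"
    proof (rule nn_integral_cong_AE)
      show "AE x in M. ennreal ((norm (g j x - h x))\<^sup>2) = liminf (\<lambda>n. ennreal ((norm (g j x - g (j + n) x))\<^sup>2))"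
        using conv
      proof eventually_elim
        case (elim x)
        then have "(\<lambda>n. g (j + n) x) \<longlonglongrightarrow> h x"
          unfolding h_def using LIMSEQ_ignore_initial_segment[of "\<lambda>j. g j x" _ j] by (simp add: add.commute)
        then have "(\<lambda>n. ennreal ((norm (g j x - g (j + n) x))\<^sup>2)) \<longlonglongrightarrow> ennreal ((norm (g j x - h x))\<^sup>2)"
          by (intro tendsto_intros)
        then show ?case
          by (rule lim_imp_Liminf[OF sequentially_bot, symmetric])
      qed
    qed
    also have "\<dots> \<le> liminf (\<lambda>n. \<integral>\<^sup>+x. ennreal ((norm (g j x - g (j + n) x))\<^sup>2) \<partial>M)"
      by (rule nn_integral_liminf) measurable
    also have "\<dots> \<le> ennreal (4 * (1/4) ^ j)"
    proof -
      have "(\<integral>\<^sup>+x. ennreal ((norm (g j x - g (j + n) x))\<^sup>2) \<partial>M) \<le> ennreal (4 * (1/4) ^ j)" for n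
      proof -
        have "(\<integral>\<^sup>+x. ennreal ((norm (g j x - g (j + n) x))\<^sup>2) \<partial>M) = ennreal (normsq M (\<lambda>x. g (j + n) x - g j x))"
          unfolding normsq_def using sq_integrable_diff[OF g g, of "j + n" j]
          by (subst nn_integral_eq_integral[symmetric]) (auto simp: sq_integrable_def norm_minus_commute)
        then show ?thesis using far[of j n] by (simp add: ennreal_leI)
      qed
      then have "liminf (\<lambda>n. \<integral>\<^sup>+x. ennreal ((norm (g j x - g (j + n) x))\<^sup>2) \<partial>M)
          \<le> liminf (\<lambda>n::nat. ennreal (4 * (1/4) ^ j))"
        by (intro Liminf_mono always_eventually) auto
      then show ?thesis by (simp add: Liminf_const)
    qed
    finally show ?thesis .
  qed
  have sq: "sq_integrable M (\<lambda>x. g j x - h x)" for j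
  proof -
    have "integrable M (\<lambda>x. (norm (g j x - h x))\<^sup>2)"
      unfolding integrable_iff_bounded
      using le_less_trans[OF fatou[of j] ennreal_less_top] by simp
    then show ?thesis by (simp add: sq_integrable_def)
  qed
  show ?thesis
  proof
    show "sq_integrable M h"
      using sq_integrable_diff[OF g[of 0] sq[of 0]] by simp
    show "normsq M (\<lambda>x. g j x - h x) \<le> 4 * (1/4) ^ j" for j
    proof -
      have "ennreal (normsq M (\<lambda>x. g j x - h x)) = (\<integral>\<^sup>+x. ennreal ((norm (g j x - h x))\<^sup>2) \<partial>M)"
        unfolding normsq_def using sq[of j]
        by (intro nn_integral_eq_integral[symmetric]) (auto simp: sq_integrable_def)
      then show ?thesis using fatou[of j] by (metis ennreal_le_iff mult_nonneg_nonneg zero_le_divide_1_iff zero_le_numeral zero_le_power)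
    qed
  qed
qed

lemma convergent_if_approx_convergent:
  fixes X :: "nat \<Rightarrow> real"
  assumes "\<And>e. 0 < e \<Longrightarrow> \<exists>Y. convergent Y \<and> (\<forall>n. \<bar>X n - Y n\<bar> \<le> e)"
  shows "convergent X"
proof -
  have "Cauchy X"
  proof (rule metric_CauchyI)
    fix e :: real assume "0 < e"
    then obtain Y where Y: "convergent Y" "\<And>n. \<bar>X n - Y n\<bar> \<le> e / 4"
      using assms[of "e / 4"] by auto
    then obtain N where N: "\<And>m n. m \<ge> N \<Longrightarrow> n \<ge> N \<Longrightarrow> \<bar>Y m - Y n\<bar> < e / 4"
      using \<open>0 < e\<close> metric_CauchyD[OF convergent_Cauchy[OF Y(1)], of "e / 4"] unfolding dist_real_def by auto
    have "dist (X m) (X n) < e" if "m \<ge> N" "n \<ge> N" for m n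
      using N[OF that] Y(2)[of m] Y(2)[of n] \<open>0 < e\<close> unfolding dist_real_def by linarith
    then show "\<exists>N. \<forall>m\<ge>N. \<forall>n\<ge>N. dist (X m) (X n) < e" by blast
  qed
  then show ?thesis by (rule Cauchy_convergent)
qed

text \<open>The limit functional is represented by the minimiser of
  \<open>\<parallel>g\<parallel>\<^sup>2 - 2 L g\<close>; minimising sequences are Cauchy by the parallelogram law.\<close>

lemma sq_integrable_Riesz:
  fixes L :: "('a \<Rightarrow> 'b::euclidean_space) \<Rightarrow> real"
  assumes add: "\<And>f g t. sq_integrable M f \<Longrightarrow> sq_integrable M g \<Longrightarrow> L (\<lambda>x. f x + t *\<^sub>R g x) = L f + t * L g"
    and bound: "\<And>f. sq_integrable M f \<Longrightarrow> (L f)\<^sup>2 \<le> B\<^sup>2 * normsq M f"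
  obtains g where "sq_integrable M g" "\<And>h. sq_integrable M h \<Longrightarrow> L h = L2_ip M g h"
proof -
  define J where "J f = normsq M f - 2 * L f" for f
  \<comment> \<open>Completing the square: \<open>2 * \<bar>L f\<bar>\<close> is at most
    \<open>B\<^sup>2 + normsq M f\<close>.\<close>
  have J_lower: "- B\<^sup>2 \<le> J f" if "sq_integrable M f" for f
  proof -
    have "(L f)\<^sup>2 \<le> (B * sqrt (normsq M f))\<^sup>2"
      using bound[OF that] by (simp add: power_mult_distrib)
    then have "\<bar>L f\<bar> \<le> \<bar>B\<bar> * sqrt (normsq M f)"
      using power2_le_iff_abs_le[of "\<bar>B\<bar> * sqrt (normsq M f)" "L f"] by (simp add: power_mult_distrib)
    moreover have "0 \<le> (\<bar>B\<bar> - sqrt (normsq M f))\<^sup>2" by simp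
    then have "2 * (\<bar>B\<bar> * sqrt (normsq M f)) \<le> B\<^sup>2 + normsq M f"
      by (simp add: power2_diff)
    ultimately show ?thesis unfolding J_def by linarith
  qed
  have J_expand: "J (\<lambda>x. f x + t *\<^sub>R g x) = J f + 2 * t * (L2_ip M f g - L g) + t\<^sup>2 * normsq M g"
    if "sq_integrable M f" "sq_integrable M g" for f g t
    using that by (simp add: J_def add normsq_add_scaleR algebra_simps)
  define I where "I = Inf (J ` Collect (sq_integrable M))"
  have bdd: "bdd_below (J ` Collect (sq_integrable M))"
    using J_lower by (auto intro!: bdd_belowI)
  have I: "I \<le> J f" if "sq_integrable M f" for f
    unfolding I_def using bdd that by (intro cInf_lower) auto
  have ne: "J ` Collect (sq_integrable M) \<noteq> {}"
    by (auto simp: sq_integrable_def intro!: exI[of _ "\<lambda>_. 0"])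
  have near: "\<exists>f. sq_integrable M f \<and> J f \<le> I + e" if "0 < e" for e
  proof -
    have "\<exists>y\<in>J ` Collect (sq_integrable M). y < I + e"
      using cInf_lessD[OF ne, of "I + e"] that unfolding I_def by auto
    then show ?thesis by (auto intro: less_imp_le)
  qed
  \<comment> \<open>A move along \<open>g\<close> from a point within \<open>e\<close> of the
    infimum cannot go below the infimum, so the discriminant of the resulting quadratic bounds the
    directional derivative. Along the minimising sequence this derivative tends to zero, which is
    the representing equation in the limit.\<close>
  have slope: "(L2_ip M f g - L g)\<^sup>2 \<le> e * normsq M g"
    if "sq_integrable M f" "sq_integrable M g" "J f \<le> I + e" for f g e
  proof (rule quadratic_nonneg_discriminant)
    fix t
    have "I \<le> J (\<lambda>x. f x + t *\<^sub>R g x)"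
      by (intro I sq_integrable_add sq_integrable_scaleR that)
    then show "0 \<le> e + 2 * t * (L2_ip M f g - L g) + t\<^sup>2 * normsq M g"
      unfolding J_expand[OF that(1,2)] using that(3) by linarith
  qed simp
  \<comment> \<open>The tolerance has to produce increments below \<open>(1/4) ^ j\<close>, the rate
    required by completeness: twice the excesses of two neighbours add up to at most
    \<open>1/8 + 1/32\<close> of it.\<close>
  have "\<forall>j. \<exists>f. sq_integrable M f \<and> J f \<le> I + (1/4) ^ j / 16"
    using near by simp
  then obtain g where g: "\<And>j. sq_integrable M (g j)" "\<And>j. J (g j) \<le> I + (1/4) ^ j / 16"
    by metis
  have "normsq M (\<lambda>x. g (Suc j) x - g j x) \<le> (1/4) ^ j" for j
  proof -
    let ?d = "\<lambda>x. g (Suc j) x - g j x"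
    have d: "sq_integrable M ?d" by (intro sq_integrable_diff g)
    have "J (\<lambda>x. g j x + 1 *\<^sub>R ?d x) = J (g j) + 2 * 1 * (L2_ip M (g j) ?d - L ?d) + 1\<^sup>2 * normsq M ?d"
      by (rule J_expand[OF g(1) d])
    then have 1: "J (g (Suc j)) = J (g j) + 2 * (L2_ip M (g j) ?d - L ?d) + normsq M ?d"
      by simp
    \<comment> \<open>The midpoint of \<open>g j\<close> and \<open>g (Suc j)\<close>: comparing its
      value with the infimum eliminates the linear term and leaves the square of the
      increment.\<close>
    have "J (\<lambda>x. g j x + (1/2) *\<^sub>R ?d x) = J (g j) + 2 * (1/2) * (L2_ip M (g j) ?d - L ?d) + (1/2)\<^sup>2 * normsq M ?d"
      by (rule J_expand[OF g(1) d])
    then have 2: "I \<le> J (g j) + (L2_ip M (g j) ?d - L ?d) + normsq M ?d / 4"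
      using I[of "\<lambda>x. g j x + (1/2) *\<^sub>R ?d x"] by (simp add: sq_integrable_add sq_integrable_scaleR g d power2_eq_square)
    have "normsq M ?d \<le> 2 * (J (g j) - I) + 2 * (J (g (Suc j)) - I)"
    proof -
      have "d \<le> 2 * (a - i) + 2 * (b - i)" if "b = a + 2 * c + d" "i \<le> a + c + d / 4" for a b c d i :: real
        using that by simp
      from this[OF 1 2] show ?thesis .
    qed
    also have "\<dots> \<le> 2 * ((1/4) ^ j / 16) + 2 * ((1/4) ^ Suc j / 16)"
      using g(2)[of j] g(2)[of "Suc j"] by (intro add_mono mult_left_mono) simp_all
    also have "\<dots> \<le> (1/4) ^ j" by simp
    finally show ?thesis .
  qed
  from sq_integrable_complete[OF g(1) this]
  obtain h where h: "sq_integrable M h" "\<And>j. normsq M (\<lambda>x. g j x - h x) \<le> 4 * (1/4) ^ j"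
    by blast
  have "L k = L2_ip M h k" if k: "sq_integrable M k" for k
  proof -
    have "(\<lambda>j. L2_ip M (g j) k) \<longlonglongrightarrow> L k"
    proof (rule LIM_zero_cancel, rule Lim_null_comparison)
      show "\<forall>\<^sub>F j in sequentially. norm (L2_ip M (g j) k - L k) \<le> sqrt ((1/4) ^ j / 16 * normsq M k)"
        using slope[OF g(1) k g(2)] by (auto intro!: always_eventually real_le_rsqrt)
      have "(\<lambda>j. sqrt ((1/4) ^ j / 16 * normsq M k)) \<longlonglongrightarrow> sqrt (0 / 16 * normsq M k)"
        by (intro tendsto_intros LIMSEQ_power_zero) auto
      then show "(\<lambda>j. sqrt ((1/4) ^ j / 16 * normsq M k)) \<longlonglongrightarrow> 0" by simp
    qed
    moreover have "(\<lambda>j. L2_ip M (g j) k) \<longlonglongrightarrow> L2_ip M h k"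
    proof (rule LIM_zero_cancel, rule Lim_null_comparison)
      have "(L2_ip M (g j) k - L2_ip M h k)\<^sup>2 \<le> 4 * (1/4) ^ j * normsq M k" for j
      proof -
        have "(L2_ip M (g j) k - L2_ip M h k)\<^sup>2 = (L2_ip M (\<lambda>x. g j x - h x) k)\<^sup>2"
          by (simp add: L2_ip_diff_left g h k)
        also have "\<dots> \<le> normsq M (\<lambda>x. g j x - h x) * normsq M k"
          by (intro L2_ip_Cauchy_Schwarz sq_integrable_diff g h k)
        also have "\<dots> \<le> 4 * (1/4) ^ j * normsq M k"
          by (intro mult_right_mono h) simp
        finally show ?thesis .
      qed
      then show "\<forall>\<^sub>F j in sequentially. norm (L2_ip M (g j) k - L2_ip M h k) \<le> sqrt (4 * (1/4) ^ j * normsq M k)"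
        by (auto intro!: always_eventually real_le_rsqrt)
      have "(\<lambda>j. sqrt (4 * (1/4) ^ j * normsq M k)) \<longlonglongrightarrow> sqrt (4 * 0 * normsq M k)"
        by (intro tendsto_intros LIMSEQ_power_zero) auto
      then show "(\<lambda>j. sqrt (4 * (1/4) ^ j * normsq M k)) \<longlonglongrightarrow> 0" by simp
    qed
    ultimately show ?thesis by (rule LIMSEQ_unique)
  qed
  with h(1) show ?thesis by (rule that)
qed

text \<open>The argument works without a countable dense set. A diagonal subsequence makes the
  pairings of \<open>f m\<close> with \<open>f (r k)\<close> converge in \<open>k\<close> for every
  \<open>m\<close>. The functions whose pairings converge form a subspace containing all
  \<open>f m\<close>, and an arbitrary \<open>h\<close> differs from a nearly best approximation in
  that subspace by a function almost orthogonal to every \<open>f n\<close>. The limit functional is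
  bounded, hence represented by some \<open>g\<close>.\<close>

lemma sq_integrable_weak_compactness:
  fixes f :: "nat \<Rightarrow> 'a \<Rightarrow> 'b::euclidean_space"
  assumes f: "\<And>n. sq_integrable M (f n)" and B: "\<And>n. normsq M (f n) \<le> B\<^sup>2" and "0 \<le> B"
  obtains r :: "nat \<Rightarrow> nat" and g where "strict_mono r" "sq_integrable M g"
    "\<And>h. sq_integrable M h \<Longrightarrow> (\<lambda>n. L2_ip M (f (r n)) h) \<longlonglongrightarrow> L2_ip M g h"
proof -
  interpret subseqs "\<lambda>m s. convergent (\<lambda>k. L2_ip M (f m) (f (s k)))"
  proof
    fix m and s :: "nat \<Rightarrow> nat"
    have "L2_ip M (f m) (f (s k)) \<in> {- (B * B)..B * B}" for k
      using L2_ip_abs_le[OF f f B B \<open>0 \<le> B\<close> \<open>0 \<le> B\<close>, of m "s k"] by auto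
    moreover have "seq_compact {- (B * B)..B * B}"
      by (simp add: compact_imp_seq_compact)
    ultimately obtain l r' where "strict_mono r'" "((\<lambda>k. L2_ip M (f m) (f (s k))) \<circ> r') \<longlonglongrightarrow> l"
      unfolding seq_compact_def by metis
    then show "\<exists>r'. strict_mono r' \<and> convergent (\<lambda>k. L2_ip M (f m) (f ((s \<circ> r') k)))"
      by (auto simp: o_def convergent_def)
  qed
  define r where "r = diagseq"
  have r: "strict_mono r" unfolding r_def by (rule subseq_diagseq)
  have conv_f: "convergent (\<lambda>k. L2_ip M (f m) (f (r k)))" for m
  proof -
    \<comment> \<open>The diagonal sequence is known to be a subsequence of the stage treating
      \<open>f m\<close> only from index \<open>Suc m\<close> on; the shift is undone below, since
      convergence ignores initial terms.\<close>
    have "convergent (\<lambda>k. L2_ip M (f m) (f ((diagseq \<circ> (+) (Suc m)) k)))"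
    proof (rule diagseq_holds)
      fix m and r s :: "nat \<Rightarrow> nat"
      assume "strict_mono r" "convergent (\<lambda>k. L2_ip M (f m) (f (s k)))"
      then show "convergent (\<lambda>k. L2_ip M (f m) (f ((s \<circ> r) k)))"
        using convergent_subseq_convergent[of "\<lambda>k. L2_ip M (f m) (f (s k))" r] by (simp add: o_def)
    qed
    then have "convergent (\<lambda>k. L2_ip M (f m) (f (r (k + Suc m))))"
      by (simp add: o_def r_def add.commute)
    then show ?thesis by (rule convergent_ignore_initial_segment[THEN iffD1])
  qed
  define D where "D = {h. sq_integrable M h \<and> convergent (\<lambda>k. L2_ip M h (f (r k)))}"
  have fD: "f m \<in> D" for m using conv_f f by (simp add: D_def)
  have D_add: "(\<lambda>x. g x + t *\<^sub>R h x) \<in> D" if "g \<in> D" "h \<in> D" for g h t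
  proof -
    have "L2_ip M (\<lambda>x. g x + t *\<^sub>R h x) (f n) = L2_ip M g (f n) + t * L2_ip M h (f n)" for n
      using that by (subst L2_ip_add_left) (auto simp: D_def f sq_integrable_scaleR L2_ip_scaleR_left)
    then show ?thesis
      using that by (auto simp: D_def intro!: sq_integrable_add sq_integrable_scaleR convergent_add convergent_mult convergent_const)
  qed
  have conv: "convergent (\<lambda>k. L2_ip M h (f (r k)))" if h: "sq_integrable M h" for h
  proof (rule convergent_if_approx_convergent)
    fix e :: real assume "0 < e"
    define I where "I = Inf ((\<lambda>s. normsq M (\<lambda>x. h x - s x)) ` D)"
    have I: "I \<le> normsq M (\<lambda>x. h x - s x)" if "s \<in> D" for s
      unfolding I_def using that by (intro cInf_lower bdd_belowI[of _ 0]) auto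
    \<comment> \<open>Chosen so that \<open>\<eta> * (B + 1)\<^sup>2 = e\<^sup>2\<close>; the added
      1 covers \<open>B = 0\<close>.\<close>
    define \<eta> where "\<eta> = e\<^sup>2 / (B + 1)\<^sup>2"
    have "0 < \<eta>" using \<open>0 < e\<close> \<open>0 \<le> B\<close> by (simp add: \<eta>_def)
    then obtain s where s: "s \<in> D" "normsq M (\<lambda>x. h x - s x) < I + \<eta>"
      using cInf_lessD[of "(\<lambda>s. normsq M (\<lambda>x. h x - s x)) ` D" "I + \<eta>"] fD unfolding I_def by auto
    have sqs: "sq_integrable M s" using s by (simp add: D_def)
    have "\<bar>L2_ip M h (f n) - L2_ip M s (f n)\<bar> \<le> e" for n
    proof -
      \<comment> \<open>Shifting \<open>s\<close> by a multiple of \<open>f n\<close> stays in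
        \<open>D\<close>, so it cannot bring the squared distance to \<open>h\<close> below the
        infimum \<open>I\<close>; the discriminant turns this into a small pairing with
        \<open>f n\<close>.\<close>
      have "(L2_ip M (\<lambda>x. h x - s x) (f n))\<^sup>2 \<le> \<eta> * normsq M (f n)"
      proof (rule quadratic_nonneg_discriminant)
        fix t
        have "I \<le> normsq M (\<lambda>x. h x - (s x + (- t) *\<^sub>R f n x))"
          using I[OF D_add[OF s(1) fD[of n], of "- t"]] .
        also have "\<dots> = normsq M (\<lambda>x. (h x - s x) + t *\<^sub>R f n x)"
          by (simp add: algebra_simps)
        also have "\<dots> = normsq M (\<lambda>x. h x - s x) + 2 * t * L2_ip M (\<lambda>x. h x - s x) (f n) + t\<^sup>2 * normsq M (f n)"
          by (intro normsq_add_scaleR sq_integrable_diff h sqs f)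
        finally show "0 \<le> \<eta> + 2 * t * L2_ip M (\<lambda>x. h x - s x) (f n) + t\<^sup>2 * normsq M (f n)"
          using s(2) by linarith
      qed simp
      also have "\<dots> \<le> \<eta> * (B + 1)\<^sup>2"
        using \<open>0 < \<eta>\<close> \<open>0 \<le> B\<close> by (intro mult_left_mono order_trans[OF B]) (auto intro: power_mono)
      also have "\<dots> = e\<^sup>2" using \<open>0 \<le> B\<close> by (simp add: \<eta>_def)
      finally have "(L2_ip M h (f n) - L2_ip M s (f n))\<^sup>2 \<le> e\<^sup>2"
        by (simp add: L2_ip_diff_left h sqs f)
      then show ?thesis using \<open>0 < e\<close> by (simp add: power2_le_iff_abs_le)
    qed
    moreover have "convergent (\<lambda>k. L2_ip M s (f (r k)))" using s by (simp add: D_def)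
    ultimately show "\<exists>Y. convergent Y \<and> (\<forall>n. \<bar>L2_ip M h (f (r n)) - Y n\<bar> \<le> e)" by blast
  qed
  define L where "L h = lim (\<lambda>k. L2_ip M h (f (r k)))" for h
  have L: "(\<lambda>k. L2_ip M h (f (r k))) \<longlonglongrightarrow> L h" if "sq_integrable M h" for h
    unfolding L_def using conv[OF that] by (simp add: convergent_LIMSEQ_iff)
  obtain g where g: "sq_integrable M g" "\<And>h. sq_integrable M h \<Longrightarrow> L h = L2_ip M g h"
  proof (rule sq_integrable_Riesz[of M L B])
    fix g h :: "'a \<Rightarrow> 'b" and t :: real assume gh: "sq_integrable M g" "sq_integrable M h"
    have "(\<lambda>k. L2_ip M g (f (r k)) + t * L2_ip M h (f (r k))) \<longlonglongrightarrow> L g + t * L h"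
      by (intro tendsto_intros L gh)
    moreover have "L2_ip M (\<lambda>x. g x + t *\<^sub>R h x) (f n) = L2_ip M g (f n) + t * L2_ip M h (f n)" for n
      using gh by (subst L2_ip_add_left) (auto simp: f sq_integrable_scaleR L2_ip_scaleR_left)
    moreover have "(\<lambda>k. L2_ip M (\<lambda>x. g x + t *\<^sub>R h x) (f (r k))) \<longlonglongrightarrow> L (\<lambda>x. g x + t *\<^sub>R h x)"
      by (intro L sq_integrable_add sq_integrable_scaleR gh)
    ultimately show "L (\<lambda>x. g x + t *\<^sub>R h x) = L g + t * L h"
      by (auto dest: LIMSEQ_unique)
  next
    fix h :: "'a \<Rightarrow> 'b" assume h: "sq_integrable M h"
    have "(\<lambda>k. (L2_ip M h (f (r k)))\<^sup>2) \<longlonglongrightarrow> (L h)\<^sup>2"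
      by (intro tendsto_intros L h)
    moreover have "(L2_ip M h (f n))\<^sup>2 \<le> B\<^sup>2 * normsq M h" for n
      using L2_ip_Cauchy_Schwarz[OF h f, of n] mult_left_mono[OF B[of n], of "normsq M h"]
      by (simp add: mult.commute)
    ultimately show "(L h)\<^sup>2 \<le> B\<^sup>2 * normsq M h"
      by (intro LIMSEQ_le_const2) auto
  qed blast
  show ?thesis
  proof (rule that[OF r g(1)])
    fix h :: "'a \<Rightarrow> 'b" assume "sq_integrable M h"
    then show "(\<lambda>n. L2_ip M (f (r n)) h) \<longlonglongrightarrow> L2_ip M g h"
      using L[of h] g(2)[of h] by (simp add: L2_ip_commute)
  qed
qed

section \<open>Smooth functions and test functions\<close>

lemma C_k_SucI:
  assumes "\<And>x. (f has_derivative f' x) (at x)" "\<And>b. b \<in> Basis \<Longrightarrow> C_k k (\<lambda>x. f' x b)"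
  shows "C_k (Suc k) f"
proof -
  have "frechet_derivative f (at x) = f' x" for x
    using frechet_derivative_at[OF assms(1)] by simp
  moreover have "f differentiable (at x)" for x
    using assms(1) by (auto simp: differentiable_def)
  ultimately show ?thesis using assms(2) by simp
qed

lemma C_k_SucD:
  assumes "C_k (Suc k) f"
  shows "(f has_derivative frechet_derivative f (at x)) (at x)"
  using assms by (simp add: frechet_derivative_works)

lemma C_k_Suc_imp_C_k: "C_k (Suc k) f \<Longrightarrow> C_k k f"
proof (induction k arbitrary: f)
  case 0
  then show ?case
    by (simp add: continuous_on_eq_continuous_at differentiable_imp_continuous_within)
next
  case (Suc k)
  then show ?case
    by (metis C_k.simps(2))
qed

lemma C_k_const: "C_k k (\<lambda>x. c)"
proof (induction k arbitrary: c)
  case (Suc k)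
  show ?case
    by (rule C_k_SucI[where f'="\<lambda>_ _. 0"]) (auto intro: Suc)
qed simp

lemma C_k_add: "C_k k f \<Longrightarrow> C_k k g \<Longrightarrow> C_k k (\<lambda>x. f x + g x)"
proof (induction k arbitrary: f g)
  case 0
  then show ?case by (simp add: continuous_on_add)
next
  case (Suc k)
  show ?case
  proof (rule C_k_SucI)
    show "((\<lambda>x. f x + g x) has_derivative
        (\<lambda>h. frechet_derivative f (at x) h + frechet_derivative g (at x) h)) (at x)" for x
      by (intro has_derivative_add C_k_SucD[OF Suc.prems(1)] C_k_SucD[OF Suc.prems(2)])
  qed (use Suc in simp)
qed

lemma C_k_mult: "C_k k f \<Longrightarrow> C_k k g \<Longrightarrow> C_k k (\<lambda>x. f x * g x)"
proof (induction k arbitrary: f g)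
  case 0
  then show ?case by (simp add: continuous_on_mult)
next
  case (Suc k)
  show ?case
  proof (rule C_k_SucI)
    show "((\<lambda>x. f x * g x) has_derivative
        (\<lambda>h. f x * frechet_derivative g (at x) h + frechet_derivative f (at x) h * g x)) (at x)" for x
      by (intro has_derivative_mult C_k_SucD[OF Suc.prems(1)] C_k_SucD[OF Suc.prems(2)])
  qed (use Suc C_k_Suc_imp_C_k[OF Suc.prems(1)] C_k_Suc_imp_C_k[OF Suc.prems(2)] in \<open>auto intro!: C_k_add\<close>)
qed

lemma C_k_affine: "C_k k (\<lambda>x. c + x \<bullet> a)"
proof (cases k)
  case 0
  then show ?thesis by (simp add: continuous_on_add continuous_on_inner)
next
  case (Suc m)
  show ?thesis unfolding Suc
    by (rule C_k_SucI[where f'="\<lambda>_ h. h \<bullet> a"]) (auto intro!: derivative_eq_intros C_k_const)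
qed

lemma C_k_inverse:
  assumes "C_k k f" "\<And>x. f x \<noteq> 0"
  shows "C_k k (\<lambda>x. inverse (f x))"
  using assms
proof (induction k arbitrary: f)
  case 0
  then show ?case by (simp add: continuous_on_inverse)
next
  case (Suc k)
  show ?case
  proof (rule C_k_SucI)
    show "((\<lambda>x. inverse (f x)) has_derivative
        (\<lambda>h. (-1) * (inverse (f x) * frechet_derivative f (at x) h * inverse (f x)))) (at x)" for x
      using Deriv.has_derivative_inverse[OF Suc.prems(2) C_k_SucD[OF Suc.prems(1)], of x] by simp
  next
    fix b :: 'a assume "b \<in> Basis"
    with Suc C_k_Suc_imp_C_k[OF Suc.prems(1)]
    show "C_k k (\<lambda>x. (-1) * (inverse (f x) * frechet_derivative f (at x) b * inverse (f x)))"
      by (intro C_k_mult C_k_const) auto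
  qed
qed

section \<open>The Plummer potential and its derivatives\<close>

definition plummer :: "real \<Rightarrow> 'a::euclidean_space \<Rightarrow> real" where
  "plummer \<delta> z = inverse (sqrt (z \<bullet> z + \<delta>\<^sup>2))"

lemma plummer_radicand_pos: "0 < \<delta> \<Longrightarrow> 0 < z \<bullet> z + \<delta>\<^sup>2"
  by (simp add: add_nonneg_pos)

lemma plummer_pos: "0 < \<delta> \<Longrightarrow> 0 < plummer \<delta> z"
  by (simp add: plummer_def plummer_radicand_pos)

lemma plummer_sq: "0 < \<delta> \<Longrightarrow> (plummer \<delta> z)\<^sup>2 * (z \<bullet> z + \<delta>\<^sup>2) = 1"
  using plummer_radicand_pos[of \<delta> z] by (simp add: plummer_def power_inverse)

lemma plummer_minus: "plummer \<delta> (- z) = plummer \<delta> z"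
  by (simp add: plummer_def)

text \<open>The derivative is again a polynomial in the coordinates and in \<open>plummer\<close>;
  this closed form lets smoothness of every order follow by induction.\<close>

lemma has_derivative_plummer:
  fixes p :: "'a::euclidean_space"
  assumes "0 < \<delta>"
  shows "((\<lambda>x. plummer \<delta> (x - p)) has_derivative (\<lambda>h. - ((x - p) \<bullet> h) * plummer \<delta> (x - p) ^ 3)) (at x)"
proof -
  let ?q = "\<lambda>x. (x - p) \<bullet> (x - p) + \<delta>\<^sup>2"
  have q: "0 < ?q x" by (rule plummer_radicand_pos[OF assms])
  have "((\<lambda>x. inverse (sqrt (?q x))) has_derivative
      (\<lambda>h. - (inverse (sqrt (?q x)) * ((2 * ((x - p) \<bullet> h)) * (inverse (sqrt (?q x)) / 2)) * inverse (sqrt (?q x))))) (at x)"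
    using q by (auto intro!: derivative_eq_intros simp: inner_commute)
  then show ?thesis
    by (simp add: plummer_def power3_eq_cube mult_ac)
qed

lemma C_k_plummer:
  fixes p :: "'a::euclidean_space"
  assumes "0 < \<delta>"
  shows "C_k k (\<lambda>x. plummer \<delta> (x - p))"
proof (induction k)
  case 0
  have "(x - p) \<bullet> (x - p) + \<delta>\<^sup>2 \<noteq> 0" for x
    using plummer_radicand_pos[OF assms, of "x - p"] by simp
  then show ?case
    by (auto simp: plummer_def intro!: continuous_intros)
next
  case (Suc k)
  show ?case
  proof (rule C_k_SucI[OF has_derivative_plummer[OF assms]])
    fix b :: 'a
    \<comment> \<open>An affine function times three copies of the potential, so order
      \<open>k\<close> of the potential itself yields order \<open>k\<close> of its
      derivative.\<close>
    have "C_k k (\<lambda>x. (-1) * ((- (p \<bullet> b) + x \<bullet> b) * (plummer \<delta> (x - p) * (plummer \<delta> (x - p) * plummer \<delta> (x - p)))))"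
      by (intro C_k_mult C_k_const C_k_affine Suc)
    then show "C_k k (\<lambda>x. - ((x - p) \<bullet> b) * plummer \<delta> (x - p) ^ 3)"
      by (simp add: power3_eq_cube inner_diff_left algebra_simps)
  qed
qed

text \<open>The function \<open>z \<mapsto> plummer \<delta> z ^ 3 * (z \<bullet> a)\<close> is minus the derivative of the Plummer potential in
  direction \<open>a\<close>; its gradient is \<open>plummer_hess \<delta> a\<close>.\<close>

definition plummer_hess :: "real \<Rightarrow> 'a::euclidean_space \<Rightarrow> 'a \<Rightarrow> 'a" where
  "plummer_hess \<delta> a z = plummer \<delta> z ^ 3 *\<^sub>R a - (3 * plummer \<delta> z ^ 5 * (z \<bullet> a)) *\<^sub>R z"

text \<open>The kernel sits at a difference \<open>x - y\<close> and acts as a test function in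
  \<open>y\<close> for the curl and in \<open>x\<close> for the divergence; hence both orders of
  subtraction.\<close>

lemma C_k_plummer_cubed_inner:
  fixes p :: "'a::euclidean_space"
  assumes "0 < \<delta>"
  shows "C_k k (\<lambda>x. plummer \<delta> (x - p) ^ 3 * ((x - p) \<bullet> a))"
    and "C_k k (\<lambda>x. plummer \<delta> (p - x) ^ 3 * ((p - x) \<bullet> a))"
proof -
  have "C_k k (\<lambda>x. (- (p \<bullet> a) + x \<bullet> a) * (plummer \<delta> (x - p) * (plummer \<delta> (x - p) * plummer \<delta> (x - p))))"
    by (intro C_k_mult C_k_affine C_k_plummer assms)
  then show 1: "C_k k (\<lambda>x. plummer \<delta> (x - p) ^ 3 * ((x - p) \<bullet> a))"
    by (simp add: power3_eq_cube inner_diff_left algebra_simps)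
  have "C_k k (\<lambda>x. (-1) * (plummer \<delta> (x - p) ^ 3 * ((x - p) \<bullet> a)))"
    by (intro C_k_mult C_k_const 1)
  moreover have "plummer \<delta> (p - x) = plummer \<delta> (x - p)" for x
    using plummer_minus[of \<delta> "x - p"] by simp
  moreover have "(p - x) \<bullet> a = - ((x - p) \<bullet> a)" for x
    by (simp add: inner_diff_left)
  ultimately show "C_k k (\<lambda>x. plummer \<delta> (p - x) ^ 3 * ((p - x) \<bullet> a))"
    by simp
qed

text \<open>The opposite signs come from the chain rule. As a result the curl and divergence
  formulas used later carry the same minus sign: the curl gets it from here, the divergence from the
  definition of the weak divergence.\<close>

lemma has_derivative_plummer_cubed_inner:
  fixes p :: "'a::euclidean_space"
  assumes "0 < \<delta>"
  shows "((\<lambda>x. plummer \<delta> (x - p) ^ 3 * ((x - p) \<bullet> a)) has_derivative (\<lambda>h. plummer_hess \<delta> a (x - p) \<bullet> h)) (at x)"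
    and "((\<lambda>x. plummer \<delta> (p - x) ^ 3 * ((p - x) \<bullet> a)) has_derivative (\<lambda>h. (- plummer_hess \<delta> a (p - x)) \<bullet> h)) (at x)"
proof -
  have "((\<lambda>x. plummer \<delta> (x - p) ^ 3 * ((x - p) \<bullet> a)) has_derivative
     (\<lambda>h. plummer \<delta> (x - p) ^ 3 * (h \<bullet> a) + (of_nat 3 * (- ((x - p) \<bullet> h) * plummer \<delta> (x - p) ^ 3) * plummer \<delta> (x - p) ^ (3 - 1)) * ((x - p) \<bullet> a))) (at x)" for x
    by (auto intro!: derivative_eq_intros has_derivative_plummer[OF assms])
  moreover have "plummer \<delta> (x - p) ^ 3 * (h \<bullet> a) + (of_nat 3 * (- ((x - p) \<bullet> h) * plummer \<delta> (x - p) ^ 3) * plummer \<delta> (x - p) ^ (3 - 1)) * ((x - p) \<bullet> a)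
    = plummer_hess \<delta> a (x - p) \<bullet> h" for x h
  proof -
    have "plummer \<delta> (x - p) ^ 3 * plummer \<delta> (x - p) ^ (3 - 1) = plummer \<delta> (x - p) ^ 5"
      by (simp flip: power_add)
    then show ?thesis
      by (simp add: plummer_hess_def inner_diff_left inner_commute[of h a])
        (simp add: algebra_simps)
  qed
  ultimately show 1: "((\<lambda>x. plummer \<delta> (x - p) ^ 3 * ((x - p) \<bullet> a)) has_derivative (\<lambda>h. plummer_hess \<delta> a (x - p) \<bullet> h)) (at x)" for x
    by simp
  have "((\<lambda>x. - (plummer \<delta> (x - p) ^ 3 * ((x - p) \<bullet> a))) has_derivative (\<lambda>h. - (plummer_hess \<delta> a (x - p) \<bullet> h))) (at x)"
    by (intro has_derivative_minus 1)
  moreover have "plummer \<delta> (p - x) = plummer \<delta> (x - p)" for x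
    using plummer_minus[of \<delta> "x - p"] by simp
  moreover have "(p - x) \<bullet> a = - ((x - p) \<bullet> a)" for x
    by (simp add: inner_diff_left)
  moreover have "plummer_hess \<delta> a (p - x) = plummer_hess \<delta> a (x - p)"
    using plummer_minus[of \<delta> "x - p"] by (simp add: plummer_hess_def inner_diff_left algebra_simps)
  ultimately show "((\<lambda>x. plummer \<delta> (p - x) ^ 3 * ((p - x) \<bullet> a)) has_derivative (\<lambda>h. (- plummer_hess \<delta> a (p - x)) \<bullet> h)) (at x)"
    by simp
qed

section \<open>Gradients and test functions\<close>

lemma grad_eqI:
  assumes "(f has_derivative (\<lambda>h. w \<bullet> h)) (at x)"
  shows "grad f x = w"
  using frechet_derivative_at[OF assms, symmetric]
  by (simp add: grad_def vec_eq_iff inner_axis)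

lemma has_derivative_grad:
  assumes "f differentiable (at x)"
  shows "(f has_derivative (\<lambda>h. grad f x \<bullet> h)) (at x)"
proof -
  have d: "(f has_derivative frechet_derivative f (at x)) (at x)"
    using assms by (simp add: frechet_derivative_works)
  then interpret bounded_linear "frechet_derivative f (at x)"
    by (rule has_derivative_bounded_linear)
  have "frechet_derivative f (at x) h = grad f x \<bullet> h" for h
  proof -
    have "frechet_derivative f (at x) h = frechet_derivative f (at x) (\<Sum>i\<in>UNIV. (h $ i) *\<^sub>R axis i 1)"
      using basis_expansion[of h] by (simp add: scalar_mult_eq_scaleR)
    also have "\<dots> = (\<Sum>i\<in>UNIV. h $ i * frechet_derivative f (at x) (axis i 1))"
      by (simp add: sum scale)
    also have "\<dots> = grad f x \<bullet> h"
      by (simp add: grad_def inner_vec_def mult.commute)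
    finally show ?thesis .
  qed
  then show ?thesis using d by (metis (no_types, lifting) ext)
qed

lemma grad_mult:
  assumes "f differentiable (at x)" "(g has_derivative (\<lambda>h. w \<bullet> h)) (at x)"
  shows "grad (\<lambda>x. f x * g x) x = g x *\<^sub>R grad f x + f x *\<^sub>R w"
  by (rule grad_eqI)
    (use has_derivative_mult[OF has_derivative_grad[OF assms(1)] assms(2)] in
      \<open>simp add: inner_add_left algebra_simps\<close>)

lemma test_functionsD:
  assumes "\<phi> \<in> test_functions \<Omega>"
  shows "C_k k \<phi>" "\<phi> differentiable (at x)" "continuous_on UNIV \<phi>"
    "compact (closure {x. \<phi> x \<noteq> 0})" "closure {x. \<phi> x \<noteq> 0} \<subseteq> \<Omega>"
    "x \<notin> \<Omega> \<Longrightarrow> \<phi> x = 0"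
proof -
  have *: "C_k k \<phi>" for k using assms by (simp add: test_functions_def)
  show "C_k k \<phi>" by fact
  show "\<phi> differentiable (at x)" using *[of "Suc 0"] by simp
  show "continuous_on UNIV \<phi>" using *[of 0] by simp
  show "compact (closure {x. \<phi> x \<noteq> 0})" "closure {x. \<phi> x \<noteq> 0} \<subseteq> \<Omega>"
    using assms by (auto simp: test_functions_def)
  then show "x \<notin> \<Omega> \<Longrightarrow> \<phi> x = 0"
    using closure_subset[of "{x. \<phi> x \<noteq> 0}"] by auto
qed

text \<open>The factor \<open>g\<close> may have unbounded support: this is how kernels defined on
  the whole space enter the distributional definitions.\<close>

lemma test_functions_mult:
  assumes \<phi>: "\<phi> \<in> test_functions \<Omega>" and g: "\<And>k. C_k k g"
  shows "(\<lambda>x. \<phi> x * g x) \<in> test_functions \<Omega>"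
proof -
  have "closure {x. \<phi> x * g x \<noteq> 0} \<subseteq> closure {x. \<phi> x \<noteq> 0}"
    by (intro closure_mono) auto
  moreover from this have "compact (closure {x. \<phi> x * g x \<noteq> 0})"
    using compact_Int_closed[OF test_functionsD(4)[OF \<phi>] closed_closure, of "{x. \<phi> x * g x \<noteq> 0}"]
    by (simp add: Int_absorb1)
  moreover have "C_k k (\<lambda>x. \<phi> x * g x)" for k
    by (intro C_k_mult g test_functionsD(1)[OF \<phi>])
  ultimately show ?thesis
    using test_functionsD(5)[OF \<phi>] unfolding test_functions_def by blast
qed

lemma grad_outside:
  assumes "x \<notin> closure {x. \<phi> x \<noteq> 0}"
  shows "grad \<phi> x = 0"
proof (rule grad_eqI)
  let ?U = "- closure {x. \<phi> x \<noteq> 0}"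
  have "((\<lambda>_. 0) has_derivative (\<lambda>h. 0 \<bullet> h)) (at x)" by simp
  then show "(\<phi> has_derivative (\<lambda>h. 0 \<bullet> h)) (at x)"
  proof (rule has_derivative_transform_within_open)
    show "open ?U" by auto
    show "x \<in> ?U" using assms by simp
    show "0 = \<phi> y" if "y \<in> ?U" for y
      using that closure_subset[of "{x. \<phi> x \<noteq> 0}"] by auto
  qed
qed

lemma continuous_on_grad:
  assumes "\<phi> \<in> test_functions \<Omega>"
  shows "continuous_on UNIV (grad \<phi>)"
proof -
  have "axis i 1 \<in> (Basis :: (real^3) set)" for i by simp
  then have "continuous_on UNIV (\<lambda>x. frechet_derivative \<phi> (at x) (axis i 1))" for i
    using test_functionsD(1)[OF assms, of "Suc 0"] by simp
  then show ?thesis unfolding grad_def[abs_def] by (intro continuous_on_vec_lambda)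
qed

lemma bounded_continuous_compact_support:
  fixes f :: "'a::euclidean_space \<Rightarrow> 'b::euclidean_space"
  assumes "continuous_on UNIV f" "compact K" "\<And>x. x \<notin> K \<Longrightarrow> f x = 0"
  obtains B where "0 < B" "\<And>x. norm (f x) \<le> B"
proof -
  have "compact (f ` K)"
    using assms by (meson compact_continuous_image continuous_on_subset subset_UNIV)
  then obtain B where "0 < B" "\<And>x. x \<in> K \<Longrightarrow> norm (f x) \<le> B"
    by (metis bounded_pos compact_imp_bounded imageI)
  then show ?thesis
    using that[of B] assms(3) by (metis less_imp_le norm_zero)
qed

lemma test_functions_bounded:
  assumes "\<phi> \<in> test_functions \<Omega>"
  obtains B where "0 < B" "\<And>x. \<bar>\<phi> x\<bar> \<le> B" "\<And>x. norm (grad \<phi> x) \<le> B"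
proof -
  let ?K = "closure {x. \<phi> x \<noteq> 0}"
  obtain B1 where B1: "0 < B1" "\<And>x. norm (\<phi> x) \<le> B1"
    using bounded_continuous_compact_support[OF test_functionsD(3,4)[OF assms]]
      closure_subset[of "{x. \<phi> x \<noteq> 0}"] by blast
  obtain B2 where B2: "0 < B2" "\<And>x. norm (grad \<phi> x) \<le> B2"
    using bounded_continuous_compact_support[OF continuous_on_grad[OF assms] test_functionsD(4)[OF assms]]
      grad_outside by blast
  show ?thesis
    using that[of "max B1 B2"] B1 B2 by (auto simp: le_max_iff_disj)
qed

text \<open>With \<open>\<psi> = \<phi>\<^sup>2 / (\<phi>\<^sup>2 + \<eta>\<^sup>2)\<close> the product \<open>\<phi> \<psi>\<close> approximates \<open>\<phi>\<close> uniformly.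
  This replaces a cutoff function that equals 1 on the support of \<open>\<phi>\<close>.\<close>

lemma test_functions_soft_cutoff:
  assumes \<phi>: "\<phi> \<in> test_functions \<Omega>" and "0 < \<eta>"
  obtains \<psi> where "\<psi> \<in> test_functions \<Omega>" "\<And>x. \<bar>\<phi> x - \<phi> x * \<psi> x\<bar> \<le> \<eta>"
proof -
  define g where "g x = inverse (\<phi> x * \<phi> x + \<eta>\<^sup>2)" for x
  define \<psi> where "\<psi> x = \<phi> x * (\<phi> x * g x)" for x
  have pos: "0 < \<phi> x * \<phi> x + \<eta>\<^sup>2" for x
    using \<open>0 < \<eta>\<close> by (simp add: add_nonneg_pos)
  have g: "C_k k g" for k
    unfolding g_def using pos
    by (intro C_k_inverse C_k_add C_k_mult C_k_const test_functionsD(1)[OF \<phi>]) (metis less_irrefl)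
  have "\<psi> \<in> test_functions \<Omega>"
    unfolding \<psi>_def by (intro test_functions_mult[OF \<phi>] C_k_mult g test_functionsD(1)[OF \<phi>])
  moreover have "\<bar>\<phi> x - \<phi> x * \<psi> x\<bar> \<le> \<eta>" for x
  proof -
    have "\<phi> x - \<phi> x * \<psi> x = \<phi> x * \<eta>\<^sup>2 / (\<phi> x * \<phi> x + \<eta>\<^sup>2)"
      using pos[of x] by (simp add: \<psi>_def g_def field_simps)
    \<comment> \<open>Young's inequality absorbs \<open>\<phi> x\<close> into the denominator and
      leaves one factor \<eta>, whatever the size of \<open>\<phi> x\<close>.\<close>
    moreover have "\<bar>\<phi> x\<bar> * \<eta> \<le> \<phi> x * \<phi> x + \<eta>\<^sup>2"
      using norm_mult_le_sum_squares[of "\<phi> x" \<eta>] \<open>0 < \<eta>\<close> by (simp add: power2_eq_square)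
    then have "\<bar>\<phi> x\<bar> * \<eta> * \<eta> \<le> (\<phi> x * \<phi> x + \<eta>\<^sup>2) * \<eta>"
      using \<open>0 < \<eta>\<close> by (intro mult_right_mono) auto
    ultimately show ?thesis
      using pos[of x] by (simp add: abs_mult pos_divide_le_eq power2_eq_square mult_ac)
  qed
  ultimately show ?thesis by (rule that)
qed

section \<open>Integration over Euclidean space\<close>

lemma nn_integral_lborel_affine:
  fixes f :: "'a::euclidean_space \<Rightarrow> ennreal"
  assumes "c \<noteq> 0" and [measurable]: "f \<in> borel_measurable borel"
  shows "(\<integral>\<^sup>+x. f x \<partial>lborel) = ennreal (\<bar>c\<bar> ^ DIM('a)) * (\<integral>\<^sup>+x. f (t + c *\<^sub>R x) \<partial>lborel)"
  by (subst lborel_affine[OF assms(1), of t])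
    (simp add: nn_integral_density nn_integral_distr nn_integral_cmult ennreal_power)

lemma integrable_lborel_affine:
  fixes f :: "'a::euclidean_space \<Rightarrow> 'b::{banach, second_countable_topology}"
  assumes "c \<noteq> 0" and f: "integrable lborel f"
  shows "integrable lborel (\<lambda>x. f (t + c *\<^sub>R x))"
proof -
  have [measurable]: "f \<in> borel_measurable borel" using f by simp
  have "(\<integral>\<^sup>+x. ennreal (norm (f x)) \<partial>lborel) < \<infinity>"
    using f by (simp add: integrable_iff_bounded)
  then have "ennreal (\<bar>c\<bar> ^ DIM('a)) * (\<integral>\<^sup>+x. ennreal (norm (f (t + c *\<^sub>R x))) \<partial>lborel) < \<infinity>"
    by (subst (asm) nn_integral_lborel_affine[OF assms(1), of _ t]) auto
  then show ?thesis
    using assms(1) by (auto simp: integrable_iff_bounded ennreal_mult_less_top)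
qed

lemma integral_lborel_affine:
  fixes f :: "'a::euclidean_space \<Rightarrow> 'b::euclidean_space"
  assumes "c \<noteq> 0" and [measurable]: "f \<in> borel_measurable borel"
  shows "(LBINT x. f x) = \<bar>c\<bar> ^ DIM('a) *\<^sub>R (LBINT x. f (t + c *\<^sub>R x))"
proof -
  have *: "ennreal \<bar>c\<bar> ^ DIM('a) = ennreal (\<bar>c\<bar> ^ DIM('a))"
    by (simp add: ennreal_power)
  show ?thesis
    by (subst lborel_affine[OF assms(1), of t])
      (simp add: * integral_density integral_distr)
qed

text \<open>A form of Young's convolution inequality. Splitting the product of the norms into a sum
  of squares leaves two integrals, each of which factorises by Tonelli and by invariance of
  \<open>lborel\<close> under translations and reflections. The bound is a sum of squared norms
  instead of a product of norms; where smallness in one factor matters, the fields are rescaled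
  first.\<close>

lemma kernel_integrable_bound:
  fixes F :: "'a::euclidean_space \<times> 'a \<Rightarrow> real" and K :: "'a \<Rightarrow> real"
    and f :: "'a \<Rightarrow> 'b::euclidean_space" and g :: "'a \<Rightarrow> 'c::euclidean_space"
  assumes [measurable]: "F \<in> borel_measurable (lborel \<Otimes>\<^sub>M lborel)"
    and K: "integrable lborel K" "\<And>z. 0 \<le> K z"
    and f: "sq_integrable lborel f" and g: "sq_integrable lborel g"
    and le: "\<And>x y. \<bar>F (x, y)\<bar> \<le> K (x - y) * (norm (f y) * norm (g x))"
  shows "integrable (lborel \<Otimes>\<^sub>M lborel) F"
    and "\<bar>\<integral>p. F p \<partial>(lborel \<Otimes>\<^sub>M lborel)\<bar> \<le> (LBINT z. K z) * (normsq lborel f + normsq lborel g)"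
proof -
  have [measurable]: "f \<in> borel_measurable borel" "g \<in> borel_measurable borel" "K \<in> borel_measurable borel"
    using f g K by (auto simp: sq_integrable_def)
  let ?f2 = "\<lambda>y. ennreal ((norm (f y))\<^sup>2)" and ?g2 = "\<lambda>x. ennreal ((norm (g x))\<^sup>2)"
  have K1: "(\<integral>\<^sup>+z. ennreal (K z) \<partial>lborel) = ennreal (LBINT z. K z)"
    using K by (intro nn_integral_eq_integral) auto
  have K2: "(\<integral>\<^sup>+x. ennreal (K (x - y)) \<partial>lborel) = (\<integral>\<^sup>+z. ennreal (K z) \<partial>lborel)" for y
    by (subst nn_integral_lborel_affine[of 1 "\<lambda>z. ennreal (K z)" "- y"]) (auto simp: algebra_simps)
  have K3: "(\<integral>\<^sup>+y. ennreal (K (x - y)) \<partial>lborel) = (\<integral>\<^sup>+z. ennreal (K z) \<partial>lborel)" for x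
    by (subst nn_integral_lborel_affine[of "-1" "\<lambda>z. ennreal (K z)" x]) auto
  have "(\<integral>\<^sup>+p. ennreal \<bar>F p\<bar> \<partial>(lborel \<Otimes>\<^sub>M lborel))
      \<le> (\<integral>\<^sup>+p. ennreal (K (fst p - snd p)) * ?f2 (snd p) + ennreal (K (fst p - snd p)) * ?g2 (fst p) \<partial>(lborel \<Otimes>\<^sub>M lborel))"
  proof (rule nn_integral_mono)
    fix p :: "'a \<times> 'a"
    obtain x y where p: "p = (x, y)" by (cases p)
    have "\<bar>F p\<bar> \<le> K (x - y) * ((norm (f y))\<^sup>2 + (norm (g x))\<^sup>2)"
      unfolding p by (intro order_trans[OF le] mult_left_mono K norm_mult_le_sum_squares)
    then have "ennreal \<bar>F p\<bar> \<le> ennreal (K (x - y) * (norm (f y))\<^sup>2 + K (x - y) * (norm (g x))\<^sup>2)"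
      by (intro ennreal_leI) (simp add: distrib_left)
    also have "\<dots> = ennreal (K (x - y)) * ?f2 y + ennreal (K (x - y)) * ?g2 x"
      using K by (simp add: ennreal_mult)
    finally show "ennreal \<bar>F p\<bar> \<le> ennreal (K (fst p - snd p)) * ?f2 (snd p) + ennreal (K (fst p - snd p)) * ?g2 (fst p)"
      by (simp add: p)
  qed
  also have "\<dots> = (\<integral>\<^sup>+p. ennreal (K (fst p - snd p)) * ?f2 (snd p) \<partial>(lborel \<Otimes>\<^sub>M lborel))
      + (\<integral>\<^sup>+p. ennreal (K (fst p - snd p)) * ?g2 (fst p) \<partial>(lborel \<Otimes>\<^sub>M lborel))"
    by (rule nn_integral_add) auto
  also have "(\<integral>\<^sup>+p. ennreal (K (fst p - snd p)) * ?f2 (snd p) \<partial>(lborel \<Otimes>\<^sub>M lborel))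
      = (\<integral>\<^sup>+y. \<integral>\<^sup>+x. ennreal (K (x - y)) * ?f2 y \<partial>lborel \<partial>lborel)"
    by (subst lborel_pair.nn_integral_snd[symmetric]) auto
  also have "\<dots> = (\<integral>\<^sup>+z. ennreal (K z) \<partial>lborel) * (\<integral>\<^sup>+y. ?f2 y \<partial>lborel)"
    by (simp add: nn_integral_multc nn_integral_cmult K2)
  also have "(\<integral>\<^sup>+p. ennreal (K (fst p - snd p)) * ?g2 (fst p) \<partial>(lborel \<Otimes>\<^sub>M lborel))
      = (\<integral>\<^sup>+x. \<integral>\<^sup>+y. ennreal (K (x - y)) * ?g2 x \<partial>lborel \<partial>lborel)"
    by (subst lborel.nn_integral_fst[symmetric]) auto
  also have "\<dots> = (\<integral>\<^sup>+z. ennreal (K z) \<partial>lborel) * (\<integral>\<^sup>+y. ?g2 y \<partial>lborel)"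
    by (simp add: nn_integral_multc nn_integral_cmult K3)
  also have "(\<integral>\<^sup>+y. ?f2 y \<partial>lborel) = ennreal (normsq lborel f)"
    unfolding normsq_def using f by (intro nn_integral_eq_integral) (auto simp: sq_integrable_def)
  also have "(\<integral>\<^sup>+y. ?g2 y \<partial>lborel) = ennreal (normsq lborel g)"
    unfolding normsq_def using g by (intro nn_integral_eq_integral) (auto simp: sq_integrable_def)
  also have "(\<integral>\<^sup>+z. ennreal (K z) \<partial>lborel) * ennreal (normsq lborel f) + (\<integral>\<^sup>+z. ennreal (K z) \<partial>lborel) * ennreal (normsq lborel g)
      = ennreal ((LBINT z. K z) * (normsq lborel f + normsq lborel g))"
    using K by (simp add: K1 distrib_left ennreal_mult[symmetric] ennreal_plus[symmetric] integral_nonneg_AE del: ennreal_plus)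
  finally have bound: "(\<integral>\<^sup>+p. ennreal \<bar>F p\<bar> \<partial>(lborel \<Otimes>\<^sub>M lborel)) \<le> ennreal ((LBINT z. K z) * (normsq lborel f + normsq lborel g))" .
  then show int: "integrable (lborel \<Otimes>\<^sub>M lborel) F"
    using le_less_trans[OF bound ennreal_less_top] by (auto simp: integrable_iff_bounded)
  have "ennreal \<bar>\<integral>p. F p \<partial>(lborel \<Otimes>\<^sub>M lborel)\<bar> \<le> (\<integral>\<^sup>+p. ennreal \<bar>F p\<bar> \<partial>(lborel \<Otimes>\<^sub>M lborel))"
    using integral_norm_bound_ennreal[OF int] by simp
  then show "\<bar>\<integral>p. F p \<partial>(lborel \<Otimes>\<^sub>M lborel)\<bar> \<le> (LBINT z. K z) * (normsq lborel f + normsq lborel g)"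
    using order_trans[OF _ bound] K
    by (subst ennreal_le_iff[symmetric]) (auto intro!: mult_nonneg_nonneg integral_nonneg_AE)
qed

section \<open>The regularised Newton kernel\<close>

lemma plummer_measurable [measurable]: "plummer \<delta> \<in> borel_measurable borel"
  unfolding plummer_def[abs_def] by measurable

lemma plummer_hess_measurable [measurable]:
  fixes f g :: "'x \<Rightarrow> 'a::euclidean_space"
  assumes [measurable]: "f \<in> borel_measurable M" "g \<in> borel_measurable M"
  shows "(\<lambda>x. plummer_hess \<delta> (f x) (g x)) \<in> borel_measurable M"
  unfolding plummer_hess_def by measurable

lemma plummer_le: "0 < \<delta> \<Longrightarrow> plummer \<delta> z \<le> inverse \<delta>"
  unfolding plummer_def by (intro le_imp_inverse_le real_le_rsqrt) auto

lemma norm_mult_plummer_le: "0 < \<delta> \<Longrightarrow> norm z * plummer \<delta> z \<le> 1"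
proof -
  assume "0 < \<delta>"
  then have "norm z \<le> sqrt (z \<bullet> z + \<delta>\<^sup>2)"
    unfolding norm_eq_sqrt_inner by simp
  then show ?thesis
    using plummer_radicand_pos[OF \<open>0 < \<delta>\<close>, of z] by (simp add: plummer_def field_simps)
qed

lemma plummer_antimono: "0 < \<delta> \<Longrightarrow> \<delta> \<le> \<epsilon> \<Longrightarrow> plummer \<epsilon> z \<le> plummer \<delta> z"
  unfolding plummer_def using plummer_radicand_pos[of \<delta> z]
  by (intro le_imp_inverse_le) (auto intro: power_mono)

lemma plummer_scale: "0 < \<delta> \<Longrightarrow> plummer \<delta> (\<delta> *\<^sub>R z) = plummer 1 z / \<delta>"
proof -
  assume "0 < \<delta>"
  have "sqrt ((\<delta> *\<^sub>R z) \<bullet> (\<delta> *\<^sub>R z) + \<delta>\<^sup>2) = sqrt (\<delta>\<^sup>2 * (z \<bullet> z + 1))"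
    by (simp add: algebra_simps power2_eq_square)
  also have "\<dots> = \<delta> * sqrt (z \<bullet> z + 1)"
    using \<open>0 < \<delta>\<close> by (simp add: real_sqrt_mult)
  finally show ?thesis by (simp add: plummer_def field_simps)
qed

text \<open>Since \<open>norm z * plummer \<delta> z\<close> is at most 1, so is its cube. The left
  side is the length of the gradient of the Plummer potential, the right side that of the Newton
  potential. At the origin both sides vanish, by \<open>inverse 0 = 0\<close>.\<close>

lemma norm_mult_plummer_cubed_le:
  assumes "0 < \<delta>"
  shows "norm z * plummer \<delta> z ^ 3 \<le> inverse (z \<bullet> z)"
proof (cases "z = 0")
  case False
  have "norm z ^ 3 * plummer \<delta> z ^ 3 \<le> 1 ^ 3"
    using norm_mult_plummer_le[OF assms, of z] plummer_pos[OF assms, of z]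
    by (subst power_mult_distrib[symmetric], intro power_mono) auto
  then show ?thesis
    using False by (simp add: field_simps power3_eq_cube flip: power2_norm_eq_inner power2_eq_square)
qed simp

text \<open>Like the bound on \<open>plummer_hess\<close>, this justifies integrability and Fubini
  for a fixed \<delta>, where its growth as \<delta> tends to 0 is harmless.\<close>

lemma norm_plummer_cubed_scaleR_le:
  assumes "0 < \<delta>"
  shows "norm (plummer \<delta> z ^ 3 *\<^sub>R z) \<le> inverse \<delta> ^ 2"
proof -
  have "norm (plummer \<delta> z ^ 3 *\<^sub>R z) = plummer \<delta> z ^ 2 * (norm z * plummer \<delta> z)"
    using plummer_pos[OF assms, of z] by (simp add: power3_eq_cube power2_eq_square)
  also have "\<dots> \<le> inverse \<delta> ^ 2 * 1"
    using assms plummer_pos[OF assms, of z] by (intro mult_mono power_mono plummer_le norm_mult_plummer_le) (auto simp: less_imp_le)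
  finally show ?thesis by simp
qed

lemma norm_plummer_hess_le:
  assumes "0 < \<delta>"
  shows "norm (plummer_hess \<delta> a z) \<le> 4 * inverse \<delta> ^ 3 * norm a"
proof -
  have r: "0 \<le> plummer \<delta> z" using plummer_pos[OF assms, of z] by simp
  have r3: "plummer \<delta> z ^ 3 \<le> inverse \<delta> ^ 3"
    using assms r by (intro power_mono plummer_le)
  have "norm (plummer_hess \<delta> a z) \<le> plummer \<delta> z ^ 3 * norm a + 3 * plummer \<delta> z ^ 5 * \<bar>z \<bullet> a\<bar> * norm z"
    unfolding plummer_hess_def using r by (intro order_trans[OF norm_triangle_ineq4]) (simp add: abs_mult)
  also have "\<dots> \<le> plummer \<delta> z ^ 3 * norm a + 3 * plummer \<delta> z ^ 5 * (norm z * norm a) * norm z"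
    using r by (intro add_left_mono mult_right_mono mult_left_mono Cauchy_Schwarz_ineq2) auto
  also have "\<dots> = plummer \<delta> z ^ 3 * norm a * (1 + 3 * (norm z * plummer \<delta> z)\<^sup>2)"
    by (simp add: power_mult_distrib power2_eq_square eval_nat_numeral algebra_simps)
  also have "\<dots> \<le> inverse \<delta> ^ 3 * norm a * (1 + 3 * 1\<^sup>2)"
    using assms r r3 by (intro mult_mono add_left_mono mult_left_mono power_mono norm_mult_plummer_le) auto
  finally show ?thesis by simp
qed

lemma cball_borel [measurable]: "cball (x::'a::euclidean_space) r \<in> sets borel"
  by simp

section \<open>Integrability of the radial kernels\<close>

text \<open>Comparison with a step function: the sum of \<open>c k\<close> times the indicator of
  the ball of radius \<open>\<rho> k\<close> has integral equal to the given series times the volume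
  of the unit ball. This replaces polar coordinates, both for a singularity at the origin and for
  decay at infinity.\<close>

lemma integrable_dyadic:
  fixes f :: "real^3 \<Rightarrow> real"
  assumes [measurable]: "f \<in> borel_measurable borel" and f: "\<And>z. 0 \<le> f z"
    and c: "\<And>k. 0 \<le> c k" and \<rho>: "\<And>k. 0 \<le> \<rho> k"
    and le: "\<And>z. f z \<noteq> 0 \<Longrightarrow> \<exists>k::nat. norm z \<le> \<rho> k \<and> f z \<le> c k"
    and sum: "summable (\<lambda>k. c k * \<rho> k ^ 3)"
  shows "integrable lborel f"
proof -
  let ?V = "unit_ball_vol 3"
  have "(\<integral>\<^sup>+z. ennreal (f z) \<partial>lborel) \<le> (\<integral>\<^sup>+z. (\<Sum>k. ennreal (c k) * indicator (cball 0 (\<rho> k)) (z::real^3)) \<partial>lborel)"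
  proof (rule nn_integral_mono)
    fix z :: "real^3"
    show "ennreal (f z) \<le> (\<Sum>k. ennreal (c k) * indicator (cball 0 (\<rho> k)) z)"
    proof (cases "f z = 0")
      case False
      then obtain k where k: "norm z \<le> \<rho> k" "f z \<le> c k" using le by blast
      then have "ennreal (f z) \<le> (\<Sum>k\<in>{k}. ennreal (c k) * indicator (cball 0 (\<rho> k)) z)"
        by (simp add: ennreal_leI)
      also have "\<dots> \<le> (\<Sum>k. ennreal (c k) * indicator (cball 0 (\<rho> k)) z)"
        by (intro sum_le_suminf) auto
      finally show ?thesis .
    qed simp
  qed
  also have "\<dots> = (\<Sum>k. \<integral>\<^sup>+z. ennreal (c k) * indicator (cball 0 (\<rho> k)) (z::real^3) \<partial>lborel)"
    by (intro nn_integral_suminf) auto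
  also have "\<dots> = (\<Sum>k. ennreal (?V * (c k * \<rho> k ^ 3)))"
  proof (rule suminf_cong)
    fix k
    have "(\<integral>\<^sup>+z. ennreal (c k) * indicator (cball 0 (\<rho> k)) (z::real^3) \<partial>lborel)
        = ennreal (c k) * emeasure lborel (cball (0::real^3) (\<rho> k))"
      by (simp add: nn_integral_cmult)
    also have "\<dots> = ennreal (?V * (c k * \<rho> k ^ 3))"
      using c[of k] \<rho>[of k] by (simp add: emeasure_cball ennreal_mult[symmetric] mult_ac)
    finally show "(\<integral>\<^sup>+z. ennreal (c k) * indicator (cball 0 (\<rho> k)) (z::real^3) \<partial>lborel) = ennreal (?V * (c k * \<rho> k ^ 3))" .
  qed
  also have "\<dots> = ennreal (\<Sum>k. ?V * (c k * \<rho> k ^ 3))"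
    using c \<rho> sum by (intro suminf_ennreal2 summable_mult) auto
  also have "\<dots> < \<infinity>" by simp
  finally show ?thesis
    using f by (auto simp: integrable_iff_bounded)
qed

text \<open>The balls shrink dyadically: their volumes decay like \<open>(1/8) ^ k\<close> and beat
  the growth \<open>4 ^ k\<close> of the integrand.\<close>

lemma integrable_inverse_square_ball:
  assumes "0 < R"
  shows "integrable lborel (\<lambda>z::real^3. indicator (cball 0 R) z * inverse (z \<bullet> z))"
proof (rule integrable_dyadic)
  \<comment> \<open>The factor 4 comes from bounding the integrand by its value at the next smaller
    radius, outside which the point lies.\<close>
  let ?\<rho> = "\<lambda>k::nat. R * (1/2) ^ k" and ?c = "\<lambda>k::nat. 4 / R\<^sup>2 * 4 ^ k"
  show "\<exists>k. norm z \<le> ?\<rho> k \<and> indicator (cball 0 R) z * inverse (z \<bullet> z) \<le> ?c k"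
    if "indicator (cball 0 R) z * inverse (z \<bullet> z) \<noteq> 0" for z :: "real^3"
  proof -
    have z: "z \<noteq> 0" "norm z \<le> R" using that by (auto simp: indicator_def split: if_splits)
    obtain n where n: "?\<rho> n < norm z"
      using z assms real_arch_pow_inv[of "norm z / R" "1/2"] by (auto simp: field_simps)
    \<comment> \<open>The first radius below \<open>norm z\<close> is not the one with index 0, so
      the radius before it still covers \<open>z\<close>. The origin needs no ball because the
      integrand is 0 there, by \<open>inverse 0 = 0\<close>.\<close>
    define m where "m = (LEAST n. ?\<rho> n < norm z)"
    have m: "?\<rho> m < norm z" unfolding m_def using n by (rule LeastI)
    then have "m \<noteq> 0" using z by (cases m) auto
    then obtain k where k: "m = Suc k" by (cases m) auto
    have "\<not> ?\<rho> k < norm z"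
      using not_less_Least[of k "\<lambda>n. ?\<rho> n < norm z"] k m_def by simp
    then have 1: "norm z \<le> ?\<rho> k" by simp
    have "(?\<rho> m)\<^sup>2 \<le> (norm z)\<^sup>2" using m assms by (intro power_mono) auto
    then have "inverse ((norm z)\<^sup>2) \<le> inverse ((?\<rho> m)\<^sup>2)"
      using assms by (intro le_imp_inverse_le) auto
    also have "\<dots> = ?c k"
    proof -
      have "((1/2::real) ^ k)\<^sup>2 = 1 / 4 ^ k"
        by (simp add: power2_eq_square power_one_over flip: power_mult_distrib)
      then show ?thesis by (simp add: k power_mult_distrib field_simps)
    qed
    finally have "inverse (z \<bullet> z) \<le> ?c k" by (simp add: power2_norm_eq_inner)
    then show ?thesis using 1 z by (auto intro!: exI[of _ k])
  qed
  have "?c k * ?\<rho> k ^ 3 = 4 * R * (1/2) ^ k" for k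
  proof -
    have "(4::real) ^ k * ((1/2) ^ k) ^ 3 = (1/2) ^ k"
      by (simp add: power3_eq_cube flip: power_mult_distrib)
    then show ?thesis
      using assms by (simp add: power_mult_distrib power2_eq_square power3_eq_cube)
  qed
  then show "summable (\<lambda>k. ?c k * ?\<rho> k ^ 3)"
    by (simp add: summable_mult summable_geometric)
qed (use assms in auto)

text \<open>The balls now grow dyadically: the integrand decays like \<open>(1/32) ^ k\<close> and
  beats the volumes \<open>8 ^ k\<close>.\<close>

lemma integrable_plummer_fifth: "integrable lborel (\<lambda>z::real^3. plummer 1 z ^ 5)"
proof (rule integrable_dyadic)
  \<comment> \<open>The factor 32 absorbs an index shift: if the first ball containing
    \<open>z\<close> has index \<open>m > 0\<close>, the potential is bounded by the inverse radius
    of ball \<open>m - 1\<close>. For \<open>m = 0\<close> the bound by 1 is enough.\<close>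
  let ?\<rho> = "\<lambda>k::nat. 2 ^ k :: real" and ?c = "\<lambda>k::nat. 32 * (1/32) ^ k :: real"
  show "\<exists>k. norm z \<le> ?\<rho> k \<and> plummer 1 z ^ 5 \<le> ?c k" for z :: "real^3"
  proof -
    have r: "0 < plummer 1 z" "plummer 1 z \<le> 1" "norm z * plummer 1 z \<le> 1"
      using plummer_pos[of 1 z] plummer_le[of 1 z] norm_mult_plummer_le[of 1 z] by auto
    obtain n where n: "norm z < ?\<rho> n"
      using real_arch_pow[of 2 "norm z"] by auto
    define m where "m = (LEAST n. norm z < ?\<rho> n)"
    have m: "norm z < ?\<rho> m" unfolding m_def using n by (rule LeastI)
    show ?thesis
    proof (cases m)
      case 0
      have "plummer 1 z ^ 5 \<le> 1" using r by (intro power_le_one) auto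
      then show ?thesis using m 0 by (auto intro!: exI[of _ 0])
    next
      case (Suc k)
      have "\<not> norm z < ?\<rho> k"
        using not_less_Least[of k "\<lambda>n. norm z < ?\<rho> n"] Suc m_def by simp
      then have "?\<rho> k * plummer 1 z \<le> 1"
        using r by (intro order_trans[OF mult_right_mono r(3)]) auto
      then have "plummer 1 z \<le> (1/2) ^ k" by (simp add: field_simps)
      then have "plummer 1 z ^ 5 \<le> ((1/2) ^ k) ^ 5" using r by (intro power_mono) auto
      also have "\<dots> = (1/32) ^ k"
        by (simp add: power_mult[symmetric] mult.commute[of k]) (simp add: power_mult power_one_over)
      also have "\<dots> = ?c m" by (simp add: Suc)
      finally show ?thesis using m by (auto intro!: exI[of _ m])
    qed
  qed
  have "?c k * ?\<rho> k ^ 3 = 32 * (1/4) ^ k" for k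
  proof -
    have "(1/32 :: real) ^ k * ((2 ^ k) ^ 3) = ((1/32) * (2 * 2 * 2)) ^ k"
      unfolding power3_eq_cube by (simp only: power_mult_distrib)
    then show ?thesis by simp
  qed
  then have *: "(\<lambda>k. ?c k * ?\<rho> k ^ 3) = (\<lambda>k. 32 * (1/4) ^ k)"
    by (rule ext)
  show "summable (\<lambda>k. ?c k * ?\<rho> k ^ 3)"
    unfolding * by (intro summable_mult summable_geometric) simp
qed (auto simp: plummer_def)

text \<open>The length of the gradient of the Newton potential minus that of the Plummer potential,
  cut off at radius \<open>R\<close>. It does not mention \<delta>, so it can majorise the kernel
  differences for all \<open>\<delta> \<le> \<epsilon>\<close> at once.\<close>

definition plummer_defect :: "real \<Rightarrow> real \<Rightarrow> real^3 \<Rightarrow> real" where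
  "plummer_defect R \<epsilon> z = indicator (cball 0 R) z * (inverse (z \<bullet> z) - norm z * plummer \<epsilon> z ^ 3)"

lemma plummer_defect_measurable [measurable]: "plummer_defect R \<epsilon> \<in> borel_measurable borel"
  unfolding plummer_defect_def[abs_def] by measurable

lemma plummer_defect_nonneg: "0 < \<epsilon> \<Longrightarrow> 0 \<le> plummer_defect R \<epsilon> z"
  using norm_mult_plummer_cubed_le[of \<epsilon> z] by (auto simp: plummer_defect_def indicator_def)

lemma plummer_defect_le: "0 < \<epsilon> \<Longrightarrow> \<bar>plummer_defect R \<epsilon> z\<bar> \<le> indicator (cball 0 R) z * inverse (z \<bullet> z)"
  using norm_mult_plummer_cubed_le[of \<epsilon> z] plummer_pos[of \<epsilon> z] by (auto simp: plummer_defect_def indicator_def)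

lemma integrable_plummer_defect: "0 < R \<Longrightarrow> 0 < \<epsilon> \<Longrightarrow> integrable lborel (plummer_defect R \<epsilon>)"
  by (rule Bochner_Integration.integrable_bound[OF integrable_inverse_square_ball])
    (auto intro!: AE_I2 order_trans[OF plummer_defect_le])

lemma tendsto_plummer:
  assumes "z \<noteq> 0" "\<epsilon> \<longlonglongrightarrow> 0"
  shows "(\<lambda>j. plummer (\<epsilon> j) z) \<longlonglongrightarrow> inverse (norm z)"
proof -
  have "(\<lambda>j. inverse (sqrt (z \<bullet> z + (\<epsilon> j)\<^sup>2))) \<longlonglongrightarrow> inverse (sqrt (z \<bullet> z + 0\<^sup>2))"
    using assms by (intro tendsto_intros) auto
  then show ?thesis by (simp add: plummer_def norm_eq_sqrt_inner)
qed

text \<open>Dominated convergence with the locally integrable majorant \<open>1 / |z|^2\<close>.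
  This limit is the source of smallness when pairings at different regularisations are
  compared.\<close>

lemma tendsto_integral_plummer_defect:
  assumes "0 < R" "\<epsilon> \<longlonglongrightarrow> 0" "\<And>j. 0 < \<epsilon> j"
  shows "(\<lambda>j. LBINT z. plummer_defect R (\<epsilon> j) z) \<longlonglongrightarrow> 0"
proof -
  have "(\<lambda>j. LBINT z. plummer_defect R (\<epsilon> j) z) \<longlonglongrightarrow> (\<integral>z. 0 \<partial>(lborel :: (real^3) measure))"
  proof (rule integral_dominated_convergence)
    show "integrable lborel (\<lambda>z::real^3. indicator (cball 0 R) z * inverse (z \<bullet> z))"
      by (rule integrable_inverse_square_ball[OF assms(1)])
    show "AE z in lborel. (\<lambda>j. plummer_defect R (\<epsilon> j) z) \<longlonglongrightarrow> 0"
    proof (rule AE_I2)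
      fix z :: "real^3"
      show "(\<lambda>j. plummer_defect R (\<epsilon> j) z) \<longlonglongrightarrow> 0"
      proof (cases "z = 0")
        case False
        have "(\<lambda>j. plummer_defect R (\<epsilon> j) z) \<longlonglongrightarrow> indicator (cball 0 R) z * (inverse (z \<bullet> z) - norm z * inverse (norm z) ^ 3)"
          unfolding plummer_defect_def by (intro tendsto_intros tendsto_plummer False assms)
        moreover have "inverse (z \<bullet> z) - norm z * inverse (norm z) ^ 3 = 0"
          using False by (simp add: power3_eq_cube power2_eq_square flip: power2_norm_eq_inner)
        ultimately show ?thesis by simp
      qed (simp add: plummer_defect_def)
    qed
  qed (use assms in \<open>auto intro!: plummer_defect_le\<close>)
  then show ?thesis by simp
qed

text \<open>By monotonicity in the regularisation the absolute value opens with a definite sign, and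
  the \<delta> term is then replaced by its Newton majorant. This makes the comparison uniform in
  \<delta>.\<close>

lemma norm_mult_plummer_cubed_diff_le:
  assumes "0 < \<delta>" "\<delta> \<le> \<epsilon>" "norm z \<le> R"
  shows "norm z * \<bar>plummer \<delta> z ^ 3 - plummer \<epsilon> z ^ 3\<bar> \<le> plummer_defect R \<epsilon> z"
proof -
  have "plummer \<epsilon> z ^ 3 \<le> plummer \<delta> z ^ 3"
    using assms plummer_pos[of \<epsilon> z] by (intro power_mono plummer_antimono) auto
  then have "norm z * \<bar>plummer \<delta> z ^ 3 - plummer \<epsilon> z ^ 3\<bar> = norm z * plummer \<delta> z ^ 3 - norm z * plummer \<epsilon> z ^ 3"
    by (simp add: right_diff_distrib)
  also have "\<dots> \<le> plummer_defect R \<epsilon> z"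
    using norm_mult_plummer_cubed_le[OF assms(1), of z] assms(3) by (simp add: plummer_defect_def)
  finally show ?thesis .
qed

section \<open>The smoothed pairing\<close>

lemma sq_integrableD: "sq_integrable M f \<Longrightarrow> integrable M (\<lambda>x. (norm (f x))\<^sup>2)"
  by (simp add: sq_integrable_def)

lemma normsq_scaleR: "normsq M (\<lambda>x. c *\<^sub>R f x) = c\<^sup>2 * normsq M f"
  by (simp add: normsq_def power_mult_distrib)

lemma integrable_indicator_cball:
  "integrable lborel (\<lambda>x::'a::euclidean_space. indicator (cball 0 R) x :: real)"
  by (intro integrable_real_indicator emeasure_lborel_cball_finite) auto

section \<open>Approximation by bounded continuous fields\<close>

text \<open>Pointwise rather than almost everywhere, so that any two points at which such fields are
  nonzero are at distance at most \<open>2 * R\<close>.\<close>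

definition vanishes_off :: "real \<Rightarrow> ('a::euclidean_space \<Rightarrow> 'b::euclidean_space) \<Rightarrow> bool" where
  "vanishes_off R f \<longleftrightarrow> (\<forall>x. x \<notin> cball 0 R \<longrightarrow> f x = 0)"

lemma vanishes_offD: "vanishes_off R f \<Longrightarrow> x \<notin> cball 0 R \<Longrightarrow> f x = 0"
  by (simp add: vanishes_off_def)

text \<open>For \<open>k > 0\<close> this is the nearest-point projection onto the ball of radius
  \<open>k\<close>, written with \<open>max\<close> so that it is continuous by composition.\<close>

definition radial_cut :: "real \<Rightarrow> 'b::euclidean_space \<Rightarrow> 'b" where
  "radial_cut k w = (1 / max 1 (norm w / k)) *\<^sub>R w"

lemma norm_radial_cut_le: "0 < k \<Longrightarrow> norm (radial_cut k w) \<le> k"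
  by (auto simp: radial_cut_def max_def field_simps)

lemma radial_cut_eq: "0 < k \<Longrightarrow> norm w \<le> k \<Longrightarrow> radial_cut k w = w"
  by (simp add: radial_cut_def max_def)

lemma norm_diff_radial_cut_le: "norm (w - radial_cut k w) \<le> norm w"
proof -
  have "w - radial_cut k w = (1 - 1 / max 1 (norm w / k)) *\<^sub>R w"
    by (simp add: radial_cut_def scaleR_diff_left)
  moreover have "0 \<le> 1 - 1 / max 1 (norm w / k)" "1 - 1 / max 1 (norm w / k) \<le> 1"
    by (auto simp: field_simps)
  ultimately show ?thesis by (simp add: mult_left_le_one_le)
qed

lemma continuous_radial_cut: "continuous_on UNIV (radial_cut k)"
  unfolding radial_cut_def[abs_def] divide_inverse
  by (intro continuous_intros continuous_on_max) (auto simp: max_def)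

text \<open>First the values of \<open>u\<close> are truncated. Then \<open>u\<close> is an almost
  everywhere limit of continuous functions; truncating these as well and multiplying by a continuous
  cutoff gives them a common integrable majorant, so that dominated convergence applies.\<close>

lemma sq_integrable_approx_continuous:
  fixes u :: "'a::euclidean_space \<Rightarrow> 'b::euclidean_space"
  assumes u: "sq_integrable lborel u" and supp: "vanishes_off R u" and "0 < e"
  obtains g B where "continuous_on UNIV g" "\<And>x. norm (g x) \<le> B"
    "sq_integrable lborel g" "normsq lborel (\<lambda>x. u x - g x) < e"
proof -
  have [measurable]: "u \<in> borel_measurable borel" using u by (simp add: sq_integrable_def)
  have cut_borel [measurable]: "radial_cut k \<in> borel_measurable borel" for k :: real
    by (intro borel_measurable_continuous_onI continuous_radial_cut)
  \<comment> \<open>A quarter of \<open>e\<close> for each of the two errors, since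
    \<open>normsq_add_le\<close> doubles both.\<close>
  have cut: "\<exists>k::real>0. normsq lborel (\<lambda>x. u x - radial_cut k (u x)) < e / 4"
  proof -
    have "(\<lambda>n. normsq lborel (\<lambda>x. u x - radial_cut (real (Suc n)) (u x))) \<longlonglongrightarrow> (\<integral>x. 0 \<partial>(lborel :: 'a measure))"
      unfolding normsq_def
    proof (rule integral_dominated_convergence)
      show "integrable lborel (\<lambda>x. (norm (u x))\<^sup>2)" using u by (simp add: sq_integrable_def)
      show "AE x in lborel. (\<lambda>n. (norm (u x - radial_cut (real (Suc n)) (u x)))\<^sup>2) \<longlonglongrightarrow> 0"
      proof (rule AE_I2)
        fix x
        have "\<forall>\<^sub>F n in sequentially. (norm (u x - radial_cut (real (Suc n)) (u x)))\<^sup>2 = 0"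
          using eventually_ge_at_top[of "nat \<lceil>norm (u x)\<rceil>"]
        proof eventually_elim
          case (elim n)
          then have "norm (u x) \<le> real (Suc n)" by linarith
          then show ?case by (simp add: radial_cut_eq)
        qed
        then show "(\<lambda>n. (norm (u x - radial_cut (real (Suc n)) (u x)))\<^sup>2) \<longlonglongrightarrow> 0"
          by (rule tendsto_eventually)
      qed
      show "AE x in lborel. norm ((norm (u x - radial_cut (real (Suc n)) (u x)))\<^sup>2) \<le> (norm (u x))\<^sup>2" for n
        by (auto intro!: AE_I2 power_mono norm_diff_radial_cut_le)
    qed auto
    then have "(\<lambda>n. normsq lborel (\<lambda>x. u x - radial_cut (real (Suc n)) (u x))) \<longlonglongrightarrow> 0" by simp
    from order_tendstoD(2)[OF this, of "e/4"] \<open>0 < e\<close>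
    obtain n where "normsq lborel (\<lambda>x. u x - radial_cut (real (Suc n)) (u x)) < e/4"
      by (auto simp: eventually_sequentially)
    then show ?thesis by (intro exI[of _ "real (Suc n)"]) auto
  qed
  then obtain k :: real where k: "0 < k" "normsq lborel (\<lambda>x. u x - radial_cut k (u x)) < e / 4"
    by blast
  have "u measurable_on UNIV"
    by (subst measurable_on_iff_borel_measurable) (auto simp: lebesgue_on_UNIV_eq intro: measurable_completion)
  then obtain N g where N: "negligible N" and g: "\<And>n. continuous_on UNIV (g n)"
    and lim: "\<And>x. x \<notin> N \<Longrightarrow> (\<lambda>n. g n x) \<longlonglongrightarrow> u x"
    unfolding measurable_on_def by auto
  \<comment> \<open>Equal to 1 on the ball of radius \<open>R\<close>, where \<open>u\<close> lives,
    and 0 outside radius \<open>R + 1\<close>.\<close>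
  define \<theta> :: "'a \<Rightarrow> real" where "\<theta> x = max 0 (min 1 (R + 1 - norm x))" for x
  have \<theta>: "continuous_on UNIV \<theta>" "0 \<le> \<theta> x" "\<theta> x \<le> 1" for x
    unfolding \<theta>_def[abs_def] by (intro continuous_intros continuous_on_max continuous_on_min) auto
  have \<theta>_out: "\<theta> x = 0" if "x \<notin> cball 0 (R + 1)" for x
    using that by (auto simp: \<theta>_def)
  define h where "h n x = \<theta> x *\<^sub>R radial_cut k (g n x)" for n x
  have h_cont: "continuous_on UNIV (h n)" for n
    unfolding h_def
    by (intro continuous_on_scaleR \<theta> continuous_on_compose2[OF continuous_radial_cut g]) auto
  have [measurable]: "h n \<in> borel_measurable borel" for n
    by (intro borel_measurable_continuous_onI h_cont)
  have h_le: "norm (h n x) \<le> k * indicator (cball 0 (R + 1)) x" for n x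
  proof -
    have "norm (h n x) \<le> \<theta> x * k"
      using \<theta>(2)[of x] norm_radial_cut_le[OF k(1), of "g n x"] by (simp add: h_def mult_left_mono)
    also have "\<dots> \<le> k * indicator (cball 0 (R + 1)) x"
      using \<theta>(3)[of x] \<theta>_out[of x] k(1) by (cases "x \<in> cball 0 (R + 1)") auto
    finally show ?thesis .
  qed
  have ind: "integrable lborel (\<lambda>x::'a. C * indicator (cball 0 (R + 1)) x)" for C :: real
    by (intro integrable_mult_right integrable_indicator_cball)
  have h_sq: "sq_integrable lborel (h n)" for n
    unfolding sq_integrable_def
  proof
    show "integrable lborel (\<lambda>x. (norm (h n x))\<^sup>2)"
    proof (rule Bochner_Integration.integrable_bound[OF ind])
      show "AE x in lborel. norm ((norm (h n x))\<^sup>2) \<le> norm (k\<^sup>2 * indicator (cball 0 (R + 1)) x)"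
      proof (rule AE_I2)
        fix x
        have "(norm (h n x))\<^sup>2 \<le> (k * indicator (cball 0 (R + 1)) x)\<^sup>2"
          by (intro power_mono h_le) simp
        then show "norm ((norm (h n x))\<^sup>2) \<le> norm (k\<^sup>2 * indicator (cball 0 (R + 1)) x)"
          by (cases "x \<in> cball 0 (R + 1)") auto
      qed
    qed simp
  qed simp
  have cut_sq: "sq_integrable lborel (\<lambda>x. radial_cut k (u x))"
  proof -
    have "sq_integrable lborel (\<lambda>x. u x - radial_cut k (u x))"
      by (rule sq_integrable_bound[OF u, where C=1]) (auto simp: norm_diff_radial_cut_le)
    from sq_integrable_diff[OF u this] show ?thesis by simp
  qed
  \<comment> \<open>The exceptional set is Lebesgue null but perhaps not Borel; it is enclosed in a
    Borel null set because the convergence is needed almost everywhere for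
    \<open>lborel\<close>.\<close>
  obtain N' where N': "N \<subseteq> N'" "N' \<in> null_sets lborel"
    using N by (auto simp: negligible_iff_null_sets null_sets_completion_iff2)
  have "(\<lambda>n. normsq lborel (\<lambda>x. radial_cut k (u x) - h n x)) \<longlonglongrightarrow> (\<integral>x. 0 \<partial>(lborel :: 'a measure))"
    unfolding normsq_def
  proof (rule integral_dominated_convergence)
    show "integrable lborel (\<lambda>x::'a. (2 * k)\<^sup>2 * indicator (cball 0 (R + 1)) x)" by (rule ind)
    show "AE x in lborel. (\<lambda>n. (norm (radial_cut k (u x) - h n x))\<^sup>2) \<longlonglongrightarrow> 0"
      using AE_not_in[OF N'(2)]
    proof eventually_elim
      case (elim x)
      have "isCont (radial_cut k) (u x)"
        using continuous_radial_cut[of k] continuous_on_eq_continuous_at[OF open_UNIV, of "radial_cut k"] by blast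
      moreover have "(\<lambda>n. g n x) \<longlonglongrightarrow> u x"
        using lim[of x] N'(1) elim by blast
      ultimately have "(\<lambda>n. radial_cut k (g n x)) \<longlonglongrightarrow> radial_cut k (u x)"
        by (rule isCont_tendsto_compose)
      then have "(\<lambda>n. h n x) \<longlonglongrightarrow> \<theta> x *\<^sub>R radial_cut k (u x)"
        unfolding h_def by (intro tendsto_intros)
      moreover have "\<theta> x *\<^sub>R radial_cut k (u x) = radial_cut k (u x)"
        using vanishes_offD[OF supp, of x] by (cases "x \<in> cball 0 R") (auto simp: \<theta>_def radial_cut_def)
      ultimately have "(\<lambda>n. (norm (radial_cut k (u x) - h n x))\<^sup>2) \<longlonglongrightarrow> (norm (radial_cut k (u x) - radial_cut k (u x)))\<^sup>2"
        by (intro tendsto_intros) simp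
      then show ?case by simp
    qed
    show "AE x in lborel. norm ((norm (radial_cut k (u x) - h n x))\<^sup>2) \<le> (2 * k)\<^sup>2 * indicator (cball 0 (R + 1)) x" for n
    proof (rule AE_I2)
      fix x
      have "norm (radial_cut k (u x) - h n x) \<le> 2 * k * indicator (cball 0 (R + 1)) x"
        using norm_triangle_ineq4[of "radial_cut k (u x)" "h n x"] h_le[of n x] vanishes_offD[OF supp, of x]
          norm_radial_cut_le[OF k(1), of "u x"]
        by (cases "x \<in> cball 0 R"; cases "x \<in> cball 0 (R+1)") (auto simp: radial_cut_def)
      then have "(norm (radial_cut k (u x) - h n x))\<^sup>2 \<le> (2 * k * indicator (cball 0 (R + 1)) x)\<^sup>2"
        by (intro power_mono) auto
      then show "norm ((norm (radial_cut k (u x) - h n x))\<^sup>2) \<le> (2 * k)\<^sup>2 * indicator (cball 0 (R + 1)) x"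
        by (auto simp: indicator_def)
    qed
  qed auto
  then have "(\<lambda>n. normsq lborel (\<lambda>x. radial_cut k (u x) - h n x)) \<longlonglongrightarrow> 0" by simp
  from order_tendstoD(2)[OF this, of "e/4"] \<open>0 < e\<close>
  obtain n where n: "normsq lborel (\<lambda>x. radial_cut k (u x) - h n x) < e/4"
    by (auto simp: eventually_sequentially)
  have "normsq lborel (\<lambda>x. u x - h n x)
      = normsq lborel (\<lambda>x. (u x - radial_cut k (u x)) + (radial_cut k (u x) - h n x))"
    by simp
  also have "\<dots> \<le> 2 * normsq lborel (\<lambda>x. u x - radial_cut k (u x)) + 2 * normsq lborel (\<lambda>x. radial_cut k (u x) - h n x)"
    by (intro normsq_add_le sq_integrable_diff u cut_sq h_sq)
  also have "\<dots> < e" using k(2) n by linarith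
  finally have "normsq lborel (\<lambda>x. u x - h n x) < e" .
  moreover have "norm (h n x) \<le> k" for x
    using h_le[of n x] k(1) by (cases "x \<in> cball 0 (R + 1)") auto
  ultimately show ?thesis
    using that[OF h_cont _ h_sq] by blast
qed

text \<open>On the ball a norm is at most 1 plus its square. The explicit bound keeps the
  \<open>L\<^sup>1\<close> norms uniform along a sequence that is bounded in
  \<open>L\<^sup>2\<close>.\<close>

lemma sq_integrable_compact_support_integrable:
  fixes v :: "'a::euclidean_space \<Rightarrow> 'b::euclidean_space"
  assumes v: "sq_integrable lborel v" and supp: "vanishes_off R v"
  shows "integrable lborel v"
    and "(LBINT x. norm (v x)) \<le> measure lborel (cball (0::'a) R) + normsq lborel v"
proof -
  have le: "norm (v x) \<le> indicator (cball 0 R) x + (norm (v x))\<^sup>2" for x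
    using vanishes_offD[OF supp, of x] norm_mult_le_sum_squares[of "v x" "1::real"] by (cases "x \<in> cball 0 R") auto
  have int: "integrable lborel (\<lambda>x. indicator (cball 0 R) x + (norm (v x))\<^sup>2)"
    using v by (intro Bochner_Integration.integrable_add integrable_indicator_cball)
      (auto simp: sq_integrable_def)
  then show int_v: "integrable lborel v"
  proof (rule Bochner_Integration.integrable_bound)
    show "AE x in lborel. norm (v x) \<le> norm (indicator (cball 0 R) x + (norm (v x))\<^sup>2)"
      by (auto intro!: AE_I2 order_trans[OF le])
  qed (use v in \<open>simp add: sq_integrable_def\<close>)
  have "(LBINT x. norm (v x)) \<le> (LBINT x. indicator (cball 0 R) x + (norm (v x))\<^sup>2)"
    using int int_v le by (intro integral_mono) auto
  also have "\<dots> = measure lborel (cball (0::'a) R) + normsq lborel v"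
    using v unfolding normsq_def
    by (subst Bochner_Integration.integral_add) (auto simp: integrable_indicator_cball sq_integrable_def)
  finally show "(LBINT x. norm (v x)) \<le> measure lborel (cball (0::'a) R) + normsq lborel v" .
qed

text \<open>Minus the Laplacian of the Plummer potential: an unnormalised approximate identity.\<close>

definition plummer_density :: "real \<Rightarrow> real^3 \<Rightarrow> real" where
  "plummer_density \<delta> z = 3 * \<delta>\<^sup>2 * plummer \<delta> z ^ 5"

text \<open>The value is \<open>4 * pi\<close>, but the integral is kept unevaluated; its positivity
  is what permits dividing by it at the end.\<close>

definition plummer_mass :: real where
  "plummer_mass = (LBINT z. plummer_density 1 z)"

text \<open>The integral of \<open>(\<rho>\<^sub>\<delta> * u) \<bullet> v\<close>, stated over the
  product measure so that either order of integration can be chosen. The first component of a pair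
  is the argument of \<open>v\<close>, the second that of \<open>u\<close>.\<close>

definition pairing :: "real \<Rightarrow> (real^3 \<Rightarrow> real^3) \<Rightarrow> (real^3 \<Rightarrow> real^3) \<Rightarrow> real" where
  "pairing \<delta> u v = (\<integral>p. plummer_density \<delta> (fst p - snd p) * (u (snd p) \<bullet> v (fst p)) \<partial>(lborel \<Otimes>\<^sub>M lborel))"

lemma plummer_density_measurable [measurable]: "plummer_density \<delta> \<in> borel_measurable borel"
  unfolding plummer_density_def[abs_def] by measurable

lemma plummer_density_nonneg: "0 < \<delta> \<Longrightarrow> 0 \<le> plummer_density \<delta> z"
  using plummer_pos[of \<delta> z] by (simp add: plummer_density_def)

lemma plummer_density_scale: "0 < \<delta> \<Longrightarrow> \<delta> ^ 3 * plummer_density \<delta> (\<delta> *\<^sub>R z) = plummer_density 1 z"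
  by (simp add: plummer_density_def plummer_scale power_divide field_simps)

lemma integrable_plummer_density_1: "integrable lborel (plummer_density 1)"
  unfolding plummer_density_def[abs_def] using integrable_plummer_fifth by simp

lemma plummer_mass_pos: "0 < plummer_mass"
proof -
  have "(LBINT z. plummer_density 1 z) \<noteq> 0"
  proof
    assume "(LBINT z. plummer_density 1 z) = 0"
    then have "AE z in lborel. plummer_density 1 z = 0"
      using integrable_plummer_density_1 by (subst (asm) integral_nonneg_eq_0_iff_AE) (auto simp: plummer_density_nonneg)
    moreover have "plummer_density 1 z \<noteq> 0" for z
      using plummer_pos[of 1 z] by (simp add: plummer_density_def)
    ultimately have "AE z::real^3 in lborel. False" by simp
    then show False by (simp add: eventually_False ae_filter_eq_bot_iff)
  qed
  moreover have "0 \<le> (LBINT z. plummer_density 1 z)"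
    by (intro integral_nonneg_AE) (auto simp: plummer_density_nonneg)
  ultimately show ?thesis by (simp add: plummer_mass_def)
qed

text \<open>The substitution \<open>y = x - \<delta> *\<^sub>R z\<close> moves \<delta> from the
  kernel into the field, which leaves one fixed integrable majorant for all \<delta>.\<close>

lemma integral_plummer_density_scaled:
  fixes g :: "real^3 \<Rightarrow> 'b::euclidean_space"
  assumes "0 < \<delta>" and [measurable]: "g \<in> borel_measurable borel"
  shows "(LBINT y. plummer_density \<delta> (x - y) *\<^sub>R g y) = (LBINT z. plummer_density 1 z *\<^sub>R g (x - \<delta> *\<^sub>R z))"
proof -
  have "(LBINT y. plummer_density \<delta> (x - y) *\<^sub>R g y)
      = \<bar>- \<delta>\<bar> ^ DIM(real^3) *\<^sub>R (LBINT z. plummer_density \<delta> (x - (x + (- \<delta>) *\<^sub>R z)) *\<^sub>R g (x + (- \<delta>) *\<^sub>R z))"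
    using assms by (intro integral_lborel_affine) auto
  also have "\<dots> = (LBINT z. (\<delta> ^ 3 * plummer_density \<delta> (\<delta> *\<^sub>R z)) *\<^sub>R g (x - \<delta> *\<^sub>R z))"
    using assms(1) by (simp flip: integral_scaleR_right)
  finally show ?thesis by (simp add: plummer_density_scale[OF assms(1)])
qed

lemma integrable_plummer_density:
  assumes "0 < \<delta>"
  shows "integrable lborel (plummer_density \<delta>)" "(LBINT z. plummer_density \<delta> z) = plummer_mass"
proof -
  have eq: "plummer_density \<delta> z = inverse \<delta> ^ 3 * plummer_density 1 (inverse \<delta> *\<^sub>R z)" for z
    using plummer_density_scale[OF assms, of "inverse \<delta> *\<^sub>R z"] assms
    by (simp add: field_simps)
  have "integrable lborel (\<lambda>z. plummer_density 1 (0 + inverse \<delta> *\<^sub>R z))"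
    using assms by (intro integrable_lborel_affine integrable_plummer_density_1) auto
  then show "integrable lborel (plummer_density \<delta>)"
    unfolding eq[abs_def] by simp
  have minus: "plummer_density \<delta> (- y) = plummer_density \<delta> y" for y by (simp add: plummer_density_def plummer_minus)
  show "(LBINT z. plummer_density \<delta> z) = plummer_mass"
    using integral_plummer_density_scaled[OF assms, of "\<lambda>_. 1::real" 0] by (simp add: plummer_mass_def minus)
qed

lemma tendsto_plummer_density_convolution:
  fixes g :: "real^3 \<Rightarrow> real^3"
  assumes g: "continuous_on UNIV g" "\<And>x. norm (g x) \<le> B"
    and \<epsilon>: "\<epsilon> \<longlonglongrightarrow> 0" "\<And>j. 0 < \<epsilon> j"
  shows "(\<lambda>j. LBINT y. plummer_density (\<epsilon> j) (x - y) *\<^sub>R g y) \<longlonglongrightarrow> plummer_mass *\<^sub>R g x"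
proof -
  have [measurable]: "g \<in> borel_measurable borel"
    by (intro borel_measurable_continuous_onI g)
  have "(\<lambda>j. LBINT z. plummer_density 1 z *\<^sub>R g (x - \<epsilon> j *\<^sub>R z)) \<longlonglongrightarrow> (LBINT z. plummer_density 1 z *\<^sub>R g x)"
  proof (rule integral_dominated_convergence)
    show "integrable lborel (\<lambda>z. plummer_density 1 z * B)" using integrable_plummer_density_1 by simp
    show "AE z in lborel. (\<lambda>j. plummer_density 1 z *\<^sub>R g (x - \<epsilon> j *\<^sub>R z)) \<longlonglongrightarrow> plummer_density 1 z *\<^sub>R g x"
    proof (rule AE_I2)
      fix z
      have "(\<lambda>j. x - \<epsilon> j *\<^sub>R z) \<longlonglongrightarrow> x - 0 *\<^sub>R z" by (intro tendsto_intros \<epsilon>)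
      then have "(\<lambda>j. g (x - \<epsilon> j *\<^sub>R z)) \<longlonglongrightarrow> g x"
        using g(1) by (intro isCont_tendsto_compose[of x g]) (auto simp: continuous_on_eq_continuous_at)
      then show "(\<lambda>j. plummer_density 1 z *\<^sub>R g (x - \<epsilon> j *\<^sub>R z)) \<longlonglongrightarrow> plummer_density 1 z *\<^sub>R g x"
        by (intro tendsto_intros)
    qed
    show "AE z in lborel. norm (plummer_density 1 z *\<^sub>R g (x - \<epsilon> j *\<^sub>R z)) \<le> plummer_density 1 z * B" for j
      by (auto simp: plummer_density_nonneg intro!: mult_left_mono g)
  qed auto
  moreover have "(LBINT z. plummer_density 1 z *\<^sub>R g x) = plummer_mass *\<^sub>R g x"
    using integrable_plummer_density_1 by (simp add: plummer_mass_def)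
  ultimately show ?thesis
    by (simp add: integral_plummer_density_scaled[OF \<epsilon>(2)])
qed

lemma norm_plummer_density_convolution_le:
  fixes g :: "real^3 \<Rightarrow> real^3"
  assumes [measurable]: "g \<in> borel_measurable borel" and g: "\<And>x. norm (g x) \<le> B" and "0 < \<delta>"
  shows "norm (LBINT y. plummer_density \<delta> (x - y) *\<^sub>R g y) \<le> plummer_mass * B"
proof -
  have "norm (LBINT z. plummer_density 1 z *\<^sub>R g (x - \<delta> *\<^sub>R z)) \<le> (LBINT z. plummer_density 1 z * B)"
  proof (rule Bochner_Integration.integral_norm_bound_integral)
    show int: "integrable lborel (\<lambda>z. plummer_density 1 z * B)" using integrable_plummer_density_1 by simp
    show le: "norm (plummer_density 1 z *\<^sub>R g (x - \<delta> *\<^sub>R z)) \<le> plummer_density 1 z * B" for z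
      by (auto simp: plummer_density_nonneg intro!: mult_left_mono g)
    show "integrable lborel (\<lambda>z. plummer_density 1 z *\<^sub>R g (x - \<delta> *\<^sub>R z))"
      by (rule Bochner_Integration.integrable_bound[OF int])
        (auto intro!: AE_I2 order_trans[OF le] simp del: norm_scaleR)
  qed
  then show ?thesis
    using integrable_plummer_density_1 by (simp add: integral_plummer_density_scaled[OF \<open>0 < \<delta>\<close>] plummer_mass_def)
qed

text \<open>The mass of the kernel does not depend on \<delta>, so neither does the bound. This is
  what allows \<open>u\<close> to be replaced by a continuous field before \<delta> tends to
  0.\<close>

lemma pairing_bound:
  assumes u: "sq_integrable lborel u" and v: "sq_integrable lborel v" and "0 < \<delta>"
  shows "integrable (lborel \<Otimes>\<^sub>M lborel) (\<lambda>p. plummer_density \<delta> (fst p - snd p) * (u (snd p) \<bullet> v (fst p)))"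
    and "\<bar>pairing \<delta> u v\<bar> \<le> plummer_mass * (normsq lborel u + normsq lborel v)"
proof -
  have [measurable]: "u \<in> borel_measurable borel" "v \<in> borel_measurable borel"
    using u v by (auto simp: sq_integrable_def)
  have meas: "(\<lambda>p. plummer_density \<delta> (fst p - snd p) * (u (snd p) \<bullet> v (fst p))) \<in> borel_measurable (lborel \<Otimes>\<^sub>M lborel)"
    by measurable
  have le: "\<bar>plummer_density \<delta> (fst (x, y) - snd (x, y)) * (u (snd (x, y)) \<bullet> v (fst (x, y)))\<bar> \<le> plummer_density \<delta> (x - y) * (norm (u y) * norm (v x))"
    for x y
    using plummer_density_nonneg[OF \<open>0 < \<delta>\<close>, of "x - y"]
    by (auto simp: abs_mult intro!: mult_left_mono Cauchy_Schwarz_ineq2)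
  note * = kernel_integrable_bound[OF meas integrable_plummer_density(1)[OF \<open>0 < \<delta>\<close>] plummer_density_nonneg[OF \<open>0 < \<delta>\<close>] u v le]
  show "integrable (lborel \<Otimes>\<^sub>M lborel) (\<lambda>p. plummer_density \<delta> (fst p - snd p) * (u (snd p) \<bullet> v (fst p)))"
    by (rule *(1))
  show "\<bar>pairing \<delta> u v\<bar> \<le> plummer_mass * (normsq lborel u + normsq lborel v)"
    using *(2) by (simp add: pairing_def integrable_plummer_density(2)[OF \<open>0 < \<delta>\<close>])
qed

lemma pairing_diff_left:
  assumes "sq_integrable lborel u" "sq_integrable lborel g" "sq_integrable lborel v" "0 < \<delta>"
  shows "pairing \<delta> (\<lambda>x. u x - g x) v = pairing \<delta> u v - pairing \<delta> g v"
  unfolding pairing_def inner_diff_left right_diff_distrib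
  by (intro Bochner_Integration.integral_diff pairing_bound(1) assms)

lemma pairing_iterated:
  assumes "sq_integrable lborel u" "sq_integrable lborel v" "0 < \<delta>"
    and "\<And>x. integrable lborel (\<lambda>y. plummer_density \<delta> (x - y) *\<^sub>R u y)"
  shows "pairing \<delta> u v = (LBINT x. (LBINT y. plummer_density \<delta> (x - y) *\<^sub>R u y) \<bullet> v x)"
proof -
  have "pairing \<delta> u v = (LBINT x. LBINT y. plummer_density \<delta> (x - y) * (u y \<bullet> v x))"
    unfolding pairing_def
    by (subst lborel_pair.integral_fst'[symmetric]) (use pairing_bound(1)[OF assms(1-3)] in auto)
  moreover have "(LBINT y. plummer_density \<delta> (x - y) * (u y \<bullet> v x)) = (LBINT y. plummer_density \<delta> (x - y) *\<^sub>R u y) \<bullet> v x" for x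
    using assms(4)[of x] by (simp flip: integral_inner_left)
  ultimately show ?thesis by simp
qed

lemma tendsto_pairing_continuous:
  fixes g v :: "real^3 \<Rightarrow> real^3"
  assumes g: "continuous_on UNIV g" "\<And>x. norm (g x) \<le> B" "sq_integrable lborel g"
    and v: "sq_integrable lborel v" and supp: "vanishes_off R v"
    and \<epsilon>: "\<epsilon> \<longlonglongrightarrow> 0" "\<And>j. 0 < \<epsilon> j"
  shows "(\<lambda>j. pairing (\<epsilon> j) g v) \<longlonglongrightarrow> plummer_mass * L2_ip lborel g v"
proof -
  have [measurable]: "g \<in> borel_measurable borel" "v \<in> borel_measurable borel"
    using g v by (auto simp: sq_integrable_def)
  let ?w = "\<lambda>j x. LBINT y. plummer_density (\<epsilon> j) (x - y) *\<^sub>R g y"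
  have int: "integrable lborel (\<lambda>y. plummer_density (\<epsilon> j) (x - y) *\<^sub>R g y)" for x j
  proof (rule Bochner_Integration.integrable_bound)
    have "integrable lborel (\<lambda>y. plummer_density (\<epsilon> j) (x + (-1) *\<^sub>R y))"
      by (intro integrable_lborel_affine integrable_plummer_density \<epsilon>) auto
    then show "integrable lborel (\<lambda>y. plummer_density (\<epsilon> j) (x - y) * B)" by simp
    show "AE y in lborel. norm (plummer_density (\<epsilon> j) (x - y) *\<^sub>R g y) \<le> norm (plummer_density (\<epsilon> j) (x - y) * B)"
      using plummer_density_nonneg[OF \<epsilon>(2)[of j]]
      by (auto simp: abs_mult intro!: AE_I2 mult_left_mono order_trans[OF g(2) abs_ge_self])
  qed measurable
  have "(\<lambda>j. LBINT x. ?w j x \<bullet> v x) \<longlonglongrightarrow> (LBINT x. (plummer_mass *\<^sub>R g x) \<bullet> v x)"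
  proof (rule integral_dominated_convergence)
    show "integrable lborel (\<lambda>x. (plummer_mass * B) * norm (v x))"
      using sq_integrable_compact_support_integrable(1)[OF v supp] by auto
    show "AE x in lborel. (\<lambda>j. ?w j x \<bullet> v x) \<longlonglongrightarrow> (plummer_mass *\<^sub>R g x) \<bullet> v x"
      by (intro AE_I2 tendsto_inner tendsto_const tendsto_plummer_density_convolution[OF g(1,2) \<epsilon>])
    show "AE x in lborel. norm (?w j x \<bullet> v x) \<le> (plummer_mass * B) * norm (v x)" for j
    proof (rule AE_I2)
      fix x
      have "norm (?w j x \<bullet> v x) \<le> norm (?w j x) * norm (v x)"
        using Cauchy_Schwarz_ineq2 by simp
      also have "\<dots> \<le> (plummer_mass * B) * norm (v x)"
        by (intro mult_right_mono norm_plummer_density_convolution_le g \<epsilon>) auto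
      finally show "norm (?w j x \<bullet> v x) \<le> (plummer_mass * B) * norm (v x)" .
    qed
  qed measurable
  then show ?thesis
    by (simp add: pairing_iterated[OF g(3) v \<epsilon>(2) int] L2_ip_def)
qed

text \<open>Density argument from the continuous case. The available bound adds the two squared
  norms, so a small \<open>u - g\<close> alone does not make it small; multiplying one field by
  \<open>1/s\<close> and the other by \<open>s\<close> leaves both bilinear forms unchanged and
  balances the sum.\<close>

lemma tendsto_pairing:
  fixes u v :: "real^3 \<Rightarrow> real^3"
  assumes u: "sq_integrable lborel u" "vanishes_off R u"
    and v: "sq_integrable lborel v" "vanishes_off R v"
    and \<epsilon>: "\<epsilon> \<longlonglongrightarrow> 0" "\<And>j. 0 < \<epsilon> j"
  shows "(\<lambda>j. pairing (\<epsilon> j) u v) \<longlonglongrightarrow> plummer_mass * L2_ip lborel u v"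
proof (rule LIMSEQ_I)
  fix e :: real assume "0 < e"
  let ?C = "plummer_mass"
  \<comment> \<open>Makes the contribution of \<open>s *\<^sub>R v\<close> at most
    \<open>e / 8\<close>; the accuracy of \<open>g\<close> is then chosen so that
    \<open>(1/s) *\<^sub>R (u - g)\<close> contributes less than \<open>e / 8\<close> as well. The 1
    covers \<open>v\<close> with zero norm.\<close>
  define s where "s = sqrt (e / (8 * ?C * (normsq lborel v + 1)))"
  have pos: "0 < 8 * ?C * (normsq lborel v + 1)"
    using plummer_mass_pos normsq_nonneg[of lborel v] by (intro mult_pos_pos) linarith+
  then have s: "0 < s" "s\<^sup>2 = e / (8 * ?C * (normsq lborel v + 1))"
    using \<open>0 < e\<close> by (auto simp: s_def)
  have sv: "?C * (s\<^sup>2 * normsq lborel v) \<le> e / 8"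
  proof -
    have "?C * (s\<^sup>2 * normsq lborel v) \<le> ?C * (s\<^sup>2 * (normsq lborel v + 1))"
      using plummer_mass_pos by (intro mult_left_mono) auto
    also have "\<dots> = e / 8"
    proof -
      have "c * (e / (8 * c * t) * t) = e / 8" if "c \<noteq> 0" "t \<noteq> 0" for c t :: real
        using that by (simp add: field_simps)
      moreover have "normsq lborel v + 1 \<noteq> 0" using normsq_nonneg[of lborel v] by linarith
      ultimately show ?thesis using plummer_mass_pos unfolding s(2) by simp
    qed
    finally show ?thesis .
  qed
  have small: "0 < s\<^sup>2 * e / (8 * ?C)"
    using s(1) \<open>0 < e\<close> plummer_mass_pos by (intro divide_pos_pos mult_pos_pos) auto
  obtain g B where g: "continuous_on UNIV g" "\<And>x. norm (g x) \<le> B" "sq_integrable lborel g"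
    and ug: "normsq lborel (\<lambda>x. u x - g x) < s\<^sup>2 * e / (8 * ?C)"
    by (rule sq_integrable_approx_continuous[OF u small]) blast
  let ?w = "\<lambda>x. u x - g x"
  have w: "sq_integrable lborel ?w" by (intro sq_integrable_diff u g)
  have nw: "normsq lborel (\<lambda>x. (1/s) *\<^sub>R ?w x) = normsq lborel ?w / s\<^sup>2"
    unfolding normsq_scaleR by (simp add: power_divide)
  have nv: "normsq lborel (\<lambda>x. s *\<^sub>R v x) = s\<^sup>2 * normsq lborel v"
    by (rule normsq_scaleR)
  have total: "?C * (normsq lborel ?w / s\<^sup>2 + s\<^sup>2 * normsq lborel v) < e / 4"
  proof -
    have "?C * (normsq lborel ?w / s\<^sup>2) < e / 8"
      using ug s(1) plummer_mass_pos by (simp add: field_simps)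
    then show ?thesis using sv unfolding distrib_left by linarith
  qed
  have pair_w: "\<bar>pairing (\<epsilon> j) ?w v\<bar> < e / 4" for j
  proof -
    have "pairing (\<epsilon> j) ?w v = pairing (\<epsilon> j) (\<lambda>x. (1/s) *\<^sub>R ?w x) (\<lambda>x. s *\<^sub>R v x)"
      using s(1) by (simp add: pairing_def)
    also have "\<bar>\<dots>\<bar> \<le> ?C * (normsq lborel ?w / s\<^sup>2 + s\<^sup>2 * normsq lborel v)"
      unfolding nw[symmetric] nv[symmetric] by (intro pairing_bound sq_integrable_scaleR w v \<epsilon>)
    finally show ?thesis using total by (rule order.strict_trans1)
  qed
  have L2_ip_w: "?C * \<bar>L2_ip lborel ?w v\<bar> < e / 4"
  proof -
    have "L2_ip lborel ?w v = L2_ip lborel (\<lambda>x. (1/s) *\<^sub>R ?w x) (\<lambda>x. s *\<^sub>R v x)"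
      using s(1) by (simp add: L2_ip_def)
    also have "\<bar>\<dots>\<bar> \<le> (LBINT x. (norm ((1/s) *\<^sub>R ?w x))\<^sup>2 + (norm (s *\<^sub>R v x))\<^sup>2)"
      unfolding L2_ip_def
    proof (rule integral_abs_bound_integral)
      show "integrable lborel (\<lambda>x. ((1/s) *\<^sub>R ?w x) \<bullet> (s *\<^sub>R v x))"
        by (intro sq_integrable_inner sq_integrable_scaleR w v)
      show "integrable lborel (\<lambda>x. (norm ((1/s) *\<^sub>R ?w x))\<^sup>2 + (norm (s *\<^sub>R v x))\<^sup>2)"
        by (intro Bochner_Integration.integrable_add sq_integrableD sq_integrable_scaleR w v(1))
      show "\<bar>((1/s) *\<^sub>R ?w x) \<bullet> (s *\<^sub>R v x)\<bar> \<le> (norm ((1/s) *\<^sub>R ?w x))\<^sup>2 + (norm (s *\<^sub>R v x))\<^sup>2" for x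
        by (rule order_trans[OF Cauchy_Schwarz_ineq2 norm_mult_le_sum_squares])
    qed
    also have "\<dots> = normsq lborel (\<lambda>x. (1/s) *\<^sub>R ?w x) + normsq lborel (\<lambda>x. s *\<^sub>R v x)"
      unfolding normsq_def
      by (intro Bochner_Integration.integral_add sq_integrableD sq_integrable_scaleR w v(1))
    finally have "?C * \<bar>L2_ip lborel ?w v\<bar> \<le> ?C * (normsq lborel ?w / s\<^sup>2 + s\<^sup>2 * normsq lborel v)"
      using plummer_mass_pos by (intro mult_left_mono) (auto simp: nw nv)
    then show ?thesis using total by linarith
  qed
  have "(\<lambda>j. pairing (\<epsilon> j) g v) \<longlonglongrightarrow> ?C * L2_ip lborel g v"
    by (rule tendsto_pairing_continuous[OF g v \<epsilon>])
  then obtain J where J: "\<And>j. j \<ge> J \<Longrightarrow> norm (pairing (\<epsilon> j) g v - ?C * L2_ip lborel g v) < e / 4"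
    using LIMSEQ_D[of "\<lambda>j. pairing (\<epsilon> j) g v" _ "e / 4"] \<open>0 < e\<close> by auto
  show "\<exists>no. \<forall>j\<ge>no. norm (pairing (\<epsilon> j) u v - ?C * L2_ip lborel u v) < e"
  proof (intro exI allI impI)
    fix j assume "J \<le> j"
    have 1: "pairing (\<epsilon> j) ?w v = pairing (\<epsilon> j) u v - pairing (\<epsilon> j) g v"
      by (intro pairing_diff_left u g v \<epsilon>)
    have "L2_ip lborel ?w v = L2_ip lborel u v - L2_ip lborel g v"
      by (intro L2_ip_diff_left u g v)
    then have 2: "?C * L2_ip lborel ?w v = ?C * L2_ip lborel u v - ?C * L2_ip lborel g v"
      by (simp add: right_diff_distrib)
    have 3: "\<bar>?C * L2_ip lborel ?w v\<bar> < e / 4"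
      using L2_ip_w plummer_mass_pos by (simp add: abs_mult)
    show "norm (pairing (\<epsilon> j) u v - ?C * L2_ip lborel u v) < e"
      using J[OF \<open>J \<le> j\<close>] pair_w[of j] 3 unfolding 1 2 real_norm_def by linarith
  qed
qed

section \<open>Integration by parts in the smoothed pairing\<close>

lemma borel_measurable_cross3 [measurable]:
  assumes "f \<in> borel_measurable M" "g \<in> borel_measurable M"
  shows "(\<lambda>x. cross3 (f x) (g x)) \<in> borel_measurable M"
  using assms
  by (rule borel_measurable_continuous_Pair) (intro continuous_on_cross continuous_intros)

lemma norm_cross3_le: "norm (cross3 x y) \<le> norm x * norm y"
proof -
  have "(norm (cross3 x y))\<^sup>2 \<le> (norm x * norm y)\<^sup>2"
    using norm_cross_dot[of x y] zero_le_power2[of "x \<bullet> y"] by linarith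
  then show ?thesis by (rule power2_le_imp_le) simp
qed

text \<open>Brings the cube to the common factor \<open>plummer \<delta> z ^ 5\<close>, after which
  the Laplacian identity is a polynomial identity in coordinates.\<close>

lemma plummer_cubed_eq: "0 < \<delta> \<Longrightarrow> plummer \<delta> z ^ 3 = plummer \<delta> z ^ 5 * (z \<bullet> z + \<delta>\<^sup>2)"
proof -
  assume "0 < \<delta>"
  have "plummer \<delta> z ^ 5 * (z \<bullet> z + \<delta>\<^sup>2) = plummer \<delta> z ^ 3 * ((plummer \<delta> z)\<^sup>2 * (z \<bullet> z + \<delta>\<^sup>2))"
    by (simp add: eval_nat_numeral)
  then show ?thesis by (simp add: plummer_sq[OF \<open>0 < \<delta>\<close>])
qed

text \<open>The identity \<open>- \<Delta> = curl curl - grad div\<close> applied to the Plummer potential.\<close>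

lemma plummer_density_inner_eq:
  assumes "0 < \<delta>"
  shows "plummer_density \<delta> z * (u \<bullet> b)
    = - (\<Sum>k\<in>UNIV. axis k 1 \<bullet> cross3 u (plummer_hess \<delta> (cross3 b (axis k 1)) z)) + u \<bullet> plummer_hess \<delta> b z"
  unfolding plummer_density_def plummer_hess_def plummer_cubed_eq[OF assms]
  by (simp add: cross3_def inner_vec_def sum_3 vector_def axis_def power2_eq_square) (simp add: algebra_simps)

text \<open>Each summand contains the coordinate functional \<open>z \<bullet> a\<close> with a
  direction \<open>a\<close> free of \<open>z\<close>, the form in which the curl can be tested
  against the kernel.\<close>

lemma cross3_inner_sum:
  "cross3 z b \<bullet> c = (\<Sum>k\<in>UNIV. (z \<bullet> cross3 b (axis k 1)) * (axis k 1 \<bullet> c))"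
  by (simp add: cross3_def inner_vec_def sum_3 vector_def axis_def algebra_simps)

text \<open>Symmetry of second derivatives. It turns the direction of differentiation from
  \<open>v x\<close> into \<open>u y\<close>, which is constant while \<open>x\<close> is
  integrated.\<close>

lemma plummer_hess_symmetric: "u \<bullet> plummer_hess \<delta> b z = b \<bullet> plummer_hess \<delta> u z"
  by (simp add: plummer_hess_def inner_diff_right inner_commute)

text \<open>Two points of the ball of radius \<open>R\<close> differ by at most
  \<open>2 * R\<close>, so the constant \<open>C\<close> may be cut off there and becomes an
  integrable convolution kernel.\<close>

lemma compact_kernel_integrable:
  fixes F :: "(real^3) \<times> (real^3) \<Rightarrow> real"
    and f :: "real^3 \<Rightarrow> 'b::euclidean_space" and g :: "real^3 \<Rightarrow> 'c::euclidean_space"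
  assumes F: "F \<in> borel_measurable (lborel \<Otimes>\<^sub>M lborel)" and "0 \<le> C"
    and f: "sq_integrable lborel f" "vanishes_off R f"
    and g: "sq_integrable lborel g" "vanishes_off R g"
    and le: "\<And>x y. \<bar>F (x, y)\<bar> \<le> C * (norm (f y) * norm (g x))"
  shows "integrable (lborel \<Otimes>\<^sub>M lborel) F"
proof (rule kernel_integrable_bound(1)[OF F _ _ f(1) g(1)])
  show "integrable lborel (\<lambda>z::real^3. C * indicator (cball 0 (2 * R)) z)"
    by (intro integrable_mult_right integrable_indicator_cball)
  show "0 \<le> C * indicator (cball 0 (2 * R)) z" for z :: "real^3" using \<open>0 \<le> C\<close> by simp
  show "\<bar>F (x, y)\<bar> \<le> C * indicator (cball 0 (2 * R)) (x - y) * (norm (f y) * norm (g x))" for x y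
  proof (cases "f y = 0 \<or> g x = 0")
    case True
    then show ?thesis using le[of x y] by auto
  next
    case False
    then have "norm x \<le> R" "norm y \<le> R" using vanishes_offD[OF f(2), of y] vanishes_offD[OF g(2), of x] by (auto simp: not_le[symmetric])
    then have "norm (x - y) \<le> 2 * R" using norm_triangle_ineq4[of x y] by linarith
    then show ?thesis using le[of x y] by simp
  qed
qed

text \<open>Two integrations by parts in different variables. For fixed \<open>x\<close> the curl
  part of the Laplacian is moved in \<open>y\<close> onto \<open>c\<close>, the curl of
  \<open>u\<close>; for fixed \<open>y\<close> the gradient of the divergence is moved in
  \<open>x\<close> onto \<open>d\<close>, the divergence of \<open>v\<close>. Fubini connects the
  two orders, and one derivative of the potential is left in each kernel.\<close>

lemma pairing_identity:
  fixes u v c :: "real^3 \<Rightarrow> real^3" and d :: "real^3 \<Rightarrow> real"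
  assumes u: "sq_integrable lborel u" "vanishes_off R u"
    and v: "sq_integrable lborel v" "vanishes_off R v"
    and c: "sq_integrable lborel c" "vanishes_off R c"
    and d: "sq_integrable lborel d" "vanishes_off R d"
    and "0 < \<delta>"
    and curl: "\<And>x a. (LBINT y. (plummer \<delta> (x - y) ^ 3 * ((x - y) \<bullet> a)) *\<^sub>R c y)
        = - (LBINT y. cross3 (u y) (plummer_hess \<delta> a (x - y)))"
    and div: "\<And>y a. (LBINT x. plummer \<delta> (x - y) ^ 3 * ((x - y) \<bullet> a) * d x)
        = - (LBINT x. v x \<bullet> plummer_hess \<delta> a (x - y))"
  defines "F1 \<equiv> \<lambda>p. plummer \<delta> (fst p - snd p) ^ 3 * (cross3 (fst p - snd p) (v (fst p)) \<bullet> c (snd p))"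
    and "F2 \<equiv> \<lambda>p. plummer \<delta> (fst p - snd p) ^ 3 * ((fst p - snd p) \<bullet> u (snd p)) * d (fst p)"
  shows "integrable (lborel \<Otimes>\<^sub>M lborel) F1" "integrable (lborel \<Otimes>\<^sub>M lborel) F2"
    and "pairing \<delta> u v = (\<integral>p. F1 p \<partial>(lborel \<Otimes>\<^sub>M lborel)) - (\<integral>p. F2 p \<partial>(lborel \<Otimes>\<^sub>M lborel))"
proof -
  have [measurable]: "u \<in> borel_measurable borel" "v \<in> borel_measurable borel"
    "c \<in> borel_measurable borel" "d \<in> borel_measurable borel"
    using u v c d by (auto simp: sq_integrable_def)
  \<comment> \<open>The Hessian term still to be integrated by parts: it appears with
    \<open>y\<close> integrated first and is treated with \<open>x\<close> integrated first.\<close>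
  define F3 where "F3 = (\<lambda>p. u (snd p) \<bullet> plummer_hess \<delta> (v (fst p)) (fst p - snd p))"
  have r0: "0 \<le> plummer \<delta> z" for z :: "real^3" using plummer_pos[OF \<open>0 < \<delta>\<close>, of z] by simp
  have bd: "plummer \<delta> z ^ 3 * norm z \<le> inverse \<delta> ^ 2" for z :: "real^3"
    using norm_plummer_cubed_scaleR_le[OF \<open>0 < \<delta>\<close>, of z] r0[of z] by simp
  show F1: "integrable (lborel \<Otimes>\<^sub>M lborel) F1"
  proof (rule compact_kernel_integrable[OF _ _ c v])
    show "F1 \<in> borel_measurable (lborel \<Otimes>\<^sub>M lborel)" unfolding F1_def by measurable
    fix x y
    have "\<bar>F1 (x, y)\<bar> \<le> plummer \<delta> (x - y) ^ 3 * ((norm (x - y) * norm (v x)) * norm (c y))"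
      using r0 unfolding F1_def abs_mult
      by (auto intro!: mult_left_mono order_trans[OF Cauchy_Schwarz_ineq2] mult_right_mono norm_cross3_le)
    also have "\<dots> = (plummer \<delta> (x - y) ^ 3 * norm (x - y)) * (norm (c y) * norm (v x))"
      by simp
    also have "\<dots> \<le> inverse \<delta> ^ 2 * (norm (c y) * norm (v x))"
      by (intro mult_right_mono bd) auto
    finally show "\<bar>F1 (x, y)\<bar> \<le> inverse \<delta> ^ 2 * (norm (c y) * norm (v x))" .
  qed simp
  show F2: "integrable (lborel \<Otimes>\<^sub>M lborel) F2"
  proof (rule compact_kernel_integrable[OF _ _ u d])
    show "F2 \<in> borel_measurable (lborel \<Otimes>\<^sub>M lborel)" unfolding F2_def by measurable
    fix x y
    have "\<bar>F2 (x, y)\<bar> \<le> plummer \<delta> (x - y) ^ 3 * (norm (x - y) * norm (u y)) * norm (d x)"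
      using r0 unfolding F2_def abs_mult
      by (auto intro!: mult_left_mono Cauchy_Schwarz_ineq2 mult_right_mono)
    also have "\<dots> = (plummer \<delta> (x - y) ^ 3 * norm (x - y)) * (norm (u y) * norm (d x))"
      by simp
    also have "\<dots> \<le> inverse \<delta> ^ 2 * (norm (u y) * norm (d x))"
      by (intro mult_right_mono bd) auto
    finally show "\<bar>F2 (x, y)\<bar> \<le> inverse \<delta> ^ 2 * (norm (u y) * norm (d x))" .
  qed simp
  have F3: "integrable (lborel \<Otimes>\<^sub>M lborel) F3"
  proof (rule compact_kernel_integrable[OF _ _ u v])
    show "F3 \<in> borel_measurable (lborel \<Otimes>\<^sub>M lborel)" unfolding F3_def by measurable
    fix x y
    have "\<bar>F3 (x, y)\<bar> \<le> norm (u y) * (4 * inverse \<delta> ^ 3 * norm (v x))"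
      unfolding F3_def
      by (auto intro!: order_trans[OF Cauchy_Schwarz_ineq2] mult_left_mono norm_plummer_hess_le \<open>0 < \<delta>\<close>)
    then show "\<bar>F3 (x, y)\<bar> \<le> (4 * inverse \<delta> ^ 3) * (norm (u y) * norm (v x))"
      by (simp add: mult_ac)
  qed (use \<open>0 < \<delta>\<close> in simp)
  have u1: "integrable lborel u" and c1: "integrable lborel c"
    using sq_integrable_compact_support_integrable(1)[OF u] sq_integrable_compact_support_integrable(1)[OF c] by auto
  \<comment> \<open>With \<open>x\<close> fixed, the directions
    \<open>cross3 (v x) (axis k 1)\<close> are constants, so the curl hypothesis applies to each of
    them.\<close>
  have inner_y: "(LBINT y. plummer_density \<delta> (x - y) * (u y \<bullet> v x)) = (LBINT y. F1 (x, y)) + (LBINT y. F3 (x, y))" for x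
  proof -
    let ?a = "\<lambda>k. cross3 (v x) (axis k 1)"
    have int_c: "integrable lborel (\<lambda>y. (plummer \<delta> (x - y) ^ 3 * ((x - y) \<bullet> a)) *\<^sub>R c y)" for a
    proof (rule Bochner_Integration.integrable_bound)
      show "integrable lborel (\<lambda>y. (inverse \<delta> ^ 2 * norm a) *\<^sub>R c y)" using c1 by simp
      have "\<bar>plummer \<delta> (x - y) ^ 3 * ((x - y) \<bullet> a)\<bar> \<le> inverse \<delta> ^ 2 * norm a" for y
      proof -
        have "\<bar>plummer \<delta> (x - y) ^ 3 * ((x - y) \<bullet> a)\<bar> \<le> plummer \<delta> (x - y) ^ 3 * (norm (x - y) * norm a)"
          using r0 unfolding abs_mult by (auto intro!: mult_left_mono Cauchy_Schwarz_ineq2)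
        also have "\<dots> = (plummer \<delta> (x - y) ^ 3 * norm (x - y)) * norm a" by simp
        also have "\<dots> \<le> inverse \<delta> ^ 2 * norm a" by (intro mult_right_mono bd) auto
        finally show ?thesis .
      qed
      then show "AE y in lborel. norm ((plummer \<delta> (x - y) ^ 3 * ((x - y) \<bullet> a)) *\<^sub>R c y) \<le> norm ((inverse \<delta> ^ 2 * norm a) *\<^sub>R c y)"
        unfolding norm_scaleR by (intro AE_I2 mult_right_mono) (auto intro: order_trans[OF _ abs_ge_self])
    qed measurable
    have int_u: "integrable lborel (\<lambda>y. cross3 (u y) (plummer_hess \<delta> a (x - y)))" for a
    proof (rule Bochner_Integration.integrable_bound)
      show "integrable lborel (\<lambda>y. (4 * inverse \<delta> ^ 3 * norm a) *\<^sub>R u y)" using u1 by simp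
      have "norm (cross3 (u y) (plummer_hess \<delta> a (x - y))) \<le> norm ((4 * inverse \<delta> ^ 3 * norm a) *\<^sub>R u y)" for y
      proof -
        have "norm (cross3 (u y) (plummer_hess \<delta> a (x - y))) \<le> norm (u y) * (4 * inverse \<delta> ^ 3 * norm a)"
          by (intro order_trans[OF norm_cross3_le] mult_left_mono norm_plummer_hess_le \<open>0 < \<delta>\<close>) auto
        also have "\<dots> = norm ((4 * inverse \<delta> ^ 3 * norm a) *\<^sub>R u y)"
          using \<open>0 < \<delta>\<close> by (simp add: abs_mult)
        finally show ?thesis .
      qed
      then show "AE y in lborel. norm (cross3 (u y) (plummer_hess \<delta> a (x - y))) \<le> norm ((4 * inverse \<delta> ^ 3 * norm a) *\<^sub>R u y)"
        by simp
    qed measurable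
    have "(LBINT y. F1 (x, y))
        = (LBINT y. (\<Sum>k\<in>UNIV. axis k 1 \<bullet> ((plummer \<delta> (x - y) ^ 3 * ((x - y) \<bullet> ?a k)) *\<^sub>R c y)))"
      by (simp add: F1_def cross3_inner_sum sum_distrib_left mult_ac)
    also have "\<dots> = (\<Sum>k\<in>UNIV. LBINT y. axis k 1 \<bullet> ((plummer \<delta> (x - y) ^ 3 * ((x - y) \<bullet> ?a k)) *\<^sub>R c y))"
      by (intro Bochner_Integration.integral_sum integrable_inner_right int_c)
    also have "\<dots> = (\<Sum>k\<in>UNIV. axis k 1 \<bullet> (LBINT y. (plummer \<delta> (x - y) ^ 3 * ((x - y) \<bullet> ?a k)) *\<^sub>R c y))"
      by (intro sum.cong refl integral_inner_right int_c)
    also have "\<dots> = - (\<Sum>k\<in>UNIV. axis k 1 \<bullet> (LBINT y. cross3 (u y) (plummer_hess \<delta> (?a k) (x - y))))"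
      by (simp add: curl sum_negf)
    also have "\<dots> = - (\<Sum>k\<in>UNIV. LBINT y. axis k 1 \<bullet> cross3 (u y) (plummer_hess \<delta> (?a k) (x - y)))"
      by (intro arg_cong[where f=uminus] sum.cong refl integral_inner_right[symmetric] int_u)
    also have "\<dots> = (LBINT y. - (\<Sum>k\<in>UNIV. axis k 1 \<bullet> cross3 (u y) (plummer_hess \<delta> (?a k) (x - y))))"
      by (simp add: Bochner_Integration.integral_sum integrable_inner_right int_u)
    finally have eq: "(LBINT y. F1 (x, y)) = (LBINT y. - (\<Sum>k\<in>UNIV. axis k 1 \<bullet> cross3 (u y) (plummer_hess \<delta> (?a k) (x - y))))" .
    have int3: "integrable lborel (\<lambda>y. F3 (x, y))"
    proof (rule Bochner_Integration.integrable_bound)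
      show "integrable lborel (\<lambda>y. (4 * inverse \<delta> ^ 3 * norm (v x)) *\<^sub>R u y)" using u1 by simp
      have "\<bar>F3 (x, y)\<bar> \<le> norm ((4 * inverse \<delta> ^ 3 * norm (v x)) *\<^sub>R u y)" for y
      proof -
        have "\<bar>F3 (x, y)\<bar> \<le> norm (u y) * (4 * inverse \<delta> ^ 3 * norm (v x))"
          unfolding F3_def
          by (auto intro!: order_trans[OF Cauchy_Schwarz_ineq2] mult_left_mono norm_plummer_hess_le \<open>0 < \<delta>\<close>)
        also have "\<dots> = norm ((4 * inverse \<delta> ^ 3 * norm (v x)) *\<^sub>R u y)"
          using \<open>0 < \<delta>\<close> by (simp add: abs_mult)
        finally show ?thesis .
      qed
      then show "AE y in lborel. norm (F3 (x, y)) \<le> norm ((4 * inverse \<delta> ^ 3 * norm (v x)) *\<^sub>R u y)"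
        by simp
      show "(\<lambda>y. F3 (x, y)) \<in> borel_measurable lborel" unfolding F3_def by simp
    qed
    have "(LBINT y. plummer_density \<delta> (x - y) * (u y \<bullet> v x))
        = (LBINT y. - (\<Sum>k\<in>UNIV. axis k 1 \<bullet> cross3 (u y) (plummer_hess \<delta> (?a k) (x - y))) + F3 (x, y))"
      unfolding plummer_density_inner_eq[OF \<open>0 < \<delta>\<close>] F3_def by simp
    also have "\<dots> = (LBINT y. F1 (x, y)) + (LBINT y. F3 (x, y))"
      unfolding eq
      by (intro Bochner_Integration.integral_add int3 Bochner_Integration.integrable_minus
        Bochner_Integration.integrable_sum integrable_inner_right int_u)
    finally show ?thesis .
  qed
  \<comment> \<open>With \<open>y\<close> fixed, \<open>u y\<close> is a constant direction for the
    divergence hypothesis.\<close>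
  have inner_x: "(LBINT x. F3 (x, y)) = - (LBINT x. F2 (x, y))" for y
    using div[of y "u y"] by (simp add: F2_def F3_def plummer_hess_symmetric[of "u y"])
  have "pairing \<delta> u v = (LBINT x. LBINT y. plummer_density \<delta> (x - y) * (u y \<bullet> v x))"
    unfolding pairing_def
    by (subst lborel_pair.integral_fst'[symmetric]) (use pairing_bound(1)[OF u(1) v(1) \<open>0 < \<delta>\<close>] in auto)
  also have "\<dots> = (LBINT x. LBINT y. F1 (x, y)) + (LBINT x. LBINT y. F3 (x, y))"
    unfolding inner_y by (intro Bochner_Integration.integral_add lborel_pair.integrable_fst' F1 F3)
  also have "(LBINT x. LBINT y. F1 (x, y)) = (\<integral>p. F1 p \<partial>(lborel \<Otimes>\<^sub>M lborel))"
    by (rule lborel_pair.integral_fst'[OF F1])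
  also have "(LBINT x. LBINT y. F3 (x, y)) = (LBINT y. LBINT x. F3 (x, y))"
    using F3 by (intro lborel_pair.Fubini_integral[symmetric]) simp
  also have "\<dots> = - (LBINT y. LBINT x. F2 (x, y))"
    by (simp add: inner_x)
  also have "(LBINT y. LBINT x. F2 (x, y)) = (\<integral>p. F2 p \<partial>(lborel \<Otimes>\<^sub>M lborel))"
    using lborel_pair.integral_snd[of "\<lambda>x y. F2 (x, y)"] F2 by simp
  finally show "pairing \<delta> u v = (\<integral>p. F1 p \<partial>(lborel \<Otimes>\<^sub>M lborel)) - (\<integral>p. F2 p \<partial>(lborel \<Otimes>\<^sub>M lborel))"
    by simp
qed

text \<open>Subtracting the identities for the two regularisations leaves the difference of the
  gradient kernels, which \<open>plummer_defect\<close> majorises. The curl term costs the norms of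
  \<open>c\<close> and \<open>v\<close>, the divergence term those of \<open>u\<close> and
  \<open>d\<close>.\<close>

lemma pairing_difference_bound:
  fixes u v c :: "real^3 \<Rightarrow> real^3" and d :: "real^3 \<Rightarrow> real"
  assumes u: "sq_integrable lborel u" "vanishes_off R u"
    and v: "sq_integrable lborel v" "vanishes_off R v"
    and c: "sq_integrable lborel c" "vanishes_off R c"
    and d: "sq_integrable lborel d" "vanishes_off R d"
    and curl: "\<And>\<delta> x a. 0 < \<delta> \<Longrightarrow> (LBINT y. (plummer \<delta> (x - y) ^ 3 * ((x - y) \<bullet> a)) *\<^sub>R c y)
        = - (LBINT y. cross3 (u y) (plummer_hess \<delta> a (x - y)))"
    and div: "\<And>\<delta> y a. 0 < \<delta> \<Longrightarrow> (LBINT x. plummer \<delta> (x - y) ^ 3 * ((x - y) \<bullet> a) * d x)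
        = - (LBINT x. v x \<bullet> plummer_hess \<delta> a (x - y))"
    and "0 < R" "0 < \<delta>" "\<delta> \<le> \<epsilon>"
  shows "\<bar>pairing \<delta> u v - pairing \<epsilon> u v\<bar>
    \<le> (LBINT z. plummer_defect (2 * R) \<epsilon> z) * (normsq lborel u + normsq lborel v + normsq lborel c + normsq lborel d)"
proof -
  have "0 < \<epsilon>" using assms by linarith
  let ?P = "lborel \<Otimes>\<^sub>M lborel :: ((real^3) \<times> (real^3)) measure"
  let ?F1 = "\<lambda>\<delta> p. plummer \<delta> (fst p - snd p) ^ 3 * (cross3 (fst p - snd p) (v (fst p)) \<bullet> c (snd p))"
  let ?F2 = "\<lambda>\<delta> p. plummer \<delta> (fst p - snd p) ^ 3 * ((fst p - snd p) \<bullet> u (snd p)) * d (fst p)"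
  note id\<delta> = pairing_identity[OF u v c d \<open>0 < \<delta>\<close> curl[OF \<open>0 < \<delta>\<close>] div[OF \<open>0 < \<delta>\<close>]]
  note id\<epsilon> = pairing_identity[OF u v c d \<open>0 < \<epsilon>\<close> curl[OF \<open>0 < \<epsilon>\<close>] div[OF \<open>0 < \<epsilon>\<close>]]
  \<comment> \<open>Where both fields are nonzero, \<open>x - y\<close> lies within the cutoff
    radius \<open>2 * R\<close> of the defect; elsewhere both sides vanish.\<close>
  have diff: "\<bar>plummer \<delta> (x - y) ^ 3 - plummer \<epsilon> (x - y) ^ 3\<bar> * norm (x - y) * (norm (f y) * norm (g x))
      \<le> plummer_defect (2 * R) \<epsilon> (x - y) * (norm (f y) * norm (g x))"
    if f: "vanishes_off R f" and g: "vanishes_off R g"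
    for f :: "real^3 \<Rightarrow> 'b::euclidean_space" and g :: "real^3 \<Rightarrow> 'c::euclidean_space" and x y
  proof (cases "f y = 0 \<or> g x = 0")
    case False
    then have "norm x \<le> R" "norm y \<le> R" using vanishes_offD[OF f, of y] vanishes_offD[OF g, of x] by (auto simp: not_le[symmetric])
    then have "norm (x - y) \<le> 2 * R" using norm_triangle_ineq4[of x y] by linarith
    then show ?thesis
      using norm_mult_plummer_cubed_diff_le[OF \<open>0 < \<delta>\<close> \<open>\<delta> \<le> \<epsilon>\<close>] by (intro mult_right_mono) (auto simp: mult.commute)
  qed auto
  have "\<bar>\<integral>p. ?F1 \<delta> p - ?F1 \<epsilon> p \<partial>?P\<bar> \<le> (LBINT z. plummer_defect (2 * R) \<epsilon> z) * (normsq lborel c + normsq lborel v)"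
  proof (rule kernel_integrable_bound(2)[OF _ _ _ c(1) v(1)])
    show "(\<lambda>p. ?F1 \<delta> p - ?F1 \<epsilon> p) \<in> borel_measurable ?P"
      using id\<delta>(1) id\<epsilon>(1) by (intro borel_measurable_diff) auto
    show "integrable lborel (plummer_defect (2 * R) \<epsilon>)" using \<open>0 < R\<close> \<open>0 < \<epsilon>\<close> by (intro integrable_plummer_defect) auto
    show "0 \<le> plummer_defect (2 * R) \<epsilon> z" for z by (rule plummer_defect_nonneg[OF \<open>0 < \<epsilon>\<close>])
    fix x y
    have "\<bar>?F1 \<delta> (x, y) - ?F1 \<epsilon> (x, y)\<bar> = \<bar>plummer \<delta> (x - y) ^ 3 - plummer \<epsilon> (x - y) ^ 3\<bar> * \<bar>cross3 (x - y) (v x) \<bullet> c y\<bar>"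
      by (simp flip: abs_mult left_diff_distrib)
    also have "\<dots> \<le> \<bar>plummer \<delta> (x - y) ^ 3 - plummer \<epsilon> (x - y) ^ 3\<bar> * ((norm (x - y) * norm (v x)) * norm (c y))"
      by (auto intro!: mult_left_mono order_trans[OF Cauchy_Schwarz_ineq2] mult_right_mono norm_cross3_le)
    also have "\<dots> \<le> plummer_defect (2 * R) \<epsilon> (x - y) * (norm (c y) * norm (v x))"
      using diff[OF c(2) v(2), of x y] by (simp add: mult_ac)
    finally show "\<bar>?F1 \<delta> (x, y) - ?F1 \<epsilon> (x, y)\<bar> \<le> plummer_defect (2 * R) \<epsilon> (x - y) * (norm (c y) * norm (v x))" .
  qed
  moreover have "\<bar>\<integral>p. ?F2 \<delta> p - ?F2 \<epsilon> p \<partial>?P\<bar> \<le> (LBINT z. plummer_defect (2 * R) \<epsilon> z) * (normsq lborel u + normsq lborel d)"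
  proof (rule kernel_integrable_bound(2)[OF _ _ _ u(1) d(1)])
    show "(\<lambda>p. ?F2 \<delta> p - ?F2 \<epsilon> p) \<in> borel_measurable ?P"
      using id\<delta>(2) id\<epsilon>(2) by (intro borel_measurable_diff) auto
    show "integrable lborel (plummer_defect (2 * R) \<epsilon>)" using \<open>0 < R\<close> \<open>0 < \<epsilon>\<close> by (intro integrable_plummer_defect) auto
    show "0 \<le> plummer_defect (2 * R) \<epsilon> z" for z by (rule plummer_defect_nonneg[OF \<open>0 < \<epsilon>\<close>])
    fix x y
    have "\<bar>?F2 \<delta> (x, y) - ?F2 \<epsilon> (x, y)\<bar> = \<bar>plummer \<delta> (x - y) ^ 3 - plummer \<epsilon> (x - y) ^ 3\<bar> * (\<bar>(x - y) \<bullet> u y\<bar> * \<bar>d x\<bar>)"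
      by (simp flip: abs_mult left_diff_distrib add: mult.assoc)
    also have "\<dots> \<le> \<bar>plummer \<delta> (x - y) ^ 3 - plummer \<epsilon> (x - y) ^ 3\<bar> * ((norm (x - y) * norm (u y)) * norm (d x))"
      by (auto intro!: mult_left_mono Cauchy_Schwarz_ineq2 mult_right_mono)
    also have "\<dots> \<le> plummer_defect (2 * R) \<epsilon> (x - y) * (norm (u y) * norm (d x))"
      using diff[OF u(2) d(2), of x y] by (simp add: mult_ac)
    finally show "\<bar>?F2 \<delta> (x, y) - ?F2 \<epsilon> (x, y)\<bar> \<le> plummer_defect (2 * R) \<epsilon> (x - y) * (norm (u y) * norm (d x))" .
  qed
  moreover have "pairing \<delta> u v - pairing \<epsilon> u v = (\<integral>p. ?F1 \<delta> p - ?F1 \<epsilon> p \<partial>?P) - (\<integral>p. ?F2 \<delta> p - ?F2 \<epsilon> p \<partial>?P)"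
    using id\<delta> id\<epsilon> by simp
  ultimately show ?thesis
    unfolding distrib_left by linarith
qed

text \<open>Since the kernel of \<open>pairing \<epsilon>\<close> is bounded, \<open>pairing \<epsilon>\<close> is sequentially continuous for
  weak convergence in the first argument.\<close>

lemma pairing_tendsto_zero:
  fixes u v :: "nat \<Rightarrow> real^3 \<Rightarrow> real^3"
  assumes u: "\<And>n. sq_integrable lborel (u n)" "\<And>n. vanishes_off R (u n)"
    and v: "\<And>n. sq_integrable lborel (v n)" "\<And>n. vanishes_off R (v n)"
    and M: "\<And>n. normsq lborel (u n) \<le> M" "\<And>n. normsq lborel (v n) \<le> M"
    and "0 < \<epsilon>"
    and weak: "\<And>x. (\<lambda>n. LBINT y. plummer \<epsilon> (x - y) ^ 5 *\<^sub>R u n y) \<longlonglongrightarrow> 0"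
  shows "(\<lambda>n. pairing \<epsilon> (u n) (v n)) \<longlonglongrightarrow> 0"
proof -
  have [measurable]: "u n \<in> borel_measurable borel" "v n \<in> borel_measurable borel" for n
    using u v by (auto simp: sq_integrable_def)
  \<comment> \<open>The smoothed field is restricted to the ball where \<open>v n\<close> lives.
    This does not change the pairing, and it gives the sequence an integrable majorant independent
    of \<open>n\<close>.\<close>
  define w where "w n x = indicator (cball 0 R) x *\<^sub>R (LBINT y. plummer_density \<epsilon> (x - y) *\<^sub>R u n y)" for n x
  define A where "A = 3 * \<epsilon>\<^sup>2 * inverse \<epsilon> ^ 5"
  define B where "B = A * (measure lborel (cball (0::real^3) R) + M)"
  have plummer_density_le: "plummer_density \<epsilon> z \<le> A" for z
    unfolding plummer_density_def A_def using plummer_pos[OF \<open>0 < \<epsilon>\<close>, of z]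
    by (intro mult_left_mono power_mono plummer_le \<open>0 < \<epsilon>\<close>) auto
  have "0 \<le> A" using \<open>0 < \<epsilon>\<close> by (simp add: A_def)
  have u1: "integrable lborel (u n)" "(LBINT x. norm (u n x)) \<le> measure lborel (cball (0::real^3) R) + normsq lborel (u n)" for n
    using sq_integrable_compact_support_integrable[OF u] by blast+
  have norm_le: "norm (plummer_density \<epsilon> (x - y) *\<^sub>R u n y) \<le> A * norm (u n y)" for x y n
    using plummer_density_nonneg[OF \<open>0 < \<epsilon>\<close>, of "x - y"] by (auto intro!: mult_right_mono plummer_density_le)
  have int: "integrable lborel (\<lambda>y. plummer_density \<epsilon> (x - y) *\<^sub>R u n y)" for x n
  proof (rule Bochner_Integration.integrable_bound)
    show "integrable lborel (\<lambda>y. A * norm (u n y))" using u1 by simp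
    show "AE y in lborel. norm (plummer_density \<epsilon> (x - y) *\<^sub>R u n y) \<le> norm (A * norm (u n y))"
      by (intro AE_I2 order_trans[OF norm_le]) simp
  qed measurable
  have w_le: "norm (w n x) \<le> B * indicator (cball 0 R) x" for n x
  proof -
    have "norm (LBINT y. plummer_density \<epsilon> (x - y) *\<^sub>R u n y) \<le> (LBINT y. A * norm (u n y))"
      using u1 by (intro Bochner_Integration.integral_norm_bound_integral int norm_le) auto
    also have "\<dots> \<le> B"
      using u1(2)[of n] M(1)[of n] \<open>0 \<le> A\<close> by (auto simp: B_def intro!: mult_left_mono)
    finally show ?thesis by (cases "x \<in> cball 0 R") (auto simp: w_def)
  qed
  have "0 \<le> B"
    using \<open>0 \<le> A\<close> order_trans[OF normsq_nonneg M(1)] by (auto simp: B_def intro!: mult_nonneg_nonneg add_nonneg_nonneg)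
  have [measurable]: "w n \<in> borel_measurable borel" for n
  proof -
    have "(\<lambda>x. LBINT y. plummer_density \<epsilon> (x - y) *\<^sub>R u n y) \<in> borel_measurable lborel"
      by measurable
    then show ?thesis unfolding w_def[abs_def] by measurable
  qed
  have w_sq_le: "(norm (w n x))\<^sup>2 \<le> B\<^sup>2 * indicator (cball 0 R) x" for n x
    using power_mono[OF w_le[of n x], of 2] by (cases "x \<in> cball 0 R") auto
  have ind: "integrable lborel (\<lambda>x::real^3. B\<^sup>2 * indicator (cball 0 R) x)"
    by (intro integrable_mult_right integrable_indicator_cball)
  have w_sq: "sq_integrable lborel (w n)" for n
    unfolding sq_integrable_def
  proof
    show "integrable lborel (\<lambda>x. (norm (w n x))\<^sup>2)"
      by (rule Bochner_Integration.integrable_bound[OF ind])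
        (auto intro!: AE_I2 order_trans[OF w_sq_le])
  qed simp
  have "(\<lambda>n. normsq lborel (w n)) \<longlonglongrightarrow> (\<integral>x. 0 \<partial>(lborel :: (real^3) measure))"
    unfolding normsq_def
  proof (rule integral_dominated_convergence[OF _ _ ind])
    show "AE x in lborel. (\<lambda>n. (norm (w n x))\<^sup>2) \<longlonglongrightarrow> 0"
    proof (rule AE_I2)
      fix x :: "real^3"
      have "(\<lambda>n. (norm (indicator (cball 0 R) x *\<^sub>R (3 * \<epsilon>\<^sup>2) *\<^sub>R (LBINT y. plummer \<epsilon> (x - y) ^ 5 *\<^sub>R u n y)))\<^sup>2)
          \<longlonglongrightarrow> (norm (indicator (cball 0 R) x *\<^sub>R (3 * \<epsilon>\<^sup>2) *\<^sub>R (0 :: real^3)))\<^sup>2"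
        by (intro tendsto_intros weak)
      then show "(\<lambda>n. (norm (w n x))\<^sup>2) \<longlonglongrightarrow> 0"
        by (simp add: w_def plummer_density_def flip: integral_scaleR_right)
    qed
    show "AE x in lborel. norm ((norm (w n x))\<^sup>2) \<le> B\<^sup>2 * indicator (cball 0 R) x" for n
      using w_sq_le by simp
  qed auto
  then have nw: "(\<lambda>n. normsq lborel (w n)) \<longlonglongrightarrow> 0" by simp
  have eq: "pairing \<epsilon> (u n) (v n) = L2_ip lborel (w n) (v n)" for n
  proof -
    have "pairing \<epsilon> (u n) (v n) = (LBINT x. (LBINT y. plummer_density \<epsilon> (x - y) *\<^sub>R u n y) \<bullet> v n x)"
      by (rule pairing_iterated[OF u(1) v(1) \<open>0 < \<epsilon>\<close> int])
    also have "\<dots> = L2_ip lborel (w n) (v n)"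
      unfolding L2_ip_def w_def
    proof (rule Bochner_Integration.integral_cong[OF refl])
      show "(LBINT y. plummer_density \<epsilon> (x - y) *\<^sub>R u n y) \<bullet> v n x
          = (indicator (cball 0 R) x *\<^sub>R (LBINT y. plummer_density \<epsilon> (x - y) *\<^sub>R u n y)) \<bullet> v n x" for x
        using vanishes_offD[OF v(2), of x n] by (cases "x \<in> cball 0 R") auto
    qed
    finally show ?thesis .
  qed
  show ?thesis
  proof (rule Lim_null_comparison)
    show "\<forall>\<^sub>F n in sequentially. norm (pairing \<epsilon> (u n) (v n)) \<le> sqrt (normsq lborel (w n) * M)"
    proof (rule always_eventually, rule allI)
      fix n
      have "(L2_ip lborel (w n) (v n))\<^sup>2 \<le> normsq lborel (w n) * normsq lborel (v n)"
        by (intro L2_ip_Cauchy_Schwarz w_sq v)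
      also have "\<dots> \<le> normsq lborel (w n) * M" by (intro mult_left_mono M) simp
      finally show "norm (pairing \<epsilon> (u n) (v n)) \<le> sqrt (normsq lborel (w n) * M)"
        unfolding eq by (intro real_le_rsqrt) simp
    qed
    have "(\<lambda>n. sqrt (normsq lborel (w n) * M)) \<longlonglongrightarrow> sqrt (0 * M)"
      by (intro tendsto_intros nw)
    then show "(\<lambda>n. sqrt (normsq lborel (w n) * M)) \<longlonglongrightarrow> 0" by simp
  qed
qed

text \<open>The order of the limits matters. For fixed \<open>n\<close> the inner regularisation is
  removed, which gives an error bound in \<epsilon> that is uniform in \<open>n\<close>; then
  \<epsilon> is fixed so that this error is small, and only then does \<open>n\<close> tend to
  infinity.\<close>

theorem div_curl_compact_support:
  fixes u v c :: "nat \<Rightarrow> real^3 \<Rightarrow> real^3" and d :: "nat \<Rightarrow> real^3 \<Rightarrow> real"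
  assumes u: "\<And>n. sq_integrable lborel (u n)" "\<And>n. vanishes_off R (u n)"
    and v: "\<And>n. sq_integrable lborel (v n)" "\<And>n. vanishes_off R (v n)"
    and c: "\<And>n. sq_integrable lborel (c n)" "\<And>n. vanishes_off R (c n)"
    and d: "\<And>n. sq_integrable lborel (d n)" "\<And>n. vanishes_off R (d n)"
    and M: "\<And>n. normsq lborel (u n) \<le> M" "\<And>n. normsq lborel (v n) \<le> M"
      "\<And>n. normsq lborel (c n) \<le> M" "\<And>n. normsq lborel (d n) \<le> M"
    and curl: "\<And>n \<delta> x a. 0 < \<delta> \<Longrightarrow> (LBINT y. (plummer \<delta> (x - y) ^ 3 * ((x - y) \<bullet> a)) *\<^sub>R c n y)
        = - (LBINT y. cross3 (u n y) (plummer_hess \<delta> a (x - y)))"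
    and div: "\<And>n \<delta> y a. 0 < \<delta> \<Longrightarrow> (LBINT x. plummer \<delta> (x - y) ^ 3 * ((x - y) \<bullet> a) * d n x)
        = - (LBINT x. v n x \<bullet> plummer_hess \<delta> a (x - y))"
    and weak: "\<And>\<epsilon> x. 0 < \<epsilon> \<Longrightarrow> (\<lambda>n. LBINT y. plummer \<epsilon> (x - y) ^ 5 *\<^sub>R u n y) \<longlonglongrightarrow> 0"
    and "0 < R"
  shows "(\<lambda>n. L2_ip lborel (u n) (v n)) \<longlonglongrightarrow> 0"
proof -
  have "0 \<le> M" by (rule order_trans[OF normsq_nonneg M(1)])
  let ?k = "\<lambda>\<epsilon>. LBINT z. plummer_defect (2 * R) \<epsilon> z"
  have k_nonneg: "0 \<le> ?k \<epsilon>" if "0 < \<epsilon>" for \<epsilon>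
    using plummer_defect_nonneg[OF that] by (intro integral_nonneg_AE) auto
  have close: "\<bar>plummer_mass * L2_ip lborel (u n) (v n) - pairing \<epsilon> (u n) (v n)\<bar> \<le> ?k \<epsilon> * (4 * M)" if "0 < \<epsilon>" for n \<epsilon>
  proof -
    \<comment> \<open>A positive null sequence that stays below \<epsilon>, as the comparison of
      pairings requires.\<close>
    define \<delta> where "\<delta> j = \<epsilon> / real (Suc j)" for j
    have \<delta>: "0 < \<delta> j" "\<delta> j \<le> \<epsilon>" for j
      using that by (auto simp: \<delta>_def divide_le_eq mult_le_cancel_left1)
    have "\<delta> \<longlonglongrightarrow> 0"
      unfolding \<delta>_def[abs_def] using tendsto_mult_right_zero[OF LIMSEQ_inverse_real_of_nat, of \<epsilon>]
      by (simp add: divide_inverse)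
    then have "(\<lambda>j. pairing (\<delta> j) (u n) (v n)) \<longlonglongrightarrow> plummer_mass * L2_ip lborel (u n) (v n)"
      by (intro tendsto_pairing[where R=R] u v \<delta>)
    then have "(\<lambda>j. \<bar>pairing (\<delta> j) (u n) (v n) - pairing \<epsilon> (u n) (v n)\<bar>)
        \<longlonglongrightarrow> \<bar>plummer_mass * L2_ip lborel (u n) (v n) - pairing \<epsilon> (u n) (v n)\<bar>"
      by (intro tendsto_intros)
    moreover have "\<bar>pairing (\<delta> j) (u n) (v n) - pairing \<epsilon> (u n) (v n)\<bar> \<le> ?k \<epsilon> * (4 * M)" for j
    proof -
      have "\<bar>pairing (\<delta> j) (u n) (v n) - pairing \<epsilon> (u n) (v n)\<bar>
          \<le> ?k \<epsilon> * (normsq lborel (u n) + normsq lborel (v n) + normsq lborel (c n) + normsq lborel (d n))"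
        by (rule pairing_difference_bound[OF u v c d curl div \<open>0 < R\<close> \<delta>])
      also have "\<dots> \<le> ?k \<epsilon> * (4 * M)"
        using M[of n] by (intro mult_left_mono k_nonneg that) linarith
      finally show ?thesis .
    qed
    ultimately show ?thesis
      by (intro LIMSEQ_le_const2) auto
  qed
  show ?thesis
  proof (rule LIMSEQ_I)
    fix e :: real assume "0 < e"
    have Ce: "0 < plummer_mass * e / 2" using plummer_mass_pos \<open>0 < e\<close> by simp
    have "(\<lambda>j. ?k (inverse (real (Suc j))) * (4 * M)) \<longlonglongrightarrow> 0 * (4 * M)"
      using \<open>0 < R\<close> by (intro tendsto_intros tendsto_integral_plummer_defect LIMSEQ_inverse_real_of_nat) auto
    then have "(\<lambda>j. ?k (inverse (real (Suc j))) * (4 * M)) \<longlonglongrightarrow> 0" by simp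
    from order_tendstoD(2)[OF this Ce] obtain j where j: "?k (inverse (real (Suc j))) * (4 * M) < plummer_mass * e / 2"
      by (auto simp: eventually_sequentially)
    \<comment> \<open>The comparison error is now below half of \<open>plummer_mass * e\<close>; the
      other half is left for the pairing at this fixed \<epsilon>.\<close>
    define \<epsilon> where "\<epsilon> = inverse (real (Suc j))"
    have "0 < \<epsilon>" by (simp add: \<epsilon>_def)
    have "(\<lambda>n. pairing \<epsilon> (u n) (v n)) \<longlonglongrightarrow> 0"
      by (rule pairing_tendsto_zero[OF u v M(1,2) \<open>0 < \<epsilon>\<close> weak[OF \<open>0 < \<epsilon>\<close>]])
    from LIMSEQ_D[OF this Ce] obtain N where N: "\<And>n. n \<ge> N \<Longrightarrow> \<bar>pairing \<epsilon> (u n) (v n)\<bar> < plummer_mass * e / 2"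
      by auto
    have "norm (L2_ip lborel (u n) (v n) - 0) < e" if "n \<ge> N" for n
    proof -
      have "\<bar>plummer_mass * L2_ip lborel (u n) (v n)\<bar> < plummer_mass * e"
        using N[OF that] close[OF \<open>0 < \<epsilon>\<close>, of n] j unfolding \<epsilon>_def by linarith
      then show ?thesis using plummer_mass_pos by (simp add: abs_mult)
    qed
    then show "\<exists>N. \<forall>n\<ge>N. norm (L2_ip lborel (u n) (v n) - 0) < e" by blast
  qed
qed

section \<open>From an open set to the whole space\<close>

lemma normsq_bound:
  assumes f: "sq_integrable M f" and g: "g \<in> borel_measurable M"
    and le: "\<And>x. x \<in> space M \<Longrightarrow> norm (g x) \<le> C * norm (f x)"
  shows "normsq M g \<le> C\<^sup>2 * normsq M f"
proof -
  have "normsq M g \<le> (\<integral>x. C\<^sup>2 * (norm (f x))\<^sup>2 \<partial>M)"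
    unfolding normsq_def
  proof (rule integral_mono)
    show "integrable M (\<lambda>x. (norm (g x))\<^sup>2)"
      by (rule sq_integrableD[OF sq_integrable_bound[OF f g le]])
    show "integrable M (\<lambda>x. C\<^sup>2 * (norm (f x))\<^sup>2)"
      using sq_integrableD[OF f] by simp
    show "(norm (g x))\<^sup>2 \<le> C\<^sup>2 * (norm (f x))\<^sup>2" if "x \<in> space M" for x
      unfolding power_mult_distrib[symmetric] by (intro power_mono le that) simp
  qed
  then show ?thesis by (simp add: normsq_def)
qed

lemma L2_iff_sq_integrable: "f \<in> L2 \<Omega> \<longleftrightarrow> sq_integrable (lebesgue_on \<Omega>) f"
  by (simp add: L2_def sq_integrable_def)

lemma borel_measurable_lebesgue_on: "f \<in> borel_measurable borel \<Longrightarrow> f \<in> borel_measurable (lebesgue_on \<Omega>)"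
  by (intro measurable_restrict_space1 measurable_completion) simp

lemma integrable_lebesgue_on_bounded_indicator:
  assumes "open \<Omega>" "bounded K" "K \<in> sets borel"
  shows "integrable (lebesgue_on \<Omega>) (\<lambda>x::'a::euclidean_space. indicator K x :: real)"
proof (subst integrable_restrict_space)
  show "\<Omega> \<inter> space lebesgue \<in> sets lebesgue" using assms by simp
  have "integrable lborel (\<lambda>x. indicator (\<Omega> \<inter> K) x :: real)"
    using assms emeasure_bounded_finite[of "\<Omega> \<inter> K"] by (intro integrable_real_indicator) (auto intro: bounded_subset)
  then have "integrable lebesgue (\<lambda>x. indicator (\<Omega> \<inter> K) x :: real)"
    by (subst integrable_completion) (use assms in auto)
  then show "integrable lebesgue (\<lambda>x. indicator \<Omega> x *\<^sub>R indicator K x :: real)"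
    by (simp add: indicator_inter_arith)
qed

lemma sq_integrable_indicator_integrable:
  fixes f :: "'a::euclidean_space \<Rightarrow> 'b::euclidean_space"
  assumes "open \<Omega>" "bounded K" and K: "K \<in> sets borel"
    and f: "sq_integrable (lebesgue_on \<Omega>) f"
  shows "integrable (lebesgue_on \<Omega>) (\<lambda>x. indicator K x *\<^sub>R f x)"
proof (rule Bochner_Integration.integrable_bound)
  show "integrable (lebesgue_on \<Omega>) (\<lambda>x. indicator K x + (norm (f x))\<^sup>2)"
    by (intro Bochner_Integration.integrable_add integrable_lebesgue_on_bounded_indicator assms sq_integrableD[OF f])
  show "(\<lambda>x. indicator K x *\<^sub>R f x) \<in> borel_measurable (lebesgue_on \<Omega>)"
    by (intro borel_measurable_scaleR sq_integrable_measurable[OF f] borel_measurable_lebesgue_on)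
      (use K in simp)
  show "AE x in lebesgue_on \<Omega>. norm (indicator K x *\<^sub>R f x) \<le> norm (indicator K x + (norm (f x))\<^sup>2)"
    using norm_mult_le_sum_squares[of "f _" "1::real"] by (intro AE_I2) (auto simp: indicator_def add.commute)
qed

lemma sq_integrable_locally_integrable:
  assumes "open \<Omega>" "sq_integrable (lebesgue_on \<Omega>) f"
  shows "f locally_integrable_on \<Omega>"
  unfolding locally_integrable_on_def set_integrable_def
proof (intro allI impI)
  fix K assume "K \<subseteq> \<Omega>" "compact K"
  then have "integrable (lebesgue_on \<Omega>) (\<lambda>x. indicator K x *\<^sub>R f x)"
    using assms by (intro sq_integrable_indicator_integrable) (auto intro: compact_imp_bounded borel_compact)
  then have "integrable lebesgue (\<lambda>x. indicator \<Omega> x *\<^sub>R indicator K x *\<^sub>R f x)"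
    using assms(1) by (subst (asm) integrable_restrict_space) auto
  moreover have "indicator \<Omega> x *\<^sub>R indicator K x *\<^sub>R f x = indicator K x *\<^sub>R f x" for x
    using \<open>K \<subseteq> \<Omega>\<close> by (auto simp: indicator_def)
  ultimately show "integrable lebesgue (\<lambda>x. indicator K x *\<^sub>R f x)" by (simp only:)
qed

lemma vanishes_off_integrable:
  fixes f :: "'a::euclidean_space \<Rightarrow> 'b::euclidean_space"
  assumes "open \<Omega>" "sq_integrable (lebesgue_on \<Omega>) f" "vanishes_off R f"
  shows "integrable (lebesgue_on \<Omega>) f"
proof -
  have "integrable (lebesgue_on \<Omega>) (\<lambda>x. indicator (cball 0 R) x *\<^sub>R f x)"
    using assms by (intro sq_integrable_indicator_integrable) auto
  moreover have "indicator (cball 0 R) x *\<^sub>R f x = f x" for x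
    using vanishes_offD[OF assms(3), of x] by (cases "x \<in> cball 0 R") auto
  ultimately show ?thesis by simp
qed

lemma sq_integrable_bounded_vanishes_off:
  fixes f :: "'a::euclidean_space \<Rightarrow> 'b::euclidean_space"
  assumes "open \<Omega>" "f \<in> borel_measurable (lebesgue_on \<Omega>)" "vanishes_off R f" "\<And>x. norm (f x) \<le> B"
  shows "sq_integrable (lebesgue_on \<Omega>) f"
  unfolding sq_integrable_def
proof
  show "integrable (lebesgue_on \<Omega>) (\<lambda>x. (norm (f x))\<^sup>2)"
  proof (rule Bochner_Integration.integrable_bound)
    show "integrable (lebesgue_on \<Omega>) (\<lambda>x. B\<^sup>2 * indicator (cball 0 R) x)"
      using assms(1) by (intro integrable_mult_right integrable_lebesgue_on_bounded_indicator) auto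
    show "AE x in lebesgue_on \<Omega>. norm ((norm (f x))\<^sup>2) \<le> norm (B\<^sup>2 * indicator (cball 0 R) x)"
    proof (rule AE_I2)
      fix x
      show "norm ((norm (f x))\<^sup>2) \<le> norm (B\<^sup>2 * indicator (cball 0 R) x)"
        using power_mono[OF assms(4)[of x], of 2] vanishes_offD[OF assms(3), of x]
        by (cases "x \<in> cball 0 R") auto
    qed
  qed (use assms(2) in measurable)
qed fact

section \<open>Borel representatives\<close>

text \<open>Extension by zero across the boundary of \<Omega>, made Borel by a change on a null set,
  so that product integrals over \<open>lborel\<close> make sense.\<close>

definition borel_rep :: "'a::euclidean_space set \<Rightarrow> ('a \<Rightarrow> 'b::euclidean_space) \<Rightarrow> ('a \<Rightarrow> 'b) \<Rightarrow> bool" where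
  "borel_rep \<Omega> f g \<longleftrightarrow> g \<in> borel_measurable borel \<and> (AE x in lebesgue. g x = indicator \<Omega> x *\<^sub>R f x)"

text \<open>A measurable function is an almost everywhere limit of continuous ones, and
  \<open>lim\<close> of these is Borel. Multiplying by the indicator of the ball makes the
  representative vanish outside it at every point and not merely almost everywhere.\<close>

lemma borel_rep_exists:
  fixes f :: "'a::euclidean_space \<Rightarrow> 'b::euclidean_space"
  assumes "open \<Omega>" "f \<in> borel_measurable (lebesgue_on \<Omega>)" "vanishes_off R f"
  shows "\<exists>g. borel_rep \<Omega> f g \<and> vanishes_off R g"
proof -
  have "f measurable_on \<Omega>"
    using assms by (subst measurable_on_iff_borel_measurable) auto
  then obtain N h where N: "negligible N" and h: "\<And>n. continuous_on UNIV (h n)"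
    and lim: "\<And>x. x \<notin> N \<Longrightarrow> (\<lambda>n. h n x) \<longlonglongrightarrow> (if x \<in> \<Omega> then f x else 0)"
    unfolding measurable_on_def by auto
  have [measurable]: "h n \<in> borel_measurable borel" for n
    by (intro borel_measurable_continuous_onI h)
  define g where "g x = indicator (cball 0 R) x *\<^sub>R lim (\<lambda>n. h n x)" for x
  have "g \<in> borel_measurable borel"
    unfolding g_def[abs_def] by measurable
  moreover have "AE x in lebesgue. x \<notin> N"
    using N by (intro AE_not_in) (simp add: negligible_iff_null_sets)
  then have "AE x in lebesgue. g x = indicator \<Omega> x *\<^sub>R f x"
  proof eventually_elim
    case (elim x)
    then show ?case
      using limI[OF lim[OF elim]] vanishes_offD[OF assms(3), of x]
      by (cases "x \<in> cball 0 R") (auto simp: g_def)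
  qed
  moreover have "vanishes_off R g" by (simp add: vanishes_off_def g_def)
  ultimately show ?thesis unfolding borel_rep_def by blast
qed

text \<open>\<open>F\<close> and \<open>G\<close> may be composite expressions, so products of
  fields and kernels are transferred in one go.\<close>

lemma borel_rep_transfer:
  fixes F :: "'a::euclidean_space \<Rightarrow> 'c::euclidean_space"
  assumes "open \<Omega>" and G: "G \<in> borel_measurable borel"
    and AE: "AE x in lebesgue. G x = indicator \<Omega> x *\<^sub>R F x"
  shows "(\<integral>x. F x \<partial>lebesgue_on \<Omega>) = (LBINT x. G x)"
    and "integrable (lebesgue_on \<Omega>) F \<longleftrightarrow> integrable lborel G"
proof -
  have \<Omega>: "\<Omega> \<inter> space lebesgue \<in> sets lebesgue" using assms(1) by simp
  have G': "G \<in> borel_measurable lebesgue" using G by (intro measurable_completion) simp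
  have F': "(\<lambda>x. indicator \<Omega> x *\<^sub>R F x) \<in> borel_measurable lebesgue"
    by (rule borel_measurable_AE[OF G' AE])
  have "(\<integral>x. F x \<partial>lebesgue_on \<Omega>) = (\<integral>x. indicator \<Omega> x *\<^sub>R F x \<partial>lebesgue)"
    by (rule integral_restrict_space[OF \<Omega>])
  also have "\<dots> = (\<integral>x. G x \<partial>lebesgue)"
    using AE by (intro integral_cong_AE F' G') auto
  also have "\<dots> = (LBINT x. G x)"
    using G by (intro integral_completion) simp
  finally show "(\<integral>x. F x \<partial>lebesgue_on \<Omega>) = (LBINT x. G x)" .
  have "integrable (lebesgue_on \<Omega>) F \<longleftrightarrow> integrable lebesgue (\<lambda>x. indicator \<Omega> x *\<^sub>R F x)"
    by (rule integrable_restrict_space[OF \<Omega>])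
  also have "\<dots> \<longleftrightarrow> integrable lebesgue G"
    using AE by (intro integrable_cong_AE F' G') auto
  also have "\<dots> \<longleftrightarrow> integrable lborel G"
    using G by (intro integrable_completion) simp
  finally show "integrable (lebesgue_on \<Omega>) F \<longleftrightarrow> integrable lborel G" .
qed

lemma borel_rep_sq_integrable:
  assumes "open \<Omega>" "sq_integrable (lebesgue_on \<Omega>) f" "borel_rep \<Omega> f g"
  shows "sq_integrable lborel g" "normsq lborel g = normsq (lebesgue_on \<Omega>) f"
proof -
  have g: "g \<in> borel_measurable borel" using assms(3) by (simp add: borel_rep_def)
  have g2: "(\<lambda>x. (norm (g x))\<^sup>2) \<in> borel_measurable borel" using g by measurable
  have AE: "AE x in lebesgue. (norm (g x))\<^sup>2 = indicator \<Omega> x *\<^sub>R (norm (f x))\<^sup>2"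
    using assms(3) unfolding borel_rep_def by (auto elim!: eventually_mono simp: indicator_def)
  show "sq_integrable lborel g"
    using assms(2) g borel_rep_transfer(2)[OF assms(1) g2 AE] by (simp add: sq_integrable_def)
  show "normsq lborel g = normsq (lebesgue_on \<Omega>) f"
    using borel_rep_transfer(1)[OF assms(1) g2 AE] by (simp add: normsq_def)
qed

lemma test_function_integrable:
  assumes "open \<Omega>" "\<psi> \<in> test_functions \<Omega>"
  shows "sq_integrable (lebesgue_on \<Omega>) f \<Longrightarrow> sq_integrable (lebesgue_on \<Omega>) (\<lambda>x. \<psi> x *\<^sub>R f x)"
    and "sq_integrable (lebesgue_on \<Omega>) (\<lambda>x. \<psi> x *\<^sub>R b)"
    and "sq_integrable (lebesgue_on \<Omega>) (grad \<psi>)"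
    and "sq_integrable (lebesgue_on \<Omega>) f \<Longrightarrow> integrable (lebesgue_on \<Omega>) (\<lambda>x. \<psi> x *\<^sub>R f x)"
proof -
  obtain B where B: "0 < B" "\<And>x. \<bar>\<psi> x\<bar> \<le> B" "\<And>x. norm (grad \<psi> x) \<le> B"
    using test_functions_bounded[OF assms(2)] by blast
  have meas: "\<psi> \<in> borel_measurable (lebesgue_on \<Omega>)" "grad \<psi> \<in> borel_measurable (lebesgue_on \<Omega>)"
    by (intro borel_measurable_lebesgue_on borel_measurable_continuous_onI test_functionsD(3)[OF assms(2)]
      continuous_on_grad[OF assms(2)])+
  obtain R where R: "closure {x. \<psi> x \<noteq> 0} \<subseteq> cball 0 R"
    using bounded_subset_ballD[OF compact_imp_bounded[OF test_functionsD(4)[OF assms(2)]], of 0]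
      ball_subset_cball by blast
  have off: "vanishes_off R \<psi>" "vanishes_off R (grad \<psi>)"
    using subsetD[OF R] grad_outside[of _ \<psi>] subsetD[OF closure_subset, of _ "{x. \<psi> x \<noteq> 0}"]
    unfolding vanishes_off_def by blast+
  show 1: "sq_integrable (lebesgue_on \<Omega>) (\<lambda>x. \<psi> x *\<^sub>R f x)"
    if "sq_integrable (lebesgue_on \<Omega>) f" for f :: "real^3 \<Rightarrow> 'z::euclidean_space"
    using that by (rule sq_integrable_bound[where C=B])
      (auto intro!: borel_measurable_scaleR meas sq_integrable_measurable[OF that] mult_right_mono B)
  show "sq_integrable (lebesgue_on \<Omega>) (\<lambda>x. \<psi> x *\<^sub>R b)"
  proof (rule sq_integrable_bounded_vanishes_off[OF assms(1), where R=R and B="B * norm b"])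
    show "vanishes_off R (\<lambda>x. \<psi> x *\<^sub>R b)" using off by (simp add: vanishes_off_def)
  qed (auto intro!: borel_measurable_scaleR meas mult_right_mono B)
  show "sq_integrable (lebesgue_on \<Omega>) (grad \<psi>)"
    by (rule sq_integrable_bounded_vanishes_off[OF assms(1) meas(2) off(2) B(3)])
  show "integrable (lebesgue_on \<Omega>) (\<lambda>x. \<psi> x *\<^sub>R f x)" if "sq_integrable (lebesgue_on \<Omega>) f"
    by (rule vanishes_off_integrable[OF assms(1) 1[OF that], of R]) (use off in \<open>simp add: vanishes_off_def\<close>)
qed

lemma sq_integrable_cross3_integrable:
  assumes "sq_integrable M f" "sq_integrable M g"
  shows "integrable M (\<lambda>x. cross3 (f x) (g x))"
  using assms
  by (intro sq_integrable_bilinear norm_cross3_le borel_measurable_cross3 sq_integrable_measurable)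

text \<open>Reduction to the compactly supported case by the product rules for
  \<open>\<phi> e\<close> and \<open>\<psi> H\<close>. The extra terms contain no derivatives of the
  fields, so the curl and divergence of the localised fields stay bounded in
  \<open>L\<^sup>2\<close>.\<close>

lemma div_curl_local:
  fixes e C H :: "nat \<Rightarrow> real^3 \<Rightarrow> real^3" and D :: "nat \<Rightarrow> real^3 \<Rightarrow> real"
  defines "M \<equiv> (\<lambda>\<Omega>. lebesgue_on \<Omega> :: (real^3) measure)"
  assumes \<Omega>: "open \<Omega>" and \<phi>: "\<phi> \<in> test_functions \<Omega>" and \<psi>: "\<psi> \<in> test_functions \<Omega>"
    and e: "\<And>n. sq_integrable (M \<Omega>) (e n)" "\<And>n. normsq (M \<Omega>) (e n) \<le> K"
    and C: "\<And>n. sq_integrable (M \<Omega>) (C n)" "\<And>n. normsq (M \<Omega>) (C n) \<le> K"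
    and H: "\<And>n. sq_integrable (M \<Omega>) (H n)" "\<And>n. normsq (M \<Omega>) (H n) \<le> K"
    and D: "\<And>n. sq_integrable (M \<Omega>) (D n)" "\<And>n. normsq (M \<Omega>) (D n) \<le> K"
    and curl: "\<And>n \<theta>. \<theta> \<in> test_functions \<Omega> \<Longrightarrow>
      (\<integral>x. \<theta> x *\<^sub>R C n x \<partial>M \<Omega>) = (\<integral>x. cross3 (e n x) (grad \<theta> x) \<partial>M \<Omega>)"
    and div: "\<And>n \<theta>. \<theta> \<in> test_functions \<Omega> \<Longrightarrow>
      (\<integral>x. \<theta> x * D n x \<partial>M \<Omega>) = - (\<integral>x. H n x \<bullet> grad \<theta> x \<partial>M \<Omega>)"
    and weak: "\<And>h. sq_integrable (M \<Omega>) h \<Longrightarrow> (\<lambda>n. L2_ip (M \<Omega>) (e n) h) \<longlonglongrightarrow> 0"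
  shows "(\<lambda>n. \<integral>x. \<phi> x * \<psi> x * (e n x \<bullet> H n x) \<partial>M \<Omega>) \<longlonglongrightarrow> 0"
proof -
  let ?M = "lebesgue_on \<Omega>"
  note M = M_def
  obtain B1 where B1: "0 < B1" "\<And>x. \<bar>\<phi> x\<bar> \<le> B1" "\<And>x. norm (grad \<phi> x) \<le> B1"
    using test_functions_bounded[OF \<phi>] by blast
  obtain B2 where B2: "0 < B2" "\<And>x. \<bar>\<psi> x\<bar> \<le> B2" "\<And>x. norm (grad \<psi> x) \<le> B2"
    using test_functions_bounded[OF \<psi>] by blast
  define B where "B = max B1 B2"
  have B: "\<bar>\<phi> x\<bar> \<le> B" "norm (grad \<phi> x) \<le> B" "\<bar>\<psi> x\<bar> \<le> B" "norm (grad \<psi> x) \<le> B" for x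
    using B1(2,3)[of x] B2(2,3)[of x] by (auto simp: B_def)
  have borel: "\<phi> \<in> borel_measurable borel" "grad \<phi> \<in> borel_measurable borel"
    "\<psi> \<in> borel_measurable borel" "grad \<psi> \<in> borel_measurable borel"
    by (intro borel_measurable_continuous_onI test_functionsD(3)[OF \<phi>] test_functionsD(3)[OF \<psi>]
      continuous_on_grad[OF \<phi>] continuous_on_grad[OF \<psi>])+
  note meas = borel[THEN borel_measurable_lebesgue_on, of \<Omega>]
  have "bounded (closure {x. \<phi> x \<noteq> 0} \<union> closure {x. \<psi> x \<noteq> 0})"
    by (intro compact_imp_bounded compact_Un test_functionsD(4)[OF \<phi>] test_functionsD(4)[OF \<psi>])
  from bounded_subset_ballD[OF this, of 0]
  obtain R0 where "closure {x. \<phi> x \<noteq> 0} \<union> closure {x. \<psi> x \<noteq> 0} \<subseteq> cball 0 R0"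
    using ball_subset_cball by blast
  define R where "R = max 1 R0"
  have "0 < R" by (simp add: R_def)
  have "closure {x. \<phi> x \<noteq> 0} \<subseteq> cball 0 R" "closure {x. \<psi> x \<noteq> 0} \<subseteq> cball 0 R"
    using \<open>_ \<subseteq> cball 0 R0\<close> by (auto simp: R_def subset_iff)
  then have off: "x \<notin> cball 0 R \<Longrightarrow> \<phi> x = 0" "x \<notin> cball 0 R \<Longrightarrow> grad \<phi> x = 0"
    "x \<notin> cball 0 R \<Longrightarrow> \<psi> x = 0" "x \<notin> cball 0 R \<Longrightarrow> grad \<psi> x = 0" for x
    using grad_outside[of x] closure_subset[of "{x. \<phi> x \<noteq> 0}"] closure_subset[of "{x. \<psi> x \<noteq> 0}"] by blast+
  have e_meas: "e n \<in> borel_measurable ?M" and C_meas: "C n \<in> borel_measurable ?M"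
    and H_meas: "H n \<in> borel_measurable ?M" and D_meas: "D n \<in> borel_measurable ?M" for n
    using e(1)[of n] C(1)[of n] H(1)[of n] D(1)[of n] by (auto simp: sq_integrable_def M)
  have K: "0 \<le> K" using order_trans[OF normsq_nonneg e(2)] .

  define U where "U n x = \<phi> x *\<^sub>R e n x" for n x
  define V where "V n x = \<psi> x *\<^sub>R H n x" for n x
  define P where "P n x = cross3 (e n x) (grad \<phi> x)" for n x
  define Q where "Q n x = H n x \<bullet> grad \<psi> x" for n x
  \<comment> \<open>The curl of \<open>\<phi> e\<close> and, on the next line, the divergence of
    \<open>\<psi> H\<close>. The minus sign stems from writing \<open>grad \<phi> x\<close> as the
    second factor of the cross product.\<close>
  define Cc where "Cc n x = \<phi> x *\<^sub>R C n x - P n x" for n x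
  define Dd where "Dd n x = \<psi> x *\<^sub>R D n x + Q n x" for n x
  have le: "norm (U n x) \<le> B * norm (e n x)" "norm (V n x) \<le> B * norm (H n x)"
    "norm (P n x) \<le> B * norm (e n x)" "norm (Q n x) \<le> B * norm (H n x)"
    "norm (\<phi> x *\<^sub>R C n x) \<le> B * norm (C n x)" "norm (\<psi> x *\<^sub>R D n x) \<le> B * norm (D n x)" for n x
  proof -
    show "norm (U n x) \<le> B * norm (e n x)" "norm (V n x) \<le> B * norm (H n x)"
      "norm (\<phi> x *\<^sub>R C n x) \<le> B * norm (C n x)" "norm (\<psi> x *\<^sub>R D n x) \<le> B * norm (D n x)"
      unfolding U_def V_def norm_scaleR by (auto intro!: mult_right_mono B)
    have "norm (P n x) \<le> norm (e n x) * norm (grad \<phi> x)"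
      unfolding P_def by (rule norm_cross3_le)
    also have "\<dots> \<le> norm (e n x) * B" by (intro mult_left_mono B) auto
    finally show "norm (P n x) \<le> B * norm (e n x)" by (simp add: mult.commute)
    have "norm (Q n x) \<le> norm (H n x) * norm (grad \<psi> x)"
      unfolding Q_def real_norm_def by (rule Cauchy_Schwarz_ineq2)
    also have "\<dots> \<le> norm (H n x) * B" by (intro mult_left_mono B) auto
    finally show "norm (Q n x) \<le> B * norm (H n x)" by (simp add: mult.commute)
  qed
  have Fmeas: "U n \<in> borel_measurable ?M" "V n \<in> borel_measurable ?M" "P n \<in> borel_measurable ?M"
    "Q n \<in> borel_measurable ?M" "(\<lambda>x. \<phi> x *\<^sub>R C n x) \<in> borel_measurable ?M"
    "(\<lambda>x. \<psi> x *\<^sub>R D n x) \<in> borel_measurable ?M" for n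
    unfolding U_def[abs_def] V_def[abs_def] P_def[abs_def] Q_def[abs_def]
    by (intro borel_measurable_scaleR borel_measurable_cross3 borel_measurable_inner meas e_meas C_meas H_meas D_meas)+
  have sq: "sq_integrable ?M (U n)" "sq_integrable ?M (V n)" "sq_integrable ?M (P n)" "sq_integrable ?M (Q n)"
    "sq_integrable ?M (\<lambda>x. \<phi> x *\<^sub>R C n x)" "sq_integrable ?M (\<lambda>x. \<psi> x *\<^sub>R D n x)" for n
    by (rule sq_integrable_bound[OF _ _ le(1)] sq_integrable_bound[OF _ _ le(2)] sq_integrable_bound[OF _ _ le(3)]
      sq_integrable_bound[OF _ _ le(4)] sq_integrable_bound[OF _ _ le(5)] sq_integrable_bound[OF _ _ le(6)];
      use e(1) C(1) H(1) D(1) Fmeas in \<open>simp add: M\<close>)+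
  have nK: "normsq ?M (U n) \<le> B\<^sup>2 * K" "normsq ?M (V n) \<le> B\<^sup>2 * K" "normsq ?M (P n) \<le> B\<^sup>2 * K" "normsq ?M (Q n) \<le> B\<^sup>2 * K"
    "normsq ?M (\<lambda>x. \<phi> x *\<^sub>R C n x) \<le> B\<^sup>2 * K" "normsq ?M (\<lambda>x. \<psi> x *\<^sub>R D n x) \<le> B\<^sup>2 * K" for n
    using order_trans[OF normsq_bound[OF e(1)[unfolded M] Fmeas(1) le(1)] mult_left_mono[OF e(2)[unfolded M]]]
      order_trans[OF normsq_bound[OF H(1)[unfolded M] Fmeas(2) le(2)] mult_left_mono[OF H(2)[unfolded M]]]
      order_trans[OF normsq_bound[OF e(1)[unfolded M] Fmeas(3) le(3)] mult_left_mono[OF e(2)[unfolded M]]]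
      order_trans[OF normsq_bound[OF H(1)[unfolded M] Fmeas(4) le(4)] mult_left_mono[OF H(2)[unfolded M]]]
      order_trans[OF normsq_bound[OF C(1)[unfolded M] Fmeas(5) le(5)] mult_left_mono[OF C(2)[unfolded M]]]
      order_trans[OF normsq_bound[OF D(1)[unfolded M] Fmeas(6) le(6)] mult_left_mono[OF D(2)[unfolded M]]]
    by simp_all
  have sqCc: "sq_integrable ?M (Cc n)" and sqDd: "sq_integrable ?M (Dd n)" for n
    unfolding Cc_def[abs_def] Dd_def[abs_def] by (intro sq_integrable_diff sq_integrable_add sq)+
  have nCc: "normsq ?M (Cc n) \<le> 4 * (B\<^sup>2 * K)" for n
    using normsq_diff_le[OF sq(5)[of n] sq(3)[of n]] nK(3,5)[of n] unfolding Cc_def[abs_def] by linarith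
  have nDd: "normsq ?M (Dd n) \<le> 4 * (B\<^sup>2 * K)" for n
    using normsq_add_le[OF sq(6)[of n] sq(4)[of n]] nK(4,6)[of n] unfolding Dd_def[abs_def] by linarith
  have voff: "vanishes_off R (U n)" "vanishes_off R (V n)" "vanishes_off R (Cc n)" "vanishes_off R (Dd n)" for n
    using off by (auto simp: vanishes_off_def U_def V_def Cc_def Dd_def P_def Q_def)

  obtain u where u: "\<And>n. borel_rep \<Omega> (U n) (u n)" "\<And>n. vanishes_off R (u n)"
    using borel_rep_exists[OF \<Omega> Fmeas(1) voff(1)] by metis
  obtain v where v: "\<And>n. borel_rep \<Omega> (V n) (v n)" "\<And>n. vanishes_off R (v n)"
    using borel_rep_exists[OF \<Omega> Fmeas(2) voff(2)] by metis
  obtain c where c: "\<And>n. borel_rep \<Omega> (Cc n) (c n)" "\<And>n. vanishes_off R (c n)"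
    using borel_rep_exists[OF \<Omega> sq_integrable_measurable[OF sqCc] voff(3)] by metis
  obtain d where d: "\<And>n. borel_rep \<Omega> (Dd n) (d n)" "\<And>n. vanishes_off R (d n)"
    using borel_rep_exists[OF \<Omega> sq_integrable_measurable[OF sqDd] voff(4)] by metis
  have ub: "u n \<in> borel_measurable borel" "AE x in lebesgue. u n x = indicator \<Omega> x *\<^sub>R U n x"
    and vb: "v n \<in> borel_measurable borel" "AE x in lebesgue. v n x = indicator \<Omega> x *\<^sub>R V n x"
    and cb: "c n \<in> borel_measurable borel" "AE x in lebesgue. c n x = indicator \<Omega> x *\<^sub>R Cc n x"
    and db: "d n \<in> borel_measurable borel" "AE x in lebesgue. d n x = indicator \<Omega> x *\<^sub>R Dd n x" for n
    using u(1)[of n] v(1)[of n] c(1)[of n] d(1)[of n] by (auto simp: borel_rep_def)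

  have "(\<lambda>n. L2_ip lborel (u n) (v n)) \<longlonglongrightarrow> 0"
  proof (rule div_curl_compact_support[where R=R and M="4 * (B\<^sup>2 * K)" and c=c and d=d])
    have BK: "0 \<le> B\<^sup>2 * K" using K by simp
    fix n
    show "sq_integrable lborel (u n)" "sq_integrable lborel (v n)" "sq_integrable lborel (c n)" "sq_integrable lborel (d n)"
      using borel_rep_sq_integrable(1)[OF \<Omega> sq(1) u(1)] borel_rep_sq_integrable(1)[OF \<Omega> sq(2) v(1)]
        borel_rep_sq_integrable(1)[OF \<Omega> sqCc c(1)] borel_rep_sq_integrable(1)[OF \<Omega> sqDd d(1)] by auto
    show "normsq lborel (u n) \<le> 4 * (B\<^sup>2 * K)" "normsq lborel (v n) \<le> 4 * (B\<^sup>2 * K)"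
      "normsq lborel (c n) \<le> 4 * (B\<^sup>2 * K)" "normsq lborel (d n) \<le> 4 * (B\<^sup>2 * K)"
      using borel_rep_sq_integrable(2)[OF \<Omega> sq(1) u(1), of n] borel_rep_sq_integrable(2)[OF \<Omega> sq(2) v(1), of n]
        borel_rep_sq_integrable(2)[OF \<Omega> sqCc c(1), of n] borel_rep_sq_integrable(2)[OF \<Omega> sqDd d(1), of n]
        nK(1,2)[of n] nCc[of n] nDd[of n] BK by linarith+
    fix \<delta> :: real and a :: "real^3" assume "0 < \<delta>"
    have kb: "\<bar>plummer \<delta> z ^ 3 * (z \<bullet> a)\<bar> \<le> inverse \<delta> ^ 2 * norm a" for z :: "real^3"
    proof -
      have "\<bar>plummer \<delta> z ^ 3 * (z \<bullet> a)\<bar> = \<bar>(plummer \<delta> z ^ 3 *\<^sub>R z) \<bullet> a\<bar>" by simp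
      also have "\<dots> \<le> norm (plummer \<delta> z ^ 3 *\<^sub>R z) * norm a" by (rule Cauchy_Schwarz_ineq2)
      also have "\<dots> \<le> inverse \<delta> ^ 2 * norm a"
        by (intro mult_right_mono norm_plummer_cubed_scaleR_le \<open>0 < \<delta>\<close>) auto
      finally show ?thesis .
    qed
    have mult_int: "integrable ?M (\<lambda>x. g x *\<^sub>R f x)"
      if f: "sq_integrable ?M f" "vanishes_off R f" and g: "g \<in> borel_measurable borel" "\<And>x. \<bar>g x\<bar> \<le> G"
      for f :: "real^3 \<Rightarrow> 'z::euclidean_space" and g G
    proof (rule vanishes_off_integrable[OF \<Omega>, where R=R])
      show "sq_integrable ?M (\<lambda>x. g x *\<^sub>R f x)"
        by (rule sq_integrable_bound[OF f(1), where C=G])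
          (auto intro!: borel_measurable_scaleR[OF borel_measurable_lebesgue_on[OF g(1)] sq_integrable_measurable[OF f(1)]]
            mult_right_mono g(2))
      show "vanishes_off R (\<lambda>x. g x *\<^sub>R f x)" using f(2) by (simp add: vanishes_off_def)
    qed
    show "(LBINT y. (plummer \<delta> (x - y) ^ 3 * ((x - y) \<bullet> a)) *\<^sub>R c n y)
        = - (LBINT y. cross3 (u n y) (plummer_hess \<delta> a (x - y)))" for x
    proof -
      define g where "g y = plummer \<delta> (x - y) ^ 3 * ((x - y) \<bullet> a)" for y
      have g_borel: "g \<in> borel_measurable borel" unfolding g_def[abs_def] by measurable
      have gb: "\<bar>g y\<bar> \<le> inverse \<delta> ^ 2 * norm a" for y unfolding g_def by (rule kb)
      \<comment> \<open>The localised kernel is an admissible test function for every fixed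
        \<open>x\<close>, so the weak curl may be evaluated on it.\<close>
      have test: "(\<lambda>y. \<phi> y * g y) \<in> test_functions \<Omega>"
        unfolding g_def by (intro test_functions_mult[OF \<phi>] C_k_plummer_cubed_inner \<open>0 < \<delta>\<close>)
      have grad: "grad (\<lambda>y. \<phi> y * g y) y = g y *\<^sub>R grad \<phi> y + \<phi> y *\<^sub>R (- plummer_hess \<delta> a (x - y))" for y
        unfolding g_def by (intro grad_mult test_functionsD(2)[OF \<phi>] has_derivative_plummer_cubed_inner \<open>0 < \<delta>\<close>)
      have "(LBINT y. g y *\<^sub>R c n y) = (\<integral>y. g y *\<^sub>R Cc n y \<partial>?M)"
        using cb(2)[of n]
        by (intro borel_rep_transfer(1)[OF \<Omega>, symmetric] borel_measurable_scaleR g_borel cb(1)) (auto elim!: eventually_mono)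
      also have "\<dots> = (\<integral>y. g y *\<^sub>R \<phi> y *\<^sub>R C n y - g y *\<^sub>R P n y \<partial>?M)"
        by (simp add: Cc_def scaleR_diff_right)
      also have "\<dots> = (\<integral>y. g y *\<^sub>R \<phi> y *\<^sub>R C n y \<partial>?M) - (\<integral>y. g y *\<^sub>R P n y \<partial>?M)"
        by (intro Bochner_Integration.integral_diff mult_int[OF _ _ g_borel gb] sq)
          (use off in \<open>auto simp: vanishes_off_def P_def\<close>)
      also have "(\<integral>y. g y *\<^sub>R \<phi> y *\<^sub>R C n y \<partial>?M) = (\<integral>y. cross3 (e n y) (grad (\<lambda>y. \<phi> y * g y) y) \<partial>?M)"
        using curl[OF test, of n] by (simp add: M mult.commute)
      \<comment> \<open>The derivative that falls on \<phi> reproduces the term \<open>P n\<close>,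
        which cancels against the one in \<open>Cc n\<close>; the derivative that falls on the
        kernel is the Hessian.\<close>
      also have "\<dots> = (\<integral>y. g y *\<^sub>R P n y - cross3 (U n y) (plummer_hess \<delta> a (x - y)) \<partial>?M)"
        unfolding grad by (simp add: P_def U_def Cross3.right_diff_distrib cross_mult_right cross_mult_left)
      also have "\<dots> = (\<integral>y. g y *\<^sub>R P n y \<partial>?M) - (\<integral>y. cross3 (U n y) (plummer_hess \<delta> a (x - y)) \<partial>?M)"
      proof (intro Bochner_Integration.integral_diff mult_int[OF _ _ g_borel gb] sq)
        show "vanishes_off R (P n)" using off by (auto simp: vanishes_off_def P_def)
        show "integrable ?M (\<lambda>y. cross3 (U n y) (plummer_hess \<delta> a (x - y)))"
        proof (rule vanishes_off_integrable[OF \<Omega>, where R=R])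
          show "sq_integrable ?M (\<lambda>y. cross3 (U n y) (plummer_hess \<delta> a (x - y)))"
          proof (rule sq_integrable_bound[OF sq(1), where C="4 * inverse \<delta> ^ 3 * norm a"])
            show "(\<lambda>y. cross3 (U n y) (plummer_hess \<delta> a (x - y))) \<in> borel_measurable ?M"
              by (intro borel_measurable_cross3 Fmeas borel_measurable_lebesgue_on) measurable
            show "norm (cross3 (U n y) (plummer_hess \<delta> a (x - y))) \<le> 4 * inverse \<delta> ^ 3 * norm a * norm (U n y)" for y
              using order_trans[OF norm_cross3_le mult_left_mono[OF norm_plummer_hess_le[OF \<open>0 < \<delta>\<close>]]]
              by (simp add: mult.commute)
          qed
          show "vanishes_off R (\<lambda>y. cross3 (U n y) (plummer_hess \<delta> a (x - y)))"
            using voff(1)[of n] by (simp add: vanishes_off_def)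
        qed
      qed
      also have "(\<integral>y. cross3 (U n y) (plummer_hess \<delta> a (x - y)) \<partial>?M) = (LBINT y. cross3 (u n y) (plummer_hess \<delta> a (x - y)))"
      proof (rule borel_rep_transfer(1)[OF \<Omega>])
        show "(\<lambda>y. cross3 (u n y) (plummer_hess \<delta> a (x - y))) \<in> borel_measurable borel"
          using ub(1)[of n] by measurable
        show "AE y in lebesgue. cross3 (u n y) (plummer_hess \<delta> a (x - y)) = indicator \<Omega> y *\<^sub>R cross3 (U n y) (plummer_hess \<delta> a (x - y))"
          using ub(2)[of n] by eventually_elim (simp add: cross_mult_left)
      qed
      finally show ?thesis by (simp add: g_def)
    qed
    show "(LBINT x. plummer \<delta> (x - y) ^ 3 * ((x - y) \<bullet> a) * d n x) = - (LBINT x. v n x \<bullet> plummer_hess \<delta> a (x - y))" for y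
    proof -
      define g where "g x = plummer \<delta> (x - y) ^ 3 * ((x - y) \<bullet> a)" for x
      have g_borel: "g \<in> borel_measurable borel" unfolding g_def[abs_def] by measurable
      have gb: "\<bar>g x\<bar> \<le> inverse \<delta> ^ 2 * norm a" for x unfolding g_def by (rule kb)
      have test: "(\<lambda>x. \<psi> x * g x) \<in> test_functions \<Omega>"
        unfolding g_def by (intro test_functions_mult[OF \<psi>] C_k_plummer_cubed_inner \<open>0 < \<delta>\<close>)
      have grad: "grad (\<lambda>x. \<psi> x * g x) x = g x *\<^sub>R grad \<psi> x + \<psi> x *\<^sub>R plummer_hess \<delta> a (x - y)" for x
        unfolding g_def by (intro grad_mult test_functionsD(2)[OF \<psi>] has_derivative_plummer_cubed_inner \<open>0 < \<delta>\<close>)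
      have "(LBINT x. g x *\<^sub>R d n x) = (\<integral>x. g x *\<^sub>R Dd n x \<partial>?M)"
        using db(2)[of n]
        by (intro borel_rep_transfer(1)[OF \<Omega>, symmetric] borel_measurable_scaleR g_borel db(1)) (auto elim!: eventually_mono)
      also have "\<dots> = (\<integral>x. g x *\<^sub>R \<psi> x *\<^sub>R D n x + g x *\<^sub>R Q n x \<partial>?M)"
        by (simp add: Dd_def distrib_left)
      also have "\<dots> = (\<integral>x. g x *\<^sub>R \<psi> x *\<^sub>R D n x \<partial>?M) + (\<integral>x. g x *\<^sub>R Q n x \<partial>?M)"
        by (intro Bochner_Integration.integral_add mult_int[OF _ _ g_borel gb] sq)
          (use off in \<open>auto simp: vanishes_off_def Q_def\<close>)
      also have "(\<integral>x. g x *\<^sub>R \<psi> x *\<^sub>R D n x \<partial>?M) = - (\<integral>x. H n x \<bullet> grad (\<lambda>x. \<psi> x * g x) x \<partial>?M)"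
        using div[OF test, of n] by (simp add: M mult_ac)
      \<comment> \<open>As for the curl: the term \<open>Q n\<close> from differentiating \<psi>
        cancels against the correction in \<open>Dd n\<close>.\<close>
      also have "(\<integral>x. H n x \<bullet> grad (\<lambda>x. \<psi> x * g x) x \<partial>?M) = (\<integral>x. g x *\<^sub>R Q n x + V n x \<bullet> plummer_hess \<delta> a (x - y) \<partial>?M)"
        unfolding grad by (simp add: Q_def V_def inner_add_right)
      also have "\<dots> = (\<integral>x. g x *\<^sub>R Q n x \<partial>?M) + (\<integral>x. V n x \<bullet> plummer_hess \<delta> a (x - y) \<partial>?M)"
      proof (intro Bochner_Integration.integral_add mult_int[OF _ _ g_borel gb] sq)
        show "vanishes_off R (Q n)" using off by (auto simp: vanishes_off_def Q_def)
        show "integrable ?M (\<lambda>x. V n x \<bullet> plummer_hess \<delta> a (x - y))"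
        proof (rule vanishes_off_integrable[OF \<Omega>, where R=R])
          show "sq_integrable ?M (\<lambda>x. V n x \<bullet> plummer_hess \<delta> a (x - y))"
          proof (rule sq_integrable_bound[OF sq(2), where C="4 * inverse \<delta> ^ 3 * norm a"])
            show "(\<lambda>x. V n x \<bullet> plummer_hess \<delta> a (x - y)) \<in> borel_measurable ?M"
              by (intro borel_measurable_inner Fmeas borel_measurable_lebesgue_on) measurable
            show "norm (V n x \<bullet> plummer_hess \<delta> a (x - y)) \<le> 4 * inverse \<delta> ^ 3 * norm a * norm (V n x)" for x
              using order_trans[OF Cauchy_Schwarz_ineq2 mult_left_mono[OF norm_plummer_hess_le[OF \<open>0 < \<delta>\<close>]]]
              by (simp add: mult.commute)
          qed
          show "vanishes_off R (\<lambda>x. V n x \<bullet> plummer_hess \<delta> a (x - y))"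
            using voff(2)[of n] by (simp add: vanishes_off_def)
        qed
      qed
      also have "(\<integral>x. V n x \<bullet> plummer_hess \<delta> a (x - y) \<partial>?M) = (LBINT x. v n x \<bullet> plummer_hess \<delta> a (x - y))"
      proof (rule borel_rep_transfer(1)[OF \<Omega>])
        show "(\<lambda>x. v n x \<bullet> plummer_hess \<delta> a (x - y)) \<in> borel_measurable borel"
          using vb(1)[of n] by measurable
        show "AE x in lebesgue. v n x \<bullet> plummer_hess \<delta> a (x - y) = indicator \<Omega> x *\<^sub>R (V n x \<bullet> plummer_hess \<delta> a (x - y))"
          using vb(2)[of n] by eventually_elim simp
      qed
      finally show ?thesis by (simp add: g_def)
    qed
  next
    fix \<epsilon> :: real and x :: "real^3" assume "0 < \<epsilon>"
    define k where "k y = plummer \<epsilon> (x - y) ^ 5" for y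
    have k_borel: "k \<in> borel_measurable borel" unfolding k_def[abs_def] by measurable
    have kb: "\<bar>k y\<bar> \<le> inverse \<epsilon> ^ 5" for y
      using power_mono[OF plummer_le[OF \<open>0 < \<epsilon>\<close>], of "x - y" 5] plummer_pos[OF \<open>0 < \<epsilon>\<close>, of "x - y"] by (simp add: k_def)
    have int: "integrable ?M (\<lambda>y. k y *\<^sub>R U n y)" for n
    proof (rule vanishes_off_integrable[OF \<Omega>, where R=R])
      show "sq_integrable ?M (\<lambda>y. k y *\<^sub>R U n y)"
        by (rule sq_integrable_bound[OF sq(1)[of n], where C="inverse \<epsilon> ^ 5"])
          (auto intro!: borel_measurable_scaleR[OF borel_measurable_lebesgue_on[OF k_borel] Fmeas(1)] mult_right_mono kb)
      show "vanishes_off R (\<lambda>y. k y *\<^sub>R U n y)" using voff(1)[of n] by (simp add: vanishes_off_def)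
    qed
    have eq: "(LBINT y. k y *\<^sub>R u n y) = (\<integral>y. k y *\<^sub>R U n y \<partial>?M)" for n
      using ub(2)[of n]
      by (intro borel_rep_transfer(1)[OF \<Omega>, symmetric] borel_measurable_scaleR k_borel ub(1)) (auto elim!: eventually_mono)
    \<comment> \<open>The limit of vector integrals is taken componentwise; the cutoff is moved from
      \<open>U n\<close> onto the kernel, which gives a square-integrable field for the weak
      convergence of \<open>e n\<close>.\<close>
    have "(\<lambda>n. (\<integral>y. k y *\<^sub>R U n y \<partial>?M) \<bullet> b) \<longlonglongrightarrow> 0 \<bullet> b" if "b \<in> Basis" for b
    proof -
      have "sq_integrable ?M (\<lambda>y. (k y * \<phi> y) *\<^sub>R b)"
      proof (rule sq_integrable_bounded_vanishes_off[OF \<Omega>, where R=R and B="inverse \<epsilon> ^ 5 * B * norm b"])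
        show "(\<lambda>y. (k y * \<phi> y) *\<^sub>R b) \<in> borel_measurable ?M"
          by (intro borel_measurable_lebesgue_on borel_measurable_scaleR borel_measurable_times
            borel_measurable_const k_borel borel(1))
        show "vanishes_off R (\<lambda>y. (k y * \<phi> y) *\<^sub>R b)" using off by (auto simp: vanishes_off_def)
        show "norm ((k y * \<phi> y) *\<^sub>R b) \<le> inverse \<epsilon> ^ 5 * B * norm b" for y
          unfolding norm_scaleR abs_mult using \<open>0 < \<epsilon>\<close> by (intro mult_right_mono mult_mono kb B) auto
      qed
      from weak[unfolded M, OF this] have "(\<lambda>n. L2_ip ?M (e n) (\<lambda>y. (k y * \<phi> y) *\<^sub>R b)) \<longlonglongrightarrow> 0" .
      moreover have "L2_ip ?M (e n) (\<lambda>y. (k y * \<phi> y) *\<^sub>R b) = (\<integral>y. k y *\<^sub>R U n y \<partial>?M) \<bullet> b" for n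
        by (subst integral_inner_left[OF int, symmetric]) (simp add: L2_ip_def U_def mult_ac)
      ultimately show ?thesis by simp
    qed
    then have "(\<lambda>n. \<integral>y. k y *\<^sub>R U n y \<partial>?M) \<longlonglongrightarrow> 0"
      unfolding tendsto_componentwise_iff[of _ 0] by blast
    then show "(\<lambda>n. LBINT y. plummer \<epsilon> (x - y) ^ 5 *\<^sub>R u n y) \<longlonglongrightarrow> 0"
      by (simp add: eq[unfolded k_def] k_def)
  qed (fact u v c d \<open>0 < R\<close>)+
  moreover have "(\<integral>x. \<phi> x * \<psi> x * (e n x \<bullet> H n x) \<partial>?M) = L2_ip lborel (u n) (v n)" for n
    unfolding L2_ip_def
  proof (rule borel_rep_transfer(1)[OF \<Omega>])
    show "(\<lambda>x. u n x \<bullet> v n x) \<in> borel_measurable borel" using ub(1)[of n] vb(1)[of n] by measurable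
    show "AE x in lebesgue. u n x \<bullet> v n x = indicator \<Omega> x *\<^sub>R (\<phi> x * \<psi> x * (e n x \<bullet> H n x))"
      using ub(2)[of n] vb(2)[of n]
      by eventually_elim (auto simp: U_def V_def indicator_def)
  qed
  ultimately show ?thesis by (simp add: M)
qed

section \<open>Weak limits\<close>

lemma L2_bounded_D:
  assumes "L2_bounded \<Omega> f"
  obtains B where "0 \<le> B" "\<And>n. sq_integrable (lebesgue_on \<Omega>) (f n)" "\<And>n. normsq (lebesgue_on \<Omega>) (f n) \<le> B\<^sup>2"
proof -
  obtain B where B: "\<And>n. sqrt (normsq (lebesgue_on \<Omega>) (f n)) \<le> B" and f: "\<And>n. sq_integrable (lebesgue_on \<Omega>) (f n)"
    using assms by (auto simp: L2_bounded_def L2_norm_on_def normsq_def L2_iff_sq_integrable)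
  moreover have "0 \<le> B" using order_trans[OF real_sqrt_ge_zero[OF normsq_nonneg] B] .
  moreover have "normsq (lebesgue_on \<Omega>) (f n) \<le> B\<^sup>2" for n
    using B[of n] by (rule sqrt_le_D)
  ultimately show ?thesis using that by blast
qed

lemma L2_bounded_subseq: "L2_bounded \<Omega> f \<Longrightarrow> L2_bounded \<Omega> (\<lambda>n. f (r n))"
  by (auto simp: L2_bounded_def)

lemma L2_weakly_converges_iff:
  "L2_weakly_converges \<Omega> f g \<longleftrightarrow> (\<forall>n. sq_integrable (lebesgue_on \<Omega>) (f n)) \<and> sq_integrable (lebesgue_on \<Omega>) g \<and>
    (\<forall>h. sq_integrable (lebesgue_on \<Omega>) h \<longrightarrow>
      (\<lambda>n. L2_ip (lebesgue_on \<Omega>) (f n) h) \<longlonglongrightarrow> L2_ip (lebesgue_on \<Omega>) g h)"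
  by (auto simp: L2_weakly_converges_def L2_iff_sq_integrable L2_ip_def)

lemma L2_weakly_converges_subseq:
  assumes "L2_weakly_converges \<Omega> f g" "strict_mono r"
  shows "L2_weakly_converges \<Omega> (\<lambda>n. f (r n)) g"
  using assms LIMSEQ_subseq_LIMSEQ[OF _ assms(2)]
  unfolding L2_weakly_converges_iff by (auto simp: o_def)

lemma L2_weak_compactness:
  assumes "L2_bounded \<Omega> f"
  obtains r g where "strict_mono r" "L2_weakly_converges \<Omega> (\<lambda>n. f (r n)) g"
proof -
  obtain B where B: "0 \<le> B" "\<And>n. sq_integrable (lebesgue_on \<Omega>) (f n)" "\<And>n. normsq (lebesgue_on \<Omega>) (f n) \<le> B\<^sup>2"
    using L2_bounded_D[OF assms] by blast
  obtain r g where "strict_mono r" "sq_integrable (lebesgue_on \<Omega>) g"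
    "\<And>h. sq_integrable (lebesgue_on \<Omega>) h \<Longrightarrow>
      (\<lambda>n. L2_ip (lebesgue_on \<Omega>) (f (r n)) h) \<longlonglongrightarrow> L2_ip (lebesgue_on \<Omega>) g h"
    by (rule sq_integrable_weak_compactness[of "lebesgue_on \<Omega>" f B, OF B(2,3,1)]) blast
  then show ?thesis
    using that B(2) unfolding L2_weakly_converges_iff by blast
qed

lemma cross3_inner_left: "cross3 x y \<bullet> z = x \<bullet> cross3 y z"
  by (simp add: cross3_simps)

text \<open>Paired with a constant vector \<open>b\<close>, both sides of the weak equation are
  \<open>L\<^sup>2\<close> products with fixed fields: \<open>\<phi> x *\<^sub>R b\<close> on the
  curl side and, by the cyclic triple product, \<open>cross3 (grad \<phi> x) b\<close> on the other.
  Weak limits pass through both.\<close>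

lemma has_weak_curl_limit:
  assumes \<Omega>: "open \<Omega>" and curl: "\<And>n. has_weak_curl \<Omega> (E n) (C n)"
    and E: "L2_weakly_converges \<Omega> E E'" and C: "L2_weakly_converges \<Omega> C C'"
  shows "has_weak_curl \<Omega> E' C'"
proof -
  let ?M = "lebesgue_on \<Omega>"
  have sq: "sq_integrable ?M (E n)" "sq_integrable ?M (C n)" "sq_integrable ?M E'" "sq_integrable ?M C'" for n
    using E C by (auto simp: L2_weakly_converges_iff)
  have "(\<integral>x. \<phi> x *\<^sub>R C' x \<partial>?M) = (\<integral>x. cross3 (E' x) (grad \<phi> x) \<partial>?M)" if \<phi>: "\<phi> \<in> test_functions \<Omega>" for \<phi>
  proof (rule vector_eq_rdot[THEN iffD1], rule allI)
    fix b :: "real^3"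
    have grad: "sq_integrable ?M (\<lambda>x. cross3 (grad \<phi> x) b)"
    proof (rule sq_integrable_bound[OF test_function_integrable(3)[OF \<Omega> \<phi>]])
      show "(\<lambda>x. cross3 (grad \<phi> x) b) \<in> borel_measurable ?M"
        by (intro borel_measurable_cross3 borel_measurable_const sq_integrable_measurable[OF test_function_integrable(3)[OF \<Omega> \<phi>]])
      show "norm (cross3 (grad \<phi> x) b) \<le> norm b * norm (grad \<phi> x)" for x
        using norm_cross3_le[of "grad \<phi> x" b] by (simp add: mult.commute)
    qed
    have L: "(\<integral>x. \<phi> x *\<^sub>R c x \<partial>?M) \<bullet> b = L2_ip ?M c (\<lambda>x. \<phi> x *\<^sub>R b)" if "sq_integrable ?M c" for c
      by (subst integral_inner_left[OF test_function_integrable(4)[OF \<Omega> \<phi> that], symmetric]) (simp add: L2_ip_def)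
    have R: "(\<integral>x. cross3 (e x) (grad \<phi> x) \<partial>?M) \<bullet> b = L2_ip ?M e (\<lambda>x. cross3 (grad \<phi> x) b)" if "sq_integrable ?M e" for e
      by (subst integral_inner_left[symmetric])
        (simp_all add: L2_ip_def cross3_inner_left sq_integrable_cross3_integrable that test_function_integrable(3)[OF \<Omega> \<phi>])
    have "L2_ip ?M (C n) (\<lambda>x. \<phi> x *\<^sub>R b) = L2_ip ?M (E n) (\<lambda>x. cross3 (grad \<phi> x) b)" for n
      using curl[of n] \<phi> L[OF sq(2)[of n]] R[OF sq(1)[of n]] by (simp add: has_weak_curl_def)
    moreover have "(\<lambda>n. L2_ip ?M (C n) (\<lambda>x. \<phi> x *\<^sub>R b)) \<longlonglongrightarrow> L2_ip ?M C' (\<lambda>x. \<phi> x *\<^sub>R b)"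
      using C test_function_integrable(2)[OF \<Omega> \<phi>] by (auto simp: L2_weakly_converges_iff)
    moreover have "(\<lambda>n. L2_ip ?M (E n) (\<lambda>x. cross3 (grad \<phi> x) b)) \<longlonglongrightarrow> L2_ip ?M E' (\<lambda>x. cross3 (grad \<phi> x) b)"
      using E grad by (auto simp: L2_weakly_converges_iff)
    ultimately show "(\<integral>x. \<phi> x *\<^sub>R C' x \<partial>?M) \<bullet> b = (\<integral>x. cross3 (E' x) (grad \<phi> x) \<partial>?M) \<bullet> b"
      unfolding L[OF sq(4)] R[OF sq(3)] by (auto dest: LIMSEQ_unique)
  qed
  then show ?thesis
    using sq_integrable_locally_integrable[OF \<Omega> sq(3)] sq_integrable_locally_integrable[OF \<Omega> sq(4)]
    by (simp add: has_weak_curl_def)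
qed

lemma has_weak_div_limit:
  assumes \<Omega>: "open \<Omega>" and div: "\<And>n. has_weak_div \<Omega> (H n) (D n)"
    and H: "L2_weakly_converges \<Omega> H H'" and D: "L2_weakly_converges \<Omega> D D'"
  shows "has_weak_div \<Omega> H' D'"
proof -
  let ?M = "lebesgue_on \<Omega>"
  have sq: "sq_integrable ?M H'" "sq_integrable ?M D'"
    using H D by (auto simp: L2_weakly_converges_iff)
  have "(\<integral>x. \<phi> x * D' x \<partial>?M) = - (\<integral>x. H' x \<bullet> grad \<phi> x \<partial>?M)" if \<phi>: "\<phi> \<in> test_functions \<Omega>" for \<phi>
  proof -
    have eq: "(\<integral>x. \<phi> x * d x \<partial>?M) = L2_ip ?M d \<phi>" for d
      by (simp add: L2_ip_def mult.commute)
    have "L2_ip ?M (D n) \<phi> = - L2_ip ?M (H n) (grad \<phi>)" for n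
    proof -
      have "(\<integral>x. \<phi> x * D n x \<partial>?M) = - (\<integral>x. H n x \<bullet> grad \<phi> x \<partial>?M)"
        using div[of n] \<phi> by (simp add: has_weak_div_def)
      then show ?thesis unfolding eq by (simp add: L2_ip_def[of _ "H n"])
    qed
    moreover have "(\<lambda>n. L2_ip ?M (D n) \<phi>) \<longlonglongrightarrow> L2_ip ?M D' \<phi>"
      using D test_function_integrable(2)[OF \<Omega> \<phi>, of "1::real"] by (auto simp: L2_weakly_converges_iff)
    moreover have "(\<lambda>n. - L2_ip ?M (H n) (grad \<phi>)) \<longlonglongrightarrow> - L2_ip ?M H' (grad \<phi>)"
      using H test_function_integrable(3)[OF \<Omega> \<phi>] by (intro tendsto_minus) (auto simp: L2_weakly_converges_iff)
    ultimately show ?thesis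
      unfolding eq by (auto simp: L2_ip_def[of _ H'] dest: LIMSEQ_unique)
  qed
  then show ?thesis
    using sq_integrable_locally_integrable[OF \<Omega> sq(1)] sq_integrable_locally_integrable[OF \<Omega> sq(2)]
    by (simp add: has_weak_div_def)
qed

text \<open>\<open>E n\<close> is split into \<open>E'\<close> and the remainder \<open>e n\<close>.
  The part with \<open>E'\<close> is a fixed square-integrable field paired with \<open>H n\<close>,
  so weak convergence settles it. The part with \<open>e n\<close> is the localised lemma, up to
  replacing \<phi> by \<open>\<phi> \<psi>\<close>; that error is uniform in \<open>n\<close>
  because \<open>e n\<close> and \<open>H n\<close> are bounded.\<close>

lemma div_curl_lemma:
  assumes \<Omega>: "open \<Omega>" and \<phi>: "\<phi> \<in> test_functions \<Omega>"
    and curl: "\<And>n. has_weak_curl \<Omega> (E n) (C n)" "L2_bounded \<Omega> C"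
    and div: "\<And>n. has_weak_div \<Omega> (H n) (D n)" "L2_bounded \<Omega> D"
    and bd: "L2_bounded \<Omega> E" "L2_bounded \<Omega> H"
    and E': "L2_weakly_converges \<Omega> E E'" and C': "L2_weakly_converges \<Omega> C C'" and H': "L2_weakly_converges \<Omega> H H'"
  shows "(\<lambda>n. \<integral>x. \<phi> x * (E n x \<bullet> H n x) \<partial>lebesgue_on \<Omega>) \<longlonglongrightarrow> (\<integral>x. \<phi> x * (E' x \<bullet> H' x) \<partial>lebesgue_on \<Omega>)"
proof -
  let ?M = "lebesgue_on \<Omega>"
  \<comment> \<open>Needed so that \<open>e n\<close> has the square-integrable curl
    \<open>c n\<close>, bounded in \<open>n\<close>.\<close>
  have curl': "has_weak_curl \<Omega> E' C'" by (rule has_weak_curl_limit[OF \<Omega> curl(1) E' C'])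
  obtain BE where BE: "\<And>n. sq_integrable ?M (E n)" "\<And>n. normsq ?M (E n) \<le> BE\<^sup>2" by (rule L2_bounded_D[OF bd(1)]) blast
  obtain BH where BH: "\<And>n. sq_integrable ?M (H n)" "\<And>n. normsq ?M (H n) \<le> BH\<^sup>2" by (rule L2_bounded_D[OF bd(2)]) blast
  obtain BC where BC: "\<And>n. sq_integrable ?M (C n)" "\<And>n. normsq ?M (C n) \<le> BC\<^sup>2" by (rule L2_bounded_D[OF curl(2)]) blast
  obtain BD where BD: "\<And>n. sq_integrable ?M (D n)" "\<And>n. normsq ?M (D n) \<le> BD\<^sup>2" by (rule L2_bounded_D[OF div(2)]) blast
  have sq': "sq_integrable ?M E'" "sq_integrable ?M C'" "sq_integrable ?M H'"
    using E' C' H' by (auto simp: L2_weakly_converges_iff)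
  define e where "e n x = E n x - E' x" for n x
  define c where "c n x = C n x - C' x" for n x
  have e: "sq_integrable ?M (e n)" and c: "sq_integrable ?M (c n)" for n
    unfolding e_def[abs_def] c_def[abs_def] by (intro sq_integrable_diff BE BC sq')+
  define K where "K = 2 * BE\<^sup>2 + 2 * normsq ?M E' + 2 * BC\<^sup>2 + 2 * normsq ?M C' + BH\<^sup>2 + BD\<^sup>2"
  have K: "normsq ?M (e n) \<le> K" "normsq ?M (c n) \<le> K" "normsq ?M (H n) \<le> K" "normsq ?M (D n) \<le> K" for n
    using normsq_diff_le[OF BE(1)[of n] sq'(1)] normsq_diff_le[OF BC(1)[of n] sq'(2)] BE(2)[of n] BC(2)[of n] BH(2)[of n] BD(2)[of n]
      normsq_nonneg[of ?M E'] normsq_nonneg[of ?M C'] zero_le_power2[of BE] zero_le_power2[of BC] zero_le_power2[of BH] zero_le_power2[of BD]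
    unfolding K_def e_def[abs_def] c_def[abs_def] by linarith+
  have curl_e: "(\<integral>x. \<theta> x *\<^sub>R c n x \<partial>?M) = (\<integral>x. cross3 (e n x) (grad \<theta> x) \<partial>?M)" if \<theta>: "\<theta> \<in> test_functions \<Omega>" for n \<theta>
  proof -
    note int = test_function_integrable(4)[OF \<Omega> \<theta>] sq_integrable_cross3_integrable[OF _ test_function_integrable(3)[OF \<Omega> \<theta>]]
    have "(\<integral>x. \<theta> x *\<^sub>R c n x \<partial>?M) = (\<integral>x. \<theta> x *\<^sub>R C n x \<partial>?M) - (\<integral>x. \<theta> x *\<^sub>R C' x \<partial>?M)"
      unfolding c_def scaleR_diff_right by (intro Bochner_Integration.integral_diff int BC sq')
    also have "\<dots> = (\<integral>x. cross3 (E n x) (grad \<theta> x) \<partial>?M) - (\<integral>x. cross3 (E' x) (grad \<theta> x) \<partial>?M)"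
      using curl(1)[of n] curl' \<theta> by (simp add: has_weak_curl_def)
    also have "\<dots> = (\<integral>x. cross3 (e n x) (grad \<theta> x) \<partial>?M)"
      unfolding e_def Cross3.left_diff_distrib by (intro Bochner_Integration.integral_diff[symmetric] int BE sq')
    finally show ?thesis .
  qed
  have weak: "(\<lambda>n. L2_ip ?M (e n) h) \<longlonglongrightarrow> 0" if h: "sq_integrable ?M h" for h
  proof -
    have "(\<lambda>n. L2_ip ?M (E n) h - L2_ip ?M E' h) \<longlonglongrightarrow> L2_ip ?M E' h - L2_ip ?M E' h"
      using E' h by (intro tendsto_intros) (auto simp: L2_weakly_converges_iff)
    moreover have "L2_ip ?M (e n) h = L2_ip ?M (E n) h - L2_ip ?M E' h" for n
      unfolding e_def by (intro L2_ip_diff_left BE sq' h)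
    ultimately show ?thesis by simp
  qed
  have eH: "(\<lambda>n. \<integral>x. \<phi> x * (e n x \<bullet> H n x) \<partial>?M) \<longlonglongrightarrow> 0"
  proof (rule LIMSEQ_I)
    fix \<eta> :: real assume "0 < \<eta>"
    have "0 \<le> K" using order_trans[OF normsq_nonneg K(1)] .
    \<comment> \<open>The cutoff error is at most \<open>\<eta>'\<close> times two norm bounds
      \<open>K\<close>, that is at most \<open>\<eta> / 2\<close>; the 1 keeps the denominator
      positive.\<close>
    define \<eta>' where "\<eta>' = \<eta> / (4 * (K + 1))"
    have \<eta>': "0 < \<eta>'" "\<eta>' * (2 * K) \<le> \<eta> / 2"
      using \<open>0 < \<eta>\<close> \<open>0 \<le> K\<close> by (auto simp: \<eta>'_def field_simps)
    obtain \<psi> where \<psi>: "\<psi> \<in> test_functions \<Omega>" "\<And>x. \<bar>\<phi> x - \<phi> x * \<psi> x\<bar> \<le> \<eta>'"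
      by (rule test_functions_soft_cutoff[OF \<phi> \<eta>'(1)]) blast
    have "(\<lambda>n. \<integral>x. \<phi> x * \<psi> x * (e n x \<bullet> H n x) \<partial>?M) \<longlonglongrightarrow> 0"
      by (rule div_curl_local[OF \<Omega> \<phi> \<psi>(1) e K(1) c K(2) BH(1) K(3) BD(1) K(4) curl_e _ weak])
        (use div(1) in \<open>auto simp: has_weak_div_def\<close>)
    from LIMSEQ_D[OF this, of "\<eta> / 2"] \<open>0 < \<eta>\<close>
    obtain N where N: "\<And>n. n \<ge> N \<Longrightarrow> \<bar>\<integral>x. \<phi> x * \<psi> x * (e n x \<bullet> H n x) \<partial>?M\<bar> < \<eta> / 2"
      by auto
    have "norm ((\<integral>x. \<phi> x * (e n x \<bullet> H n x) \<partial>?M) - 0) < \<eta>" if "n \<ge> N" for n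
    proof -
      have int: "integrable ?M (\<lambda>x. \<theta> x * (e n x \<bullet> H n x))" if "\<theta> \<in> test_functions \<Omega>" for \<theta>
        using sq_integrable_inner[OF test_function_integrable(1)[OF \<Omega> that e[of n]] BH(1)[of n]] by simp
      have \<phi>\<psi>: "(\<lambda>x. \<phi> x * \<psi> x) \<in> test_functions \<Omega>"
        by (intro test_functions_mult[OF \<phi>] test_functionsD(1)[OF \<psi>(1)])
      have "\<bar>(\<integral>x. \<phi> x * (e n x \<bullet> H n x) \<partial>?M) - (\<integral>x. \<phi> x * \<psi> x * (e n x \<bullet> H n x) \<partial>?M)\<bar>
          = \<bar>\<integral>x. \<phi> x * (e n x \<bullet> H n x) - \<phi> x * \<psi> x * (e n x \<bullet> H n x) \<partial>?M\<bar>"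
        by (subst Bochner_Integration.integral_diff[OF int[OF \<phi>] int[OF \<phi>\<psi>]]) simp
      also have "\<dots> \<le> (\<integral>x. \<eta>' * ((norm (e n x))\<^sup>2 + (norm (H n x))\<^sup>2) \<partial>?M)"
      proof (rule integral_abs_bound_integral)
        show "integrable ?M (\<lambda>x. \<phi> x * (e n x \<bullet> H n x) - \<phi> x * \<psi> x * (e n x \<bullet> H n x))"
          by (intro Bochner_Integration.integrable_diff int \<phi> \<phi>\<psi>)
        show "integrable ?M (\<lambda>x. \<eta>' * ((norm (e n x))\<^sup>2 + (norm (H n x))\<^sup>2))"
          by (intro integrable_mult_right Bochner_Integration.integrable_add sq_integrableD e BH)
        fix x
        have "\<bar>\<phi> x * (e n x \<bullet> H n x) - \<phi> x * \<psi> x * (e n x \<bullet> H n x)\<bar> = \<bar>\<phi> x - \<phi> x * \<psi> x\<bar> * \<bar>e n x \<bullet> H n x\<bar>"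
          by (simp flip: abs_mult add: algebra_simps)
        also have "\<dots> \<le> \<eta>' * ((norm (e n x))\<^sup>2 + (norm (H n x))\<^sup>2)"
          using \<eta>'(1) by (intro mult_mono \<psi> order_trans[OF Cauchy_Schwarz_ineq2 norm_mult_le_sum_squares]) auto
        finally show "\<bar>\<phi> x * (e n x \<bullet> H n x) - \<phi> x * \<psi> x * (e n x \<bullet> H n x)\<bar> \<le> \<eta>' * ((norm (e n x))\<^sup>2 + (norm (H n x))\<^sup>2)" .
      qed
      also have "\<dots> = \<eta>' * (normsq ?M (e n) + normsq ?M (H n))"
        unfolding normsq_def integral_mult_right_zero
        by (subst Bochner_Integration.integral_add) (auto intro: sq_integrableD e BH)
      also have "\<dots> \<le> \<eta>' * (2 * K)"
        using \<eta>'(1) K(1,3)[of n] by (intro mult_left_mono) auto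
      finally show ?thesis
        using N[OF that] \<eta>'(2) by simp
    qed
    then show "\<exists>N. \<forall>n\<ge>N. norm ((\<integral>x. \<phi> x * (e n x \<bullet> H n x) \<partial>?M) - 0) < \<eta>" by blast
  qed
  have \<phi>E': "sq_integrable ?M (\<lambda>x. \<phi> x *\<^sub>R E' x)"
    by (rule test_function_integrable(1)[OF \<Omega> \<phi> sq'(1)])
  \<comment> \<open>The linear remainder: \<open>\<phi> x *\<^sub>R E' x\<close> is an admissible
    field for the weak convergence of \<open>H n\<close>.\<close>
  have "(\<lambda>n. L2_ip ?M (H n) (\<lambda>x. \<phi> x *\<^sub>R E' x)) \<longlonglongrightarrow> L2_ip ?M H' (\<lambda>x. \<phi> x *\<^sub>R E' x)"
    using H' \<phi>E' by (auto simp: L2_weakly_converges_iff)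
  from tendsto_add[OF eH this]
  have "(\<lambda>n. (\<integral>x. \<phi> x * (e n x \<bullet> H n x) \<partial>?M) + L2_ip ?M (H n) (\<lambda>x. \<phi> x *\<^sub>R E' x)) \<longlonglongrightarrow> L2_ip ?M H' (\<lambda>x. \<phi> x *\<^sub>R E' x)"
    by simp
  moreover have "(\<integral>x. \<phi> x * (e n x \<bullet> H n x) \<partial>?M) + L2_ip ?M (H n) (\<lambda>x. \<phi> x *\<^sub>R E' x) = (\<integral>x. \<phi> x * (E n x \<bullet> H n x) \<partial>?M)" for n
  proof -
    have 1: "integrable ?M (\<lambda>x. \<phi> x * (e n x \<bullet> H n x))"
      using sq_integrable_inner[OF test_function_integrable(1)[OF \<Omega> \<phi> e[of n]] BH(1)[of n]] by simp
    have 2: "integrable ?M (\<lambda>x. H n x \<bullet> (\<phi> x *\<^sub>R E' x))"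
      by (rule sq_integrable_inner[OF BH(1) \<phi>E'])
    show ?thesis
      unfolding L2_ip_def Bochner_Integration.integral_add[OF 1 2, symmetric]
      by (intro Bochner_Integration.integral_cong refl)
        (simp add: e_def inner_diff_left inner_commute[of "H n _"] algebra_simps)
  qed
  moreover have "L2_ip ?M H' (\<lambda>x. \<phi> x *\<^sub>R E' x) = (\<integral>x. \<phi> x * (E' x \<bullet> H' x) \<partial>?M)"
    by (simp add: L2_ip_def inner_commute)
  ultimately show ?thesis by simp
qed

theorem corollary3:
  fixes \<Omega> :: "(real^3) set"
    and E H curlE :: "nat \<Rightarrow> real^3 \<Rightarrow> real^3"
    and divH :: "nat \<Rightarrow> real^3 \<Rightarrow> real"
  assumes "open \<Omega>"
    and "L2_bounded \<Omega> E" and "L2_bounded \<Omega> H"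
    and "\<And>n. has_weak_curl \<Omega> (E n) (curlE n)" and "L2_bounded \<Omega> curlE"
    and "\<And>n. has_weak_div \<Omega> (H n) (divH n)" and "L2_bounded \<Omega> divH"
  shows "\<exists>E' H' curlE' divH' r.
    E' \<in> L2 \<Omega> \<and> H' \<in> L2 \<Omega> \<and>
    has_weak_curl \<Omega> E' curlE' \<and> curlE' \<in> L2 \<Omega> \<and>
    has_weak_div \<Omega> H' divH' \<and> divH' \<in> L2 \<Omega> \<and>
    strict_mono (r :: nat \<Rightarrow> nat) \<and>
    L2_weakly_converges \<Omega> (\<lambda>n. E (r n)) E' \<and>
    L2_weakly_converges \<Omega> (\<lambda>n. curlE (r n)) curlE' \<and>
    L2_weakly_converges \<Omega> (\<lambda>n. H (r n)) H' \<and>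
    L2_weakly_converges \<Omega> (\<lambda>n. divH (r n)) divH' \<and>
    (\<forall>\<phi>\<in>test_functions \<Omega>.
       (\<lambda>n. \<integral>x. \<phi> x * (E (r n) x \<bullet> H (r n) x) \<partial>lebesgue_on \<Omega>)
         \<longlonglongrightarrow> (\<integral>x. \<phi> x * (E' x \<bullet> H' x) \<partial>lebesgue_on \<Omega>))"
proof -
  \<comment> \<open>Each extraction is applied to the sequence already thinned by the previous ones,
    which stays bounded; weak limits found earlier survive passage to the common
    subsequence.\<close>
  obtain r1 E' where r1: "strict_mono r1" and 1: "L2_weakly_converges \<Omega> (\<lambda>n. E (r1 n)) E'"
    by (rule L2_weak_compactness[OF assms(2)])
  obtain r2 curlE' where r2: "strict_mono r2" and 2: "L2_weakly_converges \<Omega> (\<lambda>n. curlE (r1 (r2 n))) curlE'"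
    by (rule L2_weak_compactness[OF L2_bounded_subseq[OF assms(5), of r1]])
  obtain r3 H' where r3: "strict_mono r3" and 3: "L2_weakly_converges \<Omega> (\<lambda>n. H (r1 (r2 (r3 n)))) H'"
    by (rule L2_weak_compactness[OF L2_bounded_subseq[OF assms(3), of "\<lambda>n. r1 (r2 n)"]])
  obtain r4 divH' where r4: "strict_mono r4" and 4: "L2_weakly_converges \<Omega> (\<lambda>n. divH (r1 (r2 (r3 (r4 n))))) divH'"
    by (rule L2_weak_compactness[OF L2_bounded_subseq[OF assms(7), of "\<lambda>n. r1 (r2 (r3 n))"]])
  define r where "r n = r1 (r2 (r3 (r4 n)))" for n
  have r: "strict_mono r"
    using r1 r2 r3 r4 by (auto simp: r_def strict_mono_def)
  have r34: "strict_mono (\<lambda>n. r3 (r4 n))" and r234: "strict_mono (\<lambda>n. r2 (r3 (r4 n)))"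
    using r2 r3 r4 by (auto simp: strict_mono_def)
  have E: "L2_weakly_converges \<Omega> (\<lambda>n. E (r n)) E'"
    unfolding r_def by (rule L2_weakly_converges_subseq[OF 1 r234])
  have C: "L2_weakly_converges \<Omega> (\<lambda>n. curlE (r n)) curlE'"
    unfolding r_def by (rule L2_weakly_converges_subseq[OF 2 r34])
  have H: "L2_weakly_converges \<Omega> (\<lambda>n. H (r n)) H'"
    unfolding r_def by (rule L2_weakly_converges_subseq[OF 3 r4])
  have D: "L2_weakly_converges \<Omega> (\<lambda>n. divH (r n)) divH'"
    unfolding r_def by (rule 4)
  have "has_weak_curl \<Omega> E' curlE'"
    by (rule has_weak_curl_limit[OF assms(1,4) E C])
  moreover have "has_weak_div \<Omega> H' divH'"
    by (rule has_weak_div_limit[OF assms(1,6) H D])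
  moreover have "(\<lambda>n. \<integral>x. \<phi> x * (E (r n) x \<bullet> H (r n) x) \<partial>lebesgue_on \<Omega>)
      \<longlonglongrightarrow> (\<integral>x. \<phi> x * (E' x \<bullet> H' x) \<partial>lebesgue_on \<Omega>)" if "\<phi> \<in> test_functions \<Omega>" for \<phi>
    by (rule div_curl_lemma[OF assms(1) that assms(4) L2_bounded_subseq[OF assms(5)] assms(6) L2_bounded_subseq[OF assms(7)]
      L2_bounded_subseq[OF assms(2)] L2_bounded_subseq[OF assms(3)] E C H])
  ultimately show ?thesis
    using r E C H D by (intro exI[of _ E'] exI[of _ H'] exI[of _ curlE'] exI[of _ divH'] exI[of _ r])
      (auto simp: L2_weakly_converges_def)
qed

end
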